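(* Let $M\in\{1,2\}$ and let $F:\mathbb R^2\to\mathbb R^2$, $G=(G_1,\dots,G_M):\mathbb R^2\to\mathbb M_{2\times M}$ satisfy: (1) $F,G$ are of class $\mathcal C^{1,1}$ with all partial derivatives Lipschitz with constant $L$; (2) $F(0)=0$; (3) $\mathrm{rank}[G_i(0),DF(0)G_i(0)]=2$ for $i=1,\dots,M$; (4) $DG(0)=0$. Let $T$ be the minimum time function to reach the origin for $\dot x=F(x)+G(x)u$, $u\in[-1,1]^M$, let $\mathcal T>0$ be as in the context, fix $0<\tau<\mathcal T$ and define $$S=\{x\in\mathcal R_\tau:\ \exists\zeta\in\mathbb S^1\cap N_{\mathcal R_{T(x)}}(x)\text{ with } h(x,\zeta)=0\}.$$ Then $S$ is countably $\mathcal H^1$-rectifiable. Moreover, for every $\bar x\in S$ there exists $\delta>0$ such that $\mathcal H^1(S\cap B(\bar x,\delta))>0$.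
   Context: $\mathcal R_t=\{x: T(x)\le t\}$. Minimized Hamiltonian: $h(x,p)=\langle p,F(x)\rangle-\sum_{i=1}^M|\langle p,G_i(x)\rangle|$. $N_K(x)$ is the proximal normal cone: $v\in N_K(x)$ iff $\exists\sigma\ge0$ with $\langle v,y-x\rangle\le\sigma\|y-x\|^2$ for all $y\in K$. It is known (under (1)–(4)) that there exists $\mathcal T>0$, depending only on $L$, $DF(0)$, $G(0)$, such that for all $0<\tau<\mathcal T$: (a) $\mathcal R_\tau$ is strictly convex and each $x\in\mathrm{bdry}\,\mathcal R_\tau$ has a unique optimal control to the origin, bang-bang with finitely many switchings; (b) every $x\in\mathcal R_\tau$ is an optimal point; (c) $\mathrm{epi}(T)$ has locally positive reach; $\mathcal T$ denotes such a constant. $\mathcal H^1$ is one-dimensional Hausdorff measure. *)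

theory Defs
  imports "HOL-Analysis.Analysis"
begin

text \<open>Controls are u :: real => nat => real, component i < M. A trajectory on [0,t]
  is a Caratheodory solution written in integral form.\<close>

definition admissible_control :: "nat \<Rightarrow> real \<Rightarrow> (real \<Rightarrow> nat \<Rightarrow> real) \<Rightarrow> bool" where
  "admissible_control M t u \<longleftrightarrow>
     (\<forall>i<M. (\<lambda>s. u s i) \<in> borel_measurable (lebesgue_on {0..t}) \<and> (\<forall>s\<in>{0..t}. \<bar>u s i\<bar> \<le> 1))"

definition trajectory ::
  "(real^2 \<Rightarrow> real^2) \<Rightarrow> (nat \<Rightarrow> real^2 \<Rightarrow> real^2) \<Rightarrow> nat \<Rightarrow> real
    \<Rightarrow> (real \<Rightarrow> nat \<Rightarrow> real) \<Rightarrow> (real \<Rightarrow> real^2) \<Rightarrow> bool" where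
  "trajectory F G M t u y \<longleftrightarrow> 0 \<le> t \<and> admissible_control M t u \<and> continuous_on {0..t} y \<and>
     (\<forall>s\<in>{0..t}. ((\<lambda>r. F (y r) + (\<Sum>i<M. u r i *\<^sub>R G i (y r))) has_integral (y s - y 0)) {0..s})"

definition reaches_origin ::
  "(real^2 \<Rightarrow> real^2) \<Rightarrow> (nat \<Rightarrow> real^2 \<Rightarrow> real^2) \<Rightarrow> nat \<Rightarrow> real^2 \<Rightarrow> real \<Rightarrow> bool" where
  "reaches_origin F G M x t \<longleftrightarrow> (\<exists>u y. trajectory F G M t u y \<and> y 0 = x \<and> y t = 0)"

text \<open>Minimum time function (value +infinity if the origin cannot be reached).\<close>
definition min_time ::
  "(real^2 \<Rightarrow> real^2) \<Rightarrow> (nat \<Rightarrow> real^2 \<Rightarrow> real^2) \<Rightarrow> nat \<Rightarrow> real^2 \<Rightarrow> ereal" where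
  "min_time F G M x = Inf {ereal t | t. reaches_origin F G M x t}"

definition reach_set ::
  "(real^2 \<Rightarrow> real^2) \<Rightarrow> (nat \<Rightarrow> real^2 \<Rightarrow> real^2) \<Rightarrow> nat \<Rightarrow> ereal \<Rightarrow> (real^2) set" where
  "reach_set F G M r = {x. min_time F G M x \<le> r}"

definition hamiltonian ::
  "(real^2 \<Rightarrow> real^2) \<Rightarrow> (nat \<Rightarrow> real^2 \<Rightarrow> real^2) \<Rightarrow> nat \<Rightarrow> real^2 \<Rightarrow> real^2 \<Rightarrow> real" where
  "hamiltonian F G M x p = p \<bullet> F x - (\<Sum>i<M. \<bar>p \<bullet> G i x\<bar>)"

definition prox_normal :: "'a::real_inner set \<Rightarrow> 'a \<Rightarrow> 'a set" where
  "prox_normal K x = {v. \<exists>\<sigma>\<ge>0. \<forall>y\<in>K. v \<bullet> (y - x) \<le> \<sigma> * (norm (y - x))\<^sup>2}"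

definition hausdorff1_delta :: "real \<Rightarrow> 'a::metric_space set \<Rightarrow> ennreal" where
  "hausdorff1_delta \<delta> A = (INF C \<in> {C :: nat \<Rightarrow> 'a set. A \<subseteq> (\<Union>k. C k) \<and>
        (\<forall>k. bounded (C k) \<and> diameter (C k) \<le> \<delta>)}. (\<Sum>k. ennreal (diameter (C k))))"

definition hausdorff1 :: "'a::metric_space set \<Rightarrow> ennreal" where
  "hausdorff1 A = (SUP \<delta> \<in> {0<..}. hausdorff1_delta \<delta> A)"

definition countably_H1_rectifiable :: "'a::metric_space set \<Rightarrow> bool" where
  "countably_H1_rectifiable S \<longleftrightarrow>
     (\<exists>f :: nat \<Rightarrow> real \<Rightarrow> 'a. (\<forall>k. \<exists>C. C-lipschitz_on UNIV (f k)) \<and>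
        hausdorff1 (S - (\<Union>k. range (f k))) = 0)"

definition optimal_control ::
  "(real^2 \<Rightarrow> real^2) \<Rightarrow> (nat \<Rightarrow> real^2 \<Rightarrow> real^2) \<Rightarrow> nat \<Rightarrow> real^2 \<Rightarrow> (real \<Rightarrow> nat \<Rightarrow> real) \<Rightarrow> bool" where
  "optimal_control F G M x u \<longleftrightarrow>
     (\<exists>t y. ereal t = min_time F G M x \<and> trajectory F G M t u y \<and> y 0 = x \<and> y t = 0)"

definition bang_bang :: "nat \<Rightarrow> real \<Rightarrow> (real \<Rightarrow> nat \<Rightarrow> real) \<Rightarrow> bool" where
  "bang_bang M t u \<longleftrightarrow> (\<exists>P. finite P \<and> (\<forall>i<M. \<forall>s\<in>{0..t} - P. \<bar>u s i\<bar> = 1 \<and>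
        (\<exists>e>0. \<forall>r\<in>{0..t} - P. \<bar>r - s\<bar> < e \<longrightarrow> u r i = u s i)))"

definition unique_bang_bang_optimal ::
  "(real^2 \<Rightarrow> real^2) \<Rightarrow> (nat \<Rightarrow> real^2 \<Rightarrow> real^2) \<Rightarrow> nat \<Rightarrow> real^2 \<Rightarrow> bool" where
  "unique_bang_bang_optimal F G M x \<longleftrightarrow>
     (\<exists>u. optimal_control F G M x u \<and> bang_bang M (real_of_ereal (min_time F G M x)) u \<and>
        (\<forall>u'. optimal_control F G M x u' \<longrightarrow>
           (\<forall>i<M. AE s in lebesgue_on {0..real_of_ereal (min_time F G M x)}. u' s i = u s i)))"

definition strictly_convex :: "'a::real_normed_vector set \<Rightarrow> bool" where
  "strictly_convex K \<longleftrightarrow> convex K \<and>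
     (\<forall>x\<in>K. \<forall>y\<in>K. x \<noteq> y \<longrightarrow> (\<forall>l\<in>{0<..<1}. (1 - l) *\<^sub>R x + l *\<^sub>R y \<in> interior K))"

definition optimal_point ::
  "(real^2 \<Rightarrow> real^2) \<Rightarrow> (nat \<Rightarrow> real^2 \<Rightarrow> real^2) \<Rightarrow> nat \<Rightarrow> real^2 \<Rightarrow> bool" where
  "optimal_point F G M x \<longleftrightarrow>
     (\<exists>z u y t s. ereal t = min_time F G M z \<and> trajectory F G M t u y \<and> y 0 = z \<and> y t = 0 \<and>
        0 < s \<and> s \<le> t \<and> y s = x)"

definition epigraph_time ::
  "(real^2 \<Rightarrow> real^2) \<Rightarrow> (nat \<Rightarrow> real^2 \<Rightarrow> real^2) \<Rightarrow> nat \<Rightarrow> ((real^2) \<times> real) set" where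
  "epigraph_time F G M = {(x, b). min_time F G M x \<le> ereal b}"

definition positive_reach_at :: "'a::metric_space set \<Rightarrow> 'a \<Rightarrow> bool" where
  "positive_reach_at A a \<longleftrightarrow>
     (\<exists>r>0. \<forall>p. dist p a < r \<longrightarrow> (\<exists>!q. q \<in> A \<and> (\<forall>q'\<in>A. dist p q \<le> dist p q')))"

definition good_horizon ::
  "(real^2 \<Rightarrow> real^2) \<Rightarrow> (nat \<Rightarrow> real^2 \<Rightarrow> real^2) \<Rightarrow> nat \<Rightarrow> real \<Rightarrow> bool" where
  "good_horizon F G M Tc \<longleftrightarrow> 0 < Tc \<and>
     (\<forall>\<tau>\<in>{0<..<Tc}.
        strictly_convex (reach_set F G M (ereal \<tau>)) \<and>
        (\<forall>x\<in>frontier (reach_set F G M (ereal \<tau>)). unique_bang_bang_optimal F G M x) \<and>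
        (\<forall>x\<in>reach_set F G M (ereal \<tau>). optimal_point F G M x) \<and>
        (\<forall>a\<in>epigraph_time F G M. fst a \<in> reach_set F G M (ereal \<tau>) \<longrightarrow>
            positive_reach_at (epigraph_time F G M) a))"

end

theory Submission
  imports Defs
begin

text \<open>Call a point singular if its reachable set has a unit normal annihilating the minimized Hamiltonian.
  Along an optimal trajectory issuing from a singular point every later point is singular, and there the
  normal is orthogonal to the velocity; in the plane the transported normal is therefore an explicit
  multiple of the rotated velocity, so no adjoint equation has to be solved. Two trajectories of singular
  points that merge with the same normal and the same direction of motion are graphs over their common
  tangent, and the minimum condition of each along the other forces the graphs to coincide; since the
  minimum time is a function of the position, they then coincide as trajectories. Convexity of the
  reachable sets excludes cusps in the same way. At the origin the velocity is parallel to
  \<open>G\<^sub>1(0)\<close>, which leaves four possible terminal configurations. So the singular set is a countable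
  union of Lipschitz arcs ending at the origin, and it contains a nontrivial continuum near each of its
  nonzero points. If the origin itself is singular, a backward arc with a suitable constant control
  consists of singular points, which is shown by a quadratic Lyapunov function.\<close>

section \<open>Differential inequalities and Lipschitz flows\<close>

text \<open>The fields are only C^1 with Lipschitz derivative, so Taylor remainders are quadratic
  and nothing finer is available. Comparisons are therefore reduced to scalar quantities, mostly the
  determinant of a velocity and a displacement, whose derivative closes up to such a remainder.
  Controls jump at switching times, so a normal is known arc by arc as a multiple \<open>l\<close>
  of the rotated velocity; gluing arcs means controlling the sign of \<open>l\<close> and the sense
  of the velocity. The origin is the hard point. \<open>R 0\<close> is a single point, every unit
  vector is normal there, and singularity only says that some unit vector is orthogonal to all
  \<open>G i 0\<close>; no curve comes with it. The arc constructed there must be compared with all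
  trajectories at once. Its determinant \<open>b\<close> alone does not suffice, since the remainder
  also sees the tangential displacement \<open>a\<close>; adding a positive multiple of
  \<open>a\<^sup>2\<close> controls that. The rank condition makes the switching functions at least
  linear in \<open>s\<close>, so a deviating control pays in proportion to \<open>s\<close>, and
  this covers the terms created by the square.\<close>

lemma gronwall_upper:
  fixes W W' :: "real \<Rightarrow> real"
  assumes "a \<le> b" and cont: "continuous_on {a..b} W" and "W a \<le> 0" and fin: "finite P"
    and der: "\<And>s. s \<in> {a<..<b} - P \<Longrightarrow> (W has_real_derivative W' s) (at s)"
    and bd: "\<And>s. s \<in> {a<..<b} - P \<Longrightarrow> W s > 0 \<Longrightarrow> W' s \<le> k * W s + m"
    and "k \<ge> 0" "m \<ge> 0"
  shows "W b \<le> m * (b - a) * exp (k * (b - a))"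
proof (cases "W b \<le> 0")
  case True
  then show ?thesis using assms by (smt (verit) exp_ge_zero mult_nonneg_nonneg)
next
  case False
  \<comment> \<open>The bound on \<open>W'\<close> is assumed only where \<open>W > 0\<close>, so
    the estimate starts at the last time \<open>c\<close> at which \<open>W\<close> is
    nonpositive.\<close>
  define A where "A = {s \<in> {a..b}. W s \<le> 0}"
  have "closed A"
    unfolding A_def using continuous_closed_preimage[OF cont, of "{..0}"]
    by (simp add: vimage_def Int_def)
  have "a \<in> A" using assms by (auto simp: A_def)
  have bddA: "bdd_above A" by (auto simp: A_def)
  define c where "c = Sup A"
  have "c \<in> A" unfolding c_def
    using closed_contains_Sup[OF _ bddA \<open>closed A\<close>] \<open>a \<in> A\<close> by auto
  then have c: "a \<le> c" "c < b" "W c \<le> 0" using False by (auto simp: A_def less_le)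
  have pos: "W s > 0" if "c < s" "s \<le> b" for s
  proof (rule ccontr)
    assume "\<not> W s > 0"
    then have "s \<in> A" using that c by (auto simp: A_def)
    then have "s \<le> c" unfolding c_def by (rule cSup_upper[OF _ bddA])
    then show False using that by simp
  qed
  define V where "V s = W s * exp (- k * (s - c)) - m * (s - c)" for s
  \<comment> \<open>The value 0 at exceptional points makes the derivative nonpositive everywhere,
    so that integrals can be compared.\<close>
  define V' where "V' s = (if s \<in> {c<..<b} - P then
      W' s * exp (- k * (s - c)) + W s * (- k * exp (- k * (s - c))) - m else 0)" for s
  have I: "(V' has_integral (V b - V c)) {c..b}"
  proof (rule fundamental_theorem_of_calculus_interior_strong[OF fin])
    fix s assume s: "s \<in> {c<..<b} - P"
    then have "(W has_real_derivative W' s) (at s)" using der c by auto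
    from this have "(V has_real_derivative V' s) (at s)"
      unfolding V_def[abs_def] V'_def using s by (auto intro!: derivative_eq_intros)
    then show "(V has_vector_derivative V' s) (at s)"
      by (simp add: has_real_derivative_iff_has_vector_derivative)
  next
    show "continuous_on {c..b} V" unfolding V_def[abs_def]
      using c by (intro continuous_intros continuous_on_subset[OF cont]) auto
  qed (use c in auto)
  have V': "V' s \<le> 0" for s
  proof (cases "s \<in> {c<..<b} - P")
    case True
    then have "W' s \<le> k * W s + m" using bd pos c by auto
    then have "(W' s - k * W s) * exp (- k * (s - c)) \<le> m * exp (- k * (s - c))"
      by (intro mult_right_mono) auto
    also have "\<dots> \<le> m * 1" using \<open>m \<ge> 0\<close> \<open>k \<ge> 0\<close> True by (intro mult_left_mono) auto
    finally show ?thesis using True by (simp add: V'_def algebra_simps)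
  qed (auto simp: V'_def)
  have "V b - V c \<le> 0"
    by (rule has_integral_le[OF I has_integral_0]) (rule V')
  then have "W b * exp (- k * (b - c)) \<le> m * (b - c)" using c by (simp add: V_def)
  then have "W b * exp (- k * (b - c)) * exp (k * (b - c)) \<le> m * (b - c) * exp (k * (b - c))"
    by (intro mult_right_mono) auto
  then have "W b \<le> m * (b - c) * exp (k * (b - c))"
    by (simp add: mult.assoc flip: exp_add)
  also have "\<dots> \<le> m * (b - a) * exp (k * (b - a))"
    using c \<open>k \<ge> 0\<close> \<open>m \<ge> 0\<close> by (intro mult_mono) (auto intro!: mult_left_mono)
  finally show ?thesis .
qed

text \<open>The fixed point is the solution multiplied by \<open>exp (- 2*C*t)\<close>. With this
  weight the integral operator contracts by 1/2 whatever the length \<open>h\<close>, so no short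
  intervals have to be patched; clamping time to \<open>{0..h}\<close> lets it act on bounded
  continuous functions on the whole line.\<close>

lemma picard_exists:
  fixes f :: "'a::euclidean_space \<Rightarrow> 'a"
  assumes lip: "C-lipschitz_on UNIV f" and "C > 0" and h: "h \<ge> 0"
  obtains y where "y 0 = x0" "\<And>s. s \<in> {0..h} \<Longrightarrow> (y has_vector_derivative f (y s)) (at s within {0..h})"
proof -
  have contf: "continuous_on A f" for A
    using lipschitz_on_continuous_on[OF lip] continuous_on_subset by blast
  define cl where "cl t = max 0 (min h t)" for t :: real
  have cl: "cl t \<in> {0..h}" for t using h by (auto simp: cl_def)
  have contcl: "continuous_on UNIV cl"
    unfolding cl_def[abs_def] by (intro continuous_on_max continuous_on_min continuous_on_const continuous_on_id)
  define I where "I w t = integral {0..t} (\<lambda>r. f (exp (2*C*r) *\<^sub>R apply_bcontfun w r))" for w :: "real \<Rightarrow>\<^sub>C 'a" and t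
  have cint: "continuous_on A (\<lambda>r. f (exp (2*C*r) *\<^sub>R apply_bcontfun w r))" for w :: "real \<Rightarrow>\<^sub>C 'a" and A
    by (intro continuous_on_compose2[OF contf[of UNIV]] continuous_intros) auto
  have contI: "continuous_on {0..h} (I w)" for w
    unfolding I_def by (intro indefinite_integral_continuous_1 integrable_continuous_interval cint)
  define Psi where "Psi w t = exp (- 2*C*cl t) *\<^sub>R (x0 + I w (cl t))" for w t
  have contPsi: "continuous_on UNIV (Psi w)" for w
    unfolding Psi_def[abs_def]
    by (intro continuous_intros continuous_on_compose2[OF contI] contcl) (use cl in auto)
  have bddPsi: "Psi w \<in> bcontfun" for w
  proof -
    have "compact (Psi w ` {0..h})"
      by (intro compact_continuous_image continuous_on_subset[OF contPsi]) auto
    moreover have "range (Psi w) \<subseteq> Psi w ` {0..h}"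
    proof safe
      fix t
      have "Psi w t = Psi w (cl t)" by (auto simp: Psi_def cl_def max_def min_def)
      then show "Psi w t \<in> Psi w ` {0..h}" using cl by blast
    qed
    ultimately have "bounded (range (Psi w))" using bounded_subset compact_imp_bounded by blast
    then show ?thesis using contPsi by (auto simp: bcontfun_def)
  qed
  define Ph where "Ph w = Bcontfun (Psi w)" for w
  have Ph: "apply_bcontfun (Ph w) = Psi w" for w
    unfolding Ph_def using bddPsi Bcontfun_inverse by blast
  have contr: "dist (Ph w) (Ph w') \<le> 1/2 * dist w w'" for w w'
  proof (rule dist_bound)
    fix t
    define s where "s = cl t"
    have s: "0 \<le> s" "s \<le> h" using cl[of t] by (auto simp: s_def)
    have "norm (I w s - I w' s) \<le> integral {0..s} (\<lambda>r. C * exp (2*C*r) * dist w w')"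
      unfolding I_def
    proof (subst integral_diff[symmetric])
      show "norm (integral {0..s} (\<lambda>r. f (exp (2*C*r) *\<^sub>R apply_bcontfun w r) - f (exp (2*C*r) *\<^sub>R apply_bcontfun w' r)))
        \<le> integral {0..s} (\<lambda>r. C * exp (2*C*r) * dist w w')"
      proof (rule integral_norm_bound_integral)
        fix r
        have "norm (f (exp (2*C*r) *\<^sub>R apply_bcontfun w r) - f (exp (2*C*r) *\<^sub>R apply_bcontfun w' r))
           \<le> C * dist (exp (2*C*r) *\<^sub>R apply_bcontfun w r) (exp (2*C*r) *\<^sub>R apply_bcontfun w' r)"
          using lipschitz_onD[OF lip] by (simp add: dist_norm)
        also have "\<dots> = C * (exp (2*C*r) * dist (apply_bcontfun w r) (apply_bcontfun w' r))"
          by (simp add: dist_norm scaleR_right_diff_distrib[symmetric])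
        also have "\<dots> \<le> C * (exp (2*C*r) * dist w w')"
          using \<open>C > 0\<close> by (intro mult_left_mono dist_bounded) auto
        finally show "norm (f (exp (2*C*r) *\<^sub>R apply_bcontfun w r) - f (exp (2*C*r) *\<^sub>R apply_bcontfun w' r))
           \<le> C * exp (2*C*r) * dist w w'" by (simp add: mult.assoc)
      qed (intro integrable_continuous_interval continuous_intros cint)+
    qed (intro integrable_continuous_interval cint)+
    also have "integral {0..s} (\<lambda>r. C * exp (2*C*r) * dist w w') = (exp (2*C * s) - 1) / 2 * dist w w'"
    proof (rule integral_unique)
      have "((\<lambda>r. C * exp (2*C*r) * dist w w') has_integral
          (exp (2*C * s) / 2 * dist w w' - exp (2*C*0) / 2 * dist w w')) {0..s}"
        using s by (intro fundamental_theorem_of_calculus)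
          (auto intro!: derivative_eq_intros simp flip: has_real_derivative_iff_has_vector_derivative)
      then show "((\<lambda>r. C * exp (2*C*r) * dist w w') has_integral (exp (2*C * s) - 1) / 2 * dist w w') {0..s}"
        by (simp add: algebra_simps diff_divide_distrib)
    qed
    also have "\<dots> \<le> exp (2*C * s) / 2 * dist w w'"
      by (intro mult_right_mono) auto
    finally have *: "norm (I w s - I w' s) \<le> exp (2*C * s) / 2 * dist w w'" .
    have "dist (Psi w t) (Psi w' t) = exp (- 2*C * s) * norm (I w s - I w' s)"
      by (simp add: Psi_def s_def dist_norm flip: scaleR_right_diff_distrib)
    also have "\<dots> \<le> exp (- 2*C * s) * (exp (2*C * s) / 2 * dist w w')"
      using * by (intro mult_left_mono) auto
    also have "\<dots> = 1/2 * dist w w'" by (simp add: exp_minus field_simps)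
    finally show "dist (apply_bcontfun (Ph w) t) (apply_bcontfun (Ph w') t) \<le> 1/2 * dist w w'"
      by (simp add: Ph)
  qed
  have "\<exists>!w\<in>UNIV. Ph w = w"
    by (rule Banach_fix[of UNIV "1/2"]) (use contr in \<open>auto simp: complete_UNIV\<close>)
  then obtain w where w: "Ph w = w" by auto
  define y where "y t = exp (2*C*t) *\<^sub>R apply_bcontfun w t" for t
  have y: "y t = x0 + I w t" if "t \<in> {0..h}" for t
  proof -
    have "cl t = t" using that by (auto simp: cl_def)
    then have "apply_bcontfun w t = exp (- 2*C*t) *\<^sub>R (x0 + I w t)"
      using Ph[of w] w by (simp add: Psi_def)
    then show ?thesis by (simp add: y_def exp_minus)
  qed
  show ?thesis
  proof (rule that[of y])
    show "y 0 = x0" using y[of 0] h by (simp add: I_def)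
    fix s assume s: "s \<in> {0..h}"
    have "((\<lambda>u. integral {0..u} (\<lambda>r. f (y r))) has_vector_derivative f (y s)) (at s within {0..h})"
      using s cint[of "{0..h}" w] unfolding y_def by (rule integral_has_vector_derivative[rotated])
    then have "((\<lambda>u. x0 + I w u) has_vector_derivative f (y s)) (at s within {0..h})"
      unfolding I_def y_def by (auto intro!: derivative_eq_intros)
    then show "(y has_vector_derivative f (y s)) (at s within {0..h})"
      by (rule has_vector_derivative_transform[OF s, rotated]) (simp add: y)
  qed
qed

text \<open>Testing against the unit vector in the direction of the increment reduces the vector
  case to a scalar inequality and tolerates the switching times in \<open>P\<close>.\<close>

lemma norm_increment_le:
  fixes z :: "real \<Rightarrow> 'a::euclidean_space"
  assumes "a \<le> b" and cont: "continuous_on {a..b} z" and fin: "finite P"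
    and der: "\<And>s. s \<in> {a<..<b} - P \<Longrightarrow> (z has_vector_derivative z' s) (at s)"
    and bd: "\<And>s. s \<in> {a<..<b} - P \<Longrightarrow> norm (z' s) \<le> B" and "B \<ge> 0"
  shows "norm (z b - z a) \<le> B * (b - a)"
proof (cases "z b = z a")
  case False
  define e where "e = (z b - z a) /\<^sub>R norm (z b - z a)"
  have e: "norm e = 1" "e \<bullet> (z b - z a) = norm (z b - z a)"
    using False by (auto simp: e_def dot_square_norm power2_eq_square)
  have "e \<bullet> (z b - z a) \<le> B * (b - a) * exp (0 * (b - a))"
  proof (rule gronwall_upper[OF \<open>a \<le> b\<close> _ _ fin])
    show "continuous_on {a..b} (\<lambda>s. e \<bullet> (z s - z a))" by (intro continuous_intros cont)
    fix s assume s: "s \<in> {a<..<b} - P"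
    show "((\<lambda>s. e \<bullet> (z s - z a)) has_real_derivative (e \<bullet> z' s)) (at s)"
      using der[OF s] unfolding has_real_derivative_iff_has_vector_derivative
      by (auto intro!: derivative_eq_intros bounded_linear.has_vector_derivative[OF bounded_linear_inner_right])
    show "e \<bullet> z' s \<le> 0 * (e \<bullet> (z s - z a)) + B"
      using norm_cauchy_schwarz[of e "z' s"] bd[OF s] e by simp
  qed (use \<open>B \<ge> 0\<close> in auto)
  then show ?thesis using e by simp
qed (use assms in auto)

text \<open>A bootstrap: the speed bound is known only inside the ball of radius \<open>R\<close>,
  but reaching its boundary would take longer than \<open>h\<close> because
  \<open>B * h < R\<close>.\<close>

lemma stays_in_ball:
  fixes z :: "real \<Rightarrow> 'a::euclidean_space"
  assumes "0 \<le> h" and cont: "continuous_on {0..h} z" and fin: "finite P"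
    and der: "\<And>s. s \<in> {0<..<h} - P \<Longrightarrow> (z has_vector_derivative z' s) (at s)"
    and bd: "\<And>s. s \<in> {0<..<h} - P \<Longrightarrow> norm (z s - z 0) \<le> R \<Longrightarrow> norm (z' s) \<le> B"
    and "B \<ge> 0" "B * h < R" "s \<in> {0..h}"
  shows "norm (z s - z 0) \<le> B * s"
proof -
  have le: "norm (z s - z 0) \<le> B * s"
    if "s \<in> {0..h}" "\<And>r. r \<in> {0..<s} \<Longrightarrow> norm (z r - z 0) \<le> R" for s
  proof -
    have "norm (z s - z 0) \<le> B * (s - 0)"
      using that \<open>B \<ge> 0\<close> by (intro norm_increment_le[OF _ continuous_on_subset[OF cont] fin der bd]) auto
    then show ?thesis by simp
  qed
  have "norm (z r - z 0) \<le> R" if "r \<in> {0..h}" for r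
  proof (rule ccontr)
    assume r: "\<not> norm (z r - z 0) \<le> R"
    define A where "A = {r \<in> {0..h}. norm (z r - z 0) \<in> {R..}}"
    have "closed A" unfolding A_def
      using continuous_closed_preimage[of "{0..h}" "\<lambda>r. norm (z r - z 0)" "{R..}"]
      by (simp add: vimage_def Int_def continuous_intros cont)
    have "r \<in> A" using that r by (auto simp: A_def)
    have bddA: "bdd_below A" by (auto simp: A_def)
    define c where "c = Inf A"
    have "c \<in> A" unfolding c_def
      using closed_contains_Inf[OF _ bddA \<open>closed A\<close>] \<open>r \<in> A\<close> by auto
    moreover have "norm (z c - z 0) \<le> B * c"
    proof (rule le)
      show "c \<in> {0..h}" using \<open>c \<in> A\<close> by (auto simp: A_def)
      fix r assume r: "r \<in> {0..<c}"
      then have "r \<notin> A" using cInf_lower[OF _ bddA, of r] by (auto simp: c_def)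
      then show "norm (z r - z 0) \<le> R" using r \<open>c \<in> A\<close> by (auto simp: A_def)
    qed
    moreover have "B * c \<le> B * h" using \<open>c \<in> A\<close> \<open>B \<ge> 0\<close> by (intro mult_left_mono) (auto simp: A_def)
    ultimately show False using \<open>B * h < R\<close> by (auto simp: A_def)
  qed
  then show ?thesis using \<open>s \<in> {0..h}\<close> by (intro le) auto
qed

section \<open>One-dimensional Hausdorff measure\<close>

lemma hausdorff1_empty: "hausdorff1 ({} :: 'a::metric_space set) = 0"
proof -
  have "hausdorff1_delta d ({} :: 'a set) = 0" if "d > 0" for d
  proof -
    have "hausdorff1_delta d ({} :: 'a set) \<le> (\<Sum>k::nat. ennreal (diameter ({} :: 'a set)))"
      unfolding hausdorff1_delta_def using that by (intro INF_lower2[of "\<lambda>_. {}"]) auto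
    then show ?thesis by simp
  qed
  then show ?thesis unfolding hausdorff1_def by (simp add: SUP_eq_const)
qed

text \<open>The distance to \<open>a\<close> is 1-Lipschitz, so a cover of the connected set yields
  intervals no longer than the diameters that cover \<open>{0..dist a b}\<close>; Lebesgue measure
  bounds their total length from below.\<close>

lemma connected_dist_le_hausdorff1:
  fixes A :: "'a::metric_space set"
  assumes "connected C" "C \<subseteq> A" "a \<in> C" "b \<in> C"
  shows "ennreal (dist a b) \<le> hausdorff1 A"
proof -
  have "ennreal (dist a b) \<le> hausdorff1_delta 1 A"
    unfolding hausdorff1_delta_def
  proof (rule INF_greatest, clarify)
    fix D :: "nat \<Rightarrow> 'a set"
    assume D: "A \<subseteq> (\<Union>k. D k)" "\<forall>k. bounded (D k) \<and> diameter (D k) \<le> 1"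
    define J where "J k = (if D k = {} then {} else
       {Inf (dist a ` D k) .. Inf (dist a ` D k) + diameter (D k)})" for k
    have bdd: "bdd_below (dist a ` D k)" for k by (auto intro: bdd_belowI[of _ 0])
    have inJ: "dist a x \<in> J k" if x: "x \<in> D k" for x k
    proof -
      have "dist a x - diameter (D k) \<le> dist a z" if "z \<in> D k" for z
      proof -
        have "dist x z \<le> diameter (D k)" using D that x diameter_bounded_bound by blast
        then show ?thesis using dist_triangle[of a x z] by (simp add: dist_commute)
      qed
      then have "dist a x - diameter (D k) \<le> Inf (dist a ` D k)"
        using x by (intro cInf_greatest) auto
      moreover have "Inf (dist a ` D k) \<le> dist a x" using bdd x by (intro cInf_lower) auto
      ultimately show ?thesis using x by (auto simp: J_def)
    qed
    have "connected (dist a ` C)" using \<open>connected C\<close> by (intro connected_continuous_image continuous_intros)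
    moreover have "0 \<in> dist a ` C" "dist a b \<in> dist a ` C" using assms by force+
    ultimately have "{0..dist a b} \<subseteq> dist a ` C" by (rule connected_contains_Icc)
    also have "\<dots> \<subseteq> (\<Union>k. J k)"
    proof safe
      fix x assume "x \<in> C"
      then obtain k where "x \<in> D k" using D(1) assms(2) by auto
      then show "dist a x \<in> (\<Union>k. J k)" using inJ by auto
    qed
    finally have sub: "{0..dist a b} \<subseteq> (\<Union>k. J k)" .
    have J: "J k \<in> sets lborel" for k by (auto simp: J_def)
    have "ennreal (dist a b) = emeasure lborel {0..dist a b}" by simp
    also have "\<dots> \<le> emeasure lborel (\<Union>k. J k)" using sub J by (intro emeasure_mono) auto
    also have "\<dots> \<le> (\<Sum>k. emeasure lborel (J k))" using J by (intro emeasure_subadditive_countably) auto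
    also have "\<dots> \<le> (\<Sum>k. ennreal (diameter (D k)))"
      using D by (intro suminf_le) (auto simp: J_def diameter_ge_0)
    finally show "ennreal (dist a b) \<le> (\<Sum>k. ennreal (diameter (D k)))" .
  qed
  also have "\<dots> \<le> hausdorff1 A" unfolding hausdorff1_def by (intro SUP_upper) auto
  finally show ?thesis .
qed

section \<open>Comparison of integral curves by slopes\<close>

lemma slope_quotient_lipschitz:
  fixes a b a' b' :: real
  assumes "c > 0" "c \<le> b" "c \<le> b'" "\<bar>a\<bar> \<le> B" "\<bar>b\<bar> \<le> B" "\<bar>a - a'\<bar> \<le> d" "\<bar>b - b'\<bar> \<le> d"
  shows "a / b - a' / b' \<le> 2 * B / c\<^sup>2 * d"
proof -
  have "a / b - a' / b' = ((a - a') * b - a * (b - b')) / (b * b')"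
    using assms by (simp add: field_simps)
  also have "\<dots> \<le> (2 * B * d) / (b * b')"
  proof (rule divide_right_mono)
    have "(a - a') * b - a * (b - b') \<le> \<bar>a - a'\<bar> * \<bar>b\<bar> + \<bar>a\<bar> * \<bar>b - b'\<bar>"
      using abs_ge_self[of "(a - a') * b"] abs_ge_minus_self[of "a * (b - b')"] by (simp add: abs_mult)
    also have "\<dots> \<le> d * B + B * d" using assms by (intro add_mono mult_mono) auto
    finally show "(a - a') * b - a * (b - b') \<le> 2 * B * d" by simp
  qed (use assms in auto)
  also have "\<dots> \<le> (2 * B * d) / c\<^sup>2"
    using assms by (intro divide_left_mono) (auto simp: power2_eq_square intro!: mult_mono mult_pos_pos)
  finally show ?thesis by simp
qed

text \<open>Both curves are graphs over the direction \<^term>\<open>g\<close>. The cross-slope hypotheses say that each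
  field is not steeper than the other one along the other curve, so the vertical gap obeys a linear
  differential inequality.\<close>

lemma slope_comparison:
  fixes c1 c2 :: "real \<Rightarrow> 'a::euclidean_space" and f1 f2 :: "'a \<Rightarrow> 'a"
  assumes e: "e > 0" and start: "c1 0 = w" "c2 0 = w"
    and d1: "\<And>s. s \<in> {0..e} \<Longrightarrow> (c1 has_vector_derivative f1 (c1 s)) (at s within {0..e})"
    and d2: "\<And>s. s \<in> {0..e} \<Longrightarrow> (c2 has_vector_derivative f2 (c2 s)) (at s within {0..e})"
    and gn: "norm g = 1" "norm n = 1" and dec: "\<And>z. z = (g \<bullet> z) *\<^sub>R g + (n \<bullet> z) *\<^sub>R n"
    and lip: "C-lipschitz_on (cball w R) f1" "C-lipschitz_on (cball w R) f2" and "R > 0"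
    and pos: "g \<bullet> f1 w > 0" "g \<bullet> f2 w > 0"
    and A: "\<And>s. s \<in> {0<..e} \<Longrightarrow>
        (n \<bullet> f1 (c2 s)) * (g \<bullet> f2 (c2 s)) \<le> (n \<bullet> f2 (c2 s)) * (g \<bullet> f1 (c2 s))"
    and B: "\<And>s1 s2. s1 \<in> {0<..e} \<Longrightarrow> s2 \<in> {0<..e} \<Longrightarrow> g \<bullet> c1 s1 = g \<bullet> c2 s2 \<Longrightarrow>
        n \<bullet> c1 s1 < n \<bullet> c2 s2 \<Longrightarrow>
        (n \<bullet> f2 (c1 s1)) * (g \<bullet> f1 (c1 s1)) \<le> (n \<bullet> f1 (c1 s1)) * (g \<bullet> f2 (c1 s1))"
  shows "\<exists>e'>0. e' \<le> e \<and> (\<forall>s\<in>{0<..e'}. \<exists>s2\<in>{0<..e}. c1 s = c2 s2)"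
proof -
  have cont1: "continuous_on {0..e} c1" using d1 by (rule continuous_on_vector_derivative)
  have cont2: "continuous_on {0..e} c2" using d2 by (rule continuous_on_vector_derivative)
  have C0: "C \<ge> 0" using lip lipschitz_on_nonneg by blast
  define b where "b = min (g \<bullet> f1 w) (g \<bullet> f2 w) / 2"
  have b: "b > 0" using pos by (auto simp: b_def)
  \<comment> \<open>On this smaller ball both horizontal speeds stay at least \<open>b\<close>, half
    of the smaller initial speed, so both curves are graphs over \<open>g\<close>.\<close>
  define R' where "R' = min R (b / (C + 1))"
  have R': "R' > 0" "R' \<le> R" "C * R' \<le> b"
  proof -
    show "R' > 0" "R' \<le> R" using \<open>R > 0\<close> b C0 by (auto simp: R'_def)
    have "C * R' \<le> (C + 1) * (b / (C + 1))" using \<open>R' > 0\<close> C0 by (intro mult_mono) (auto simp: R'_def)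
    then show "C * R' \<le> b" using C0 by simp
  qed
  have low: "g \<bullet> f z \<ge> b" "norm (f z) \<le> norm (f w) + b"
    if "z \<in> cball w R'" "C-lipschitz_on (cball w R) f" "g \<bullet> f w \<ge> 2 * b" for f z
  proof -
    have "norm (f z - f w) \<le> C * norm (z - w)"
      using lipschitz_onD[OF that(2), of z w] that(1) R' by (auto simp: dist_norm norm_minus_commute)
    also have "\<dots> \<le> C * R'" using that(1) C0 by (intro mult_left_mono) (auto simp: dist_norm norm_minus_commute)
    finally have *: "norm (f z - f w) \<le> b" using R' by simp
    have "\<bar>g \<bullet> (f z - f w)\<bar> \<le> b" using Cauchy_Schwarz_ineq2[of g "f z - f w"] gn * by simp
    then show "g \<bullet> f z \<ge> b" using that(3) by (simp add: inner_diff_right)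
    show "norm (f z) \<le> norm (f w) + b" using * norm_triangle_sub[of "f z" "f w"] by simp
  qed
  define Bd where "Bd = max (norm (f1 w)) (norm (f2 w)) + b"
  have Bd: "Bd > 0" using b norm_ge_zero[of "f1 w"] unfolding Bd_def by linarith
  have l1: "g \<bullet> f1 z \<ge> b" "norm (f1 z) \<le> Bd" if "z \<in> cball w R'" for z
    using low[OF that lip(1)] by (auto simp: b_def Bd_def)
  have l2: "g \<bullet> f2 z \<ge> b" "norm (f2 z) \<le> Bd" if "z \<in> cball w R'" for z
    using low[OF that lip(2)] by (auto simp: b_def Bd_def)
  define e0 where "e0 = min e (R' / (2 * Bd))"
  have e0: "e0 > 0" "e0 \<le> e" "Bd * e0 < R'"
  proof -
    show "e0 > 0" "e0 \<le> e" using e R' Bd by (auto simp: e0_def)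
    have "Bd * e0 \<le> Bd * (R' / (2 * Bd))" using Bd by (intro mult_left_mono) (auto simp: e0_def)
    then show "Bd * e0 < R'" using Bd R' by simp
  qed
  have at1: "(c1 has_vector_derivative f1 (c1 s)) (at s)" if "s \<in> {0<..<e}" for s
    using d1[of s] that by (metis at_within_Icc_at atLeastAtMost_iff greaterThanLessThan_iff less_eq_real_def)
  have at2: "(c2 has_vector_derivative f2 (c2 s)) (at s)" if "s \<in> {0<..<e}" for s
    using d2[of s] that by (metis at_within_Icc_at atLeastAtMost_iff greaterThanLessThan_iff less_eq_real_def)
  have in1: "c1 s \<in> cball w R'" and in1': "norm (c1 s - w) \<le> Bd * s" if "s \<in> {0..e0}" for s
  proof -
    have "norm (c1 s - c1 0) \<le> Bd * s"
      by (rule stays_in_ball[where h=e0 and R=R' and P="{}" and z'="\<lambda>s. f1 (c1 s)"])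
        (use e0 that Bd start l1 at1 in \<open>auto intro!: continuous_on_subset[OF cont1] simp: dist_norm norm_minus_commute\<close>)
    moreover have "Bd * s \<le> Bd * e0" using that Bd by (intro mult_left_mono) auto
    ultimately show "c1 s \<in> cball w R'" "norm (c1 s - w) \<le> Bd * s"
      using e0 start by (auto simp: dist_norm norm_minus_commute)
  qed
  have in2: "c2 s \<in> cball w R'" if "s \<in> {0..e0}" for s
  proof -
    have "norm (c2 s - c2 0) \<le> Bd * s"
      by (rule stays_in_ball[where h=e0 and R=R' and P="{}" and z'="\<lambda>s. f2 (c2 s)"])
        (use e0 that Bd start l2 at2 in \<open>auto intro!: continuous_on_subset[OF cont2] simp: dist_norm norm_minus_commute\<close>)
    moreover have "Bd * s \<le> Bd * e0" using that Bd by (intro mult_left_mono) auto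
    ultimately show "c2 s \<in> cball w R'"
      using e0 start by (auto simp: dist_norm norm_minus_commute)
  qed
  define x1 where "x1 s = g \<bullet> (c1 s - w)" for s
  define x2 where "x2 s = g \<bullet> (c2 s - w)" for s
  have dx1: "(x1 has_real_derivative g \<bullet> f1 (c1 s)) (at s)" if "s \<in> {0<..<e0}" for s
    unfolding x1_def using at1[of s] that e0 unfolding has_real_derivative_iff_has_vector_derivative
    by (auto intro!: derivative_eq_intros bounded_linear.has_vector_derivative[OF bounded_linear_inner_right])
  have dx2: "(x2 has_real_derivative g \<bullet> f2 (c2 s)) (at s)" if "s \<in> {0<..<e0}" for s
    unfolding x2_def using at2[of s] that e0 unfolding has_real_derivative_iff_has_vector_derivative
    by (auto intro!: derivative_eq_intros bounded_linear.has_vector_derivative[OF bounded_linear_inner_right])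
  have cx1: "continuous_on {0..e0} x1" unfolding x1_def
    using e0 by (intro continuous_intros continuous_on_subset[OF cont1]) auto
  have cx2: "continuous_on {0..e0} x2" unfolding x2_def
    using e0 by (intro continuous_intros continuous_on_subset[OF cont2]) auto
  have mono: "x v - x u \<ge> b * (v - u)"
    if "u \<le> v" "{u..v} \<subseteq> {0..e0}" "continuous_on {0..e0} x" "\<And>s. s \<in> {0<..<e0} \<Longrightarrow> (x has_real_derivative x' s) (at s)"
      "\<And>s. s \<in> {0<..<e0} \<Longrightarrow> x' s \<ge> b" for x x' :: "real \<Rightarrow> real" and u v
  proof (cases "u = v")
    case False
    then have "u < v" using that by auto
    have "\<exists>l z. u < z \<and> z < v \<and> (x has_real_derivative l) (at z) \<and> x v - x u = (v - u) * l"
    proof (rule MVT[OF \<open>u < v\<close>])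
      show "continuous_on {u..v} x" using that continuous_on_subset by blast
      fix z assume "u < z" "z < v"
      then have "z \<in> {0<..<e0}" using that(2) \<open>u < v\<close> by auto
      then show "x differentiable (at z)" using that(4) real_differentiable_def by blast
    qed
    then obtain l z where z: "u < z" "z < v" "(x has_real_derivative l) (at z)" "x v - x u = (v - u) * l" by blast
    then have "z \<in> {0<..<e0}" using that(2) \<open>u < v\<close> by auto
    then have "l \<ge> b" using z that(4,5) DERIV_unique by fastforce
    then show ?thesis using z \<open>u < v\<close> by (simp add: mult.commute mult_left_mono)
  qed simp
  have m1: "x1 v - x1 u \<ge> b * (v - u)" if "u \<le> v" "u \<in> {0..e0}" "v \<in> {0..e0}" for u v
    by (rule mono[OF _ _ cx1 dx1 l1(1)[OF in1]]) (use that in auto)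
  have m2: "x2 v - x2 u \<ge> b * (v - u)" if "u \<le> v" "u \<in> {0..e0}" "v \<in> {0..e0}" for u v
    by (rule mono[OF _ _ cx2 dx2 l2(1)[OF in2]]) (use that in auto)
  have x0: "x1 0 = 0" "x2 0 = 0" using start by (auto simp: x1_def x2_def)
  have inj: "u = v" if "x2 u = x2 v" "u \<in> {0..e0}" "v \<in> {0..e0}" for u v
  proof (rule ccontr)
    assume "u \<noteq> v"
    then consider "u < v" | "v < u" by linarith
    then show False
    proof cases
      case 1
      then have "b * (v - u) > 0" using b by simp
      then show False using m2[of u v] 1 that by auto
    next
      case 2
      then have "b * (u - v) > 0" using b by simp
      then show False using m2[of v u] 2 that by auto
    qed
  qed
  \<comment> \<open>The inverse of the horizontal position of \<open>c2\<close>, used to follow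
    \<open>c2\<close> at the abscissa of \<open>c1\<close>.\<close>
  define tau where "tau = inv_into {0..e0} x2"
  have injon: "inj_on x2 {0..e0}" using inj by (auto simp: inj_on_def)
  have tau2: "tau (x2 s) = s" if "s \<in> {0..e0}" for s
    unfolding tau_def using injon that by simp
  have img: "x2 ` {0..e0} = {0..x2 e0}"
  proof
    have "x2 s \<in> {0..x2 e0}" if "s \<in> {0..e0}" for s
    proof -
      have "b * s \<ge> 0" "b * (e0 - s) \<ge> 0" using that b by auto
      then show ?thesis using m2[of 0 s] m2[of s e0] that e0 x0 by auto
    qed
    then show "x2 ` {0..e0} \<subseteq> {0..x2 e0}" by auto
    show "{0..x2 e0} \<subseteq> x2 ` {0..e0}"
    proof
      fix z assume "z \<in> {0..x2 e0}"
      then have "\<exists>s\<ge>0. s \<le> e0 \<and> x2 s = z"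
        using x0 e0 cx2 by (intro IVT') auto
      then show "z \<in> x2 ` {0..e0}" by auto
    qed
  qed
  have x2tau: "x2 (tau z) = z" "tau z \<in> {0..e0}" if "z \<in> {0..x2 e0}" for z
    using that f_inv_into_f[of z x2 "{0..e0}"] inv_into_into[of z x2 "{0..e0}"] unfolding tau_def img by auto
  have ctau: "continuous_on {0..x2 e0} tau"
    using continuous_on_inv[OF cx2, of tau] tau2 img by auto
  \<comment> \<open>Up to time \<open>e1\<close> the curve \<open>c1\<close> moves horizontally by
    at most \<open>b * e0 / 2\<close>, while \<open>c2\<close> covers at least \<open>b * e0\<close>
    on \<open>{0..e0}\<close>; so \<open>c1\<close> stays over the range of
    \<open>c2\<close>.\<close>
  define e1 where "e1 = b * e0 / (2 * Bd)"
  have bBd: "b \<le> Bd" using norm_ge_zero[of "f1 w"] unfolding Bd_def by linarith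
  have e1: "e1 > 0" "e1 < e0" "Bd * e1 < x2 e0"
  proof -
    show "e1 > 0" using b e0 Bd by (simp add: e1_def)
    have "b * e0 \<le> Bd * e0" using bBd e0 by simp
    then have "e1 \<le> e0 / 2" using Bd by (simp add: e1_def field_simps)
    then show "e1 < e0" using e0 by simp
    have "Bd * e1 = b * e0 / 2" using Bd by (simp add: e1_def)
    moreover have "b * e0 > 0" using b e0 by simp
    ultimately show "Bd * e1 < x2 e0" using m2[of 0 e0] x0 e0 by auto
  qed
  have x1r: "x1 s \<in> {0..<x2 e0}" if "s \<in> {0..e1}" for s
  proof -
    have "x1 s \<le> norm (c1 s - w)" using Cauchy_Schwarz_ineq2[of g "c1 s - w"] gn by (auto simp: x1_def)
    also have "\<dots> \<le> Bd * s" using in1' that e1 by auto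
    also have "\<dots> \<le> Bd * e1" using that Bd by (intro mult_left_mono) auto
    finally have "x1 s < x2 e0" using e1 by simp
    moreover have "b * s \<ge> 0" using b that by auto
    ultimately show ?thesis using m1[of 0 s] that e1 e0 x0 by auto
  qed
  have x1p: "x1 s > 0" if "s \<in> {0<..e1}" for s
  proof -
    have "b * s > 0" using b that by auto
    then show ?thesis using m1[of 0 s] that e1 e0 x0 by auto
  qed
  define sg where "sg s = tau (x1 s)" for s
  have sg: "sg s \<in> {0..e0}" "x2 (sg s) = x1 s" if "s \<in> {0..e1}" for s
    using x2tau[of "x1 s"] x1r[OF that] by (auto simp: sg_def)
  have sgp: "sg s \<in> {0<..<e0}" if "s \<in> {0<..e1}" for s
  proof -
    have "sg s \<noteq> 0" using sg[of s] x1p[OF that] x0 that by force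
    moreover have "sg s \<noteq> e0" using sg[of s] x1r[of s] that by force
    ultimately show ?thesis using sg[of s] that by force
  qed
  define D where "D s = n \<bullet> (c1 s - c2 (sg s))" for s
  have diffn: "c1 s - c2 (sg s) = D s *\<^sub>R n" if "s \<in> {0..e1}" for s
  proof -
    have "g \<bullet> (c1 s - c2 (sg s)) = 0" using sg(2)[OF that] by (simp add: x1_def x2_def inner_diff_right)
    then show ?thesis using dec[of "c1 s - c2 (sg s)"] by (simp add: D_def)
  qed
  have csg: "continuous_on {0..e1} sg" unfolding sg_def
    using x1r e1 by (intro continuous_on_compose2[OF ctau] continuous_on_subset[OF cx1]) force+
  define sl1 where "sl1 z = (n \<bullet> f1 z) / (g \<bullet> f1 z)" for z
  define sl2 where "sl2 z = (n \<bullet> f2 z) / (g \<bullet> f2 z)" for z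
  define K where "K = 2 * Bd / b\<^sup>2 * C"
  have K0: "K \<ge> 0" using Bd b C0 by (simp add: K_def)
  have inn: "\<bar>n \<bullet> z\<bar> \<le> norm z" "\<bar>g \<bullet> z\<bar> \<le> norm z" for z
    using Cauchy_Schwarz_ineq2[of n z] Cauchy_Schwarz_ineq2[of g z] gn by auto
  have slip: "(n \<bullet> f z) / (g \<bullet> f z) - (n \<bullet> f z') / (g \<bullet> f z') \<le> K * norm (z - z')"
    if "z \<in> cball w R'" "z' \<in> cball w R'" "C-lipschitz_on (cball w R) f"
      "\<And>z. z \<in> cball w R' \<Longrightarrow> g \<bullet> f z \<ge> b" "\<And>z. z \<in> cball w R' \<Longrightarrow> norm (f z) \<le> Bd" for f z z'
  proof -
    have l: "norm (f z - f z') \<le> C * norm (z - z')"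
      using lipschitz_onD[OF that(3), of z z'] that(1,2) R' by (auto simp: dist_norm)
    have "(n \<bullet> f z) / (g \<bullet> f z) - (n \<bullet> f z') / (g \<bullet> f z') \<le> 2 * Bd / b\<^sup>2 * (C * norm (z - z'))"
    proof (rule slope_quotient_lipschitz[OF b that(4)[OF that(1)] that(4)[OF that(2)]])
      show "\<bar>n \<bullet> f z\<bar> \<le> Bd" "\<bar>g \<bullet> f z\<bar> \<le> Bd" using inn[of "f z"] that(5)[OF that(1)] by auto
      show "\<bar>n \<bullet> f z - n \<bullet> f z'\<bar> \<le> C * norm (z - z')" "\<bar>g \<bullet> f z - g \<bullet> f z'\<bar> \<le> C * norm (z - z')"
        using inn[of "f z - f z'"] l by (auto simp: inner_diff_right)
    qed
    then show ?thesis by (simp add: K_def)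
  qed
  have D0: "D s = 0" if s: "s \<in> {0<..e1}" for s
  proof -
    define DD where "DD r = n \<bullet> f1 (c1 r) - n \<bullet> f2 (c2 (sg r)) * ((g \<bullet> f1 (c1 r)) / (g \<bullet> f2 (c2 (sg r))))" for r
    \<comment> \<open>Squaring the gap treats both of its signs in one Gronwall inequality: a
      nonnegative gap is controlled by \<open>A\<close> at the point of \<open>c2\<close>, a
      negative one by \<open>B\<close> at the point of \<open>c1\<close>.\<close>
    have "(D s)\<^sup>2 \<le> 0 * (s - 0) * exp ((2 * Bd * K) * (s - 0))"
    proof (rule gronwall_upper[where P="{}" and W="\<lambda>r. (D r)\<^sup>2" and W'="\<lambda>r. 2 * D r * DD r"])
      show "continuous_on {0..s} (\<lambda>r. (D r)\<^sup>2)" unfolding D_def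
      proof (intro continuous_intros)
        show "continuous_on {0..s} c1" using s e1 e0 by (intro continuous_on_subset[OF cont1]) auto
        show "continuous_on {0..s} (\<lambda>x. c2 (sg x))"
          using s sg e0 by (intro continuous_on_compose2[OF cont2] continuous_on_subset[OF csg]) force+
      qed
      show "(D 0)\<^sup>2 \<le> 0" using tau2[of 0] x0 e0 start by (simp add: D_def sg_def)
      fix r assume r: "r \<in> {0<..<s} - {}"
      then have r1: "r \<in> {0<..e1}" "r \<in> {0<..<e0}" "r \<in> {0..e1}" using s e1 by auto
      note sr = sgp[OF r1(1)]
      have "isCont tau (x1 r)"
      proof -
        have "x1 r \<in> interior {0..x2 e0}" using x1p[OF r1(1)] x1r[OF r1(3)] by simp
        then show ?thesis using continuous_on_interior[OF ctau] by blast
      qed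
      moreover have "(x2 has_real_derivative g \<bullet> f2 (c2 (tau (x1 r)))) (at (tau (x1 r)))"
        using dx2[of "sg r"] sr by (simp add: sg_def)
      moreover have gp: "g \<bullet> f2 (c2 (sg r)) \<ge> b" using l2(1)[OF in2[of "sg r"]] sr by auto
      ultimately have "(tau has_real_derivative inverse (g \<bullet> f2 (c2 (sg r)))) (at (x1 r))"
        using x1p[OF r1(1)] x1r[OF r1(3)] x2tau b
        by (intro DERIV_inverse_function[where f=x2 and a=0 and b="x2 e0"]) (auto simp: sg_def)
      then have "((tau \<circ> x1) has_real_derivative (inverse (g \<bullet> f2 (c2 (sg r))) * (g \<bullet> f1 (c1 r)))) (at r)"
        by (rule DERIV_chain[OF _ dx1[OF r1(2)]])
      then have dsg: "(sg has_real_derivative ((g \<bullet> f1 (c1 r)) / (g \<bullet> f2 (c2 (sg r))))) (at r)"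
        by (simp add: comp_def sg_def[abs_def] divide_inverse mult.commute)
      have "((c2 \<circ> sg) has_vector_derivative (((g \<bullet> f1 (c1 r)) / (g \<bullet> f2 (c2 (sg r)))) *\<^sub>R f2 (c2 (sg r)))) (at r)"
        using dsg at2[of "sg r"] sr e0 unfolding has_real_derivative_iff_has_vector_derivative
        by (intro vector_diff_chain_at) auto
      then have "(D has_vector_derivative (n \<bullet> (f1 (c1 r) - ((g \<bullet> f1 (c1 r)) / (g \<bullet> f2 (c2 (sg r)))) *\<^sub>R f2 (c2 (sg r))))) (at r)"
        unfolding D_def[abs_def] comp_def using at1[of r] r1 e0
        by (intro bounded_linear.has_vector_derivative[OF bounded_linear_inner_right] has_vector_derivative_diff) auto
      then have dD: "(D has_real_derivative DD r) (at r)"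
        unfolding has_real_derivative_iff_has_vector_derivative DD_def
        by (simp add: inner_diff_right mult.commute)
      show "((\<lambda>r. (D r)\<^sup>2) has_real_derivative 2 * D r * DD r) (at r)"
        using dD by (auto intro!: derivative_eq_intros)
      have b1: "c1 r \<in> cball w R'" and b2: "c2 (sg r) \<in> cball w R'" using in1 in2 sr r1 by auto
      have sgr: "sg r \<in> {0<..e}" and re: "r \<in> {0<..e}" using sr r1 e0 by auto
      have DD: "DD r = (g \<bullet> f1 (c1 r)) * (sl1 (c1 r) - sl2 (c2 (sg r)))"
        using gp b l1(1)[OF b1] by (simp add: DD_def sl1_def sl2_def field_simps)
      have nd: "norm (c1 r - c2 (sg r)) = \<bar>D r\<bar>" using diffn[OF r1(3)] gn by simp
      have "D r * (sl1 (c1 r) - sl2 (c2 (sg r))) \<le> K * (D r)\<^sup>2"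
      proof (cases "D r \<ge> 0")
        case True
        have "sl1 (c2 (sg r)) \<le> sl2 (c2 (sg r))"
          using A[OF sgr] l1(1)[OF b2] l2(1)[OF b2] b by (simp add: sl1_def sl2_def field_simps)
        moreover have "sl1 (c1 r) - sl1 (c2 (sg r)) \<le> K * \<bar>D r\<bar>"
          using slip[OF b1 b2 lip(1) l1] nd by (simp add: sl1_def)
        ultimately have "sl1 (c1 r) - sl2 (c2 (sg r)) \<le> K * D r" using True by simp
        from mult_left_mono[OF this True] show ?thesis by (simp add: power2_eq_square mult.left_commute)
      next
        case False
        have "n \<bullet> c1 r < n \<bullet> c2 (sg r)" using False by (simp add: D_def inner_diff_right)
        moreover have "g \<bullet> c1 r = g \<bullet> c2 (sg r)" using sg(2)[OF r1(3)] by (simp add: x1_def x2_def inner_diff_right)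
        ultimately have "sl2 (c1 r) \<le> sl1 (c1 r)"
          using B[OF re sgr] l1(1)[OF b1] l2(1)[OF b1] b by (simp add: sl1_def sl2_def field_simps)
        moreover have "sl2 (c2 (sg r)) - sl2 (c1 r) \<le> K * \<bar>D r\<bar>"
          using slip[OF b2 b1 lip(2) l2] nd by (simp add: sl2_def norm_minus_commute)
        ultimately have "sl2 (c2 (sg r)) - sl1 (c1 r) \<le> K * (- D r)" using False by simp
        from mult_left_mono[OF this, of "- D r"] False show ?thesis
          by (simp add: power2_eq_square algebra_simps)
      qed
      then have "2 * (g \<bullet> f1 (c1 r)) * (D r * (sl1 (c1 r) - sl2 (c2 (sg r)))) \<le> 2 * (g \<bullet> f1 (c1 r)) * (K * (D r)\<^sup>2)"
        using l1(1)[OF b1] b by (intro mult_left_mono) auto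
      also have "\<dots> \<le> 2 * Bd * (K * (D r)\<^sup>2)"
        using inn(2)[of "f1 (c1 r)"] l1(2)[OF b1] K0 by (intro mult_right_mono) auto
      finally show "2 * D r * DD r \<le> 2 * Bd * K * (D r)\<^sup>2 + 0" by (simp add: DD algebra_simps)
    qed (use s K0 Bd in auto)
    then show ?thesis by simp
  qed
  show ?thesis
  proof (intro exI[of _ e1] conjI ballI)
    show "e1 > 0" "e1 \<le> e" using e1 e0 by auto
    fix s assume s: "s \<in> {0<..e1}"
    then have "c1 s = c2 (sg s)" using diffn[of s] D0[of s] by simp
    then show "\<exists>s2\<in>{0<..e}. c1 s = c2 s2" using sgp[OF s] e0 by force
  qed
qed

section \<open>Trajectories and dynamic programming\<close>

lemma borel_measurable_lebesgue_on_shift: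
  fixes f :: "real \<Rightarrow> real"
  assumes "f \<in> borel_measurable (lebesgue_on {a..b})"
  shows "(\<lambda>s. f (c + s)) \<in> borel_measurable (lebesgue_on {a - c..b - c})"
proof -
  have shift: "(\<lambda>s. c + s) \<in> lebesgue \<rightarrow>\<^sub>M lebesgue"
    using lebesgue_affine_measurable[where c="\<lambda>x::real. 1" and t=c] by simp
  have "(\<lambda>x. if x \<in> {a..b} then f x else 0) \<in> borel_measurable lebesgue"
    using assms by (subst borel_measurable_if) auto
  from measurable_compose[OF shift this]
  have "(\<lambda>s. if c + s \<in> {a..b} then f (c + s) else 0) \<in> borel_measurable lebesgue" .
  also have "(\<lambda>s. if c + s \<in> {a..b} then f (c + s) else 0) = (\<lambda>s. if s \<in> {a - c..b - c} then f (c + s) else 0)"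
    by (auto simp: algebra_simps)
  finally show ?thesis by (rule borel_measurable_if_D)
qed

lemma borel_measurable_lebesgue_on_join:
  fixes f g :: "real \<Rightarrow> real"
  assumes "f \<in> borel_measurable (lebesgue_on {0..a})" "g \<in> borel_measurable (lebesgue_on {0..b})" "0 \<le> a" "0 \<le> b"
  shows "(\<lambda>s. if s < a then f s else g (s - a)) \<in> borel_measurable (lebesgue_on {0..a + b})"
proof (rule borel_measurable_if_D)
  have 1: "(\<lambda>x. if x \<in> {0..a} then f x else 0) \<in> borel_measurable lebesgue"
    using assms by (subst borel_measurable_if) auto
  have "(\<lambda>s. g (- a + s)) \<in> borel_measurable (lebesgue_on {0 - (- a)..b - (- a)})"
    by (rule borel_measurable_lebesgue_on_shift[OF assms(2)])
  then have 2: "(\<lambda>x. if x \<in> {a..a + b} then g (x - a) else 0) \<in> borel_measurable lebesgue"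
    by (subst borel_measurable_if) (auto simp: add.commute)
  have "{x \<in> space lebesgue. x < a} \<in> sets lebesgue" by simp
  from measurable_If[OF 1 2 this]
  have "(\<lambda>x. if x < a then if x \<in> {0..a} then f x else 0 else if x \<in> {a..a + b} then g (x - a) else 0)
    \<in> borel_measurable lebesgue" .
  then show "(\<lambda>x. if x \<in> {0..a + b} then if x < a then f x else g (x - a) else 0) \<in> borel_measurable lebesgue"
    by (rule back_subst[where P="\<lambda>f. f \<in> borel_measurable lebesgue"]) (use assms in auto)
qed

lemma has_integral_initial_diff:
  fixes f :: "real \<Rightarrow> 'a::banach"
  assumes "(f has_integral A) {a..s}" "(f has_integral B) {a..s'}" "a \<le> s" "s \<le> s'"
  shows "(f has_integral (B - A)) {s..s'}"
proof -
  have "f integrable_on {s..s'}"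
    by (rule integrable_subinterval_real[OF has_integral_integrable[OF assms(2)]]) (use assms in auto)
  then obtain i where i: "(f has_integral i) {s..s'}" by blast
  from has_integral_combine[OF assms(3,4,1) i] have "A + i = B"
    using assms(2) has_integral_unique by blast
  then have "i = B - A" by auto
  then show ?thesis using i by simp
qed

lemma trajectory_integral:
  assumes "trajectory F G M t u y" "0 \<le> a" "a \<le> b" "b \<le> t"
  shows "((\<lambda>r. F (y r) + (\<Sum>i<M. u r i *\<^sub>R G i (y r))) has_integral (y b - y a)) {a..b}"
proof -
  have "((\<lambda>r. F (y r) + (\<Sum>i<M. u r i *\<^sub>R G i (y r))) has_integral ((y b - y 0) - (y a - y 0))) {a..b}"
    by (rule has_integral_initial_diff[of _ _ 0]) (use assms in \<open>auto simp: trajectory_def\<close>)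
  then show ?thesis by simp
qed

lemma trajectory_initial:
  assumes "trajectory F G M t u y" "0 \<le> s" "s \<le> t"
  shows "trajectory F G M s u y"
proof -
  have "continuous_on {0..s} y"
    using assms by (auto simp: trajectory_def intro: continuous_on_subset[where s="{0..t}"])
  moreover have "(\<lambda>r. u r i) \<in> borel_measurable (lebesgue_on {0..s})" if "i < M" for i
    by (rule measurable_restrict_mono[where A="{0..t}"])
      (use assms that in \<open>auto simp: trajectory_def admissible_control_def\<close>)
  ultimately show ?thesis using assms by (auto simp: trajectory_def admissible_control_def)
qed

lemma trajectory_tail:
  assumes tr: "trajectory F G M t u y" and s: "0 \<le> s" "s \<le> t"
  shows "trajectory F G M (t - s) (\<lambda>r. u (s + r)) (\<lambda>r. y (s + r))"
  unfolding trajectory_def admissible_control_def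
proof (intro conjI allI impI ballI)
  show "0 \<le> t - s" using s by simp
  fix i assume "i < M"
  then have "(\<lambda>s. u s i) \<in> borel_measurable (lebesgue_on {0..t})"
    using tr by (auto simp: trajectory_def admissible_control_def)
  from borel_measurable_lebesgue_on_shift[OF this, of s]
  show "(\<lambda>r. u (s + r) i) \<in> borel_measurable (lebesgue_on {0..t - s})"
    by (rule measurable_restrict_mono) (use s in auto)
  show "\<bar>u (s + r) i\<bar> \<le> 1" if "r \<in> {0..t - s}" for r
    using tr that s \<open>i < M\<close> by (auto simp: trajectory_def admissible_control_def)
next
  show "continuous_on {0..t - s} (\<lambda>r. y (s + r))"
    by (rule continuous_on_compose2[of "{0..t}" y]) (use tr s in \<open>auto simp: trajectory_def intro: continuous_intros\<close>)
  fix r assume r: "r \<in> {0..t - s}"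
  have "((\<lambda>r. F (y r) + (\<Sum>i<M. u r i *\<^sub>R G i (y r))) has_integral (y (s + r) - y s)) {s..s + r}"
    using trajectory_integral[OF tr, of s "s + r"] r s by auto
  from has_integral_shift_real_ivl[OF this, of s]
  show "((\<lambda>r. F (y (s + r)) + (\<Sum>i<M. u (s + r) i *\<^sub>R G i (y (s + r)))) has_integral (y (s + r) - y (s + 0))) {0..r}"
    by (simp add: add.commute)
qed

lemma trajectory_concat:
  assumes tr1: "trajectory F G M t1 u1 y1" and tr2: "trajectory F G M t2 u2 y2" and eq: "y1 t1 = y2 0"
  shows "trajectory F G M (t1 + t2) (\<lambda>r. if r < t1 then u1 r else u2 (r - t1))
     (\<lambda>r. if r \<le> t1 then y1 r else y2 (r - t1))"
  (is "trajectory F G M _ ?u ?y")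
  unfolding trajectory_def admissible_control_def
proof (intro conjI allI impI ballI)
  have t: "0 \<le> t1" "0 \<le> t2" using tr1 tr2 by (auto simp: trajectory_def)
  then show "0 \<le> t1 + t2" by simp
  fix i assume i: "i < M"
  have "(\<lambda>s. if s < t1 then u1 s i else u2 (s - t1) i) \<in> borel_measurable (lebesgue_on {0..t1 + t2})"
    using tr1 tr2 t i by (intro borel_measurable_lebesgue_on_join) (auto simp: trajectory_def admissible_control_def)
  then show "(\<lambda>s. ?u s i) \<in> borel_measurable (lebesgue_on {0..t1 + t2})"
    by (rule back_subst[where P="\<lambda>f. f \<in> _"]) auto
  show "\<bar>?u s i\<bar> \<le> 1" if "s \<in> {0..t1 + t2}" for s
    using tr1 tr2 that i by (auto simp: trajectory_def admissible_control_def)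
next
  have t: "0 \<le> t1" "0 \<le> t2" using tr1 tr2 by (auto simp: trajectory_def)
  have "continuous_on ({0..t1} \<union> {t1..t1 + t2}) ?y"
  proof (rule continuous_on_cases)
    show "continuous_on {0..t1} y1" using tr1 by (simp add: trajectory_def)
    show "continuous_on {t1..t1 + t2} (\<lambda>r. y2 (r - t1))"
      by (rule continuous_on_compose2[of "{0..t2}" y2]) (use tr2 in \<open>auto simp: trajectory_def intro: continuous_intros\<close>)
  qed (use eq in auto)
  also have "{0..t1} \<union> {t1..t1 + t2} = {0..t1 + t2}" using t by auto
  finally show "continuous_on {0..t1 + t2} ?y" .
  fix s assume s: "s \<in> {0..t1 + t2}"
  let ?f = "\<lambda>r. F (?y r) + (\<Sum>i<M. ?u r i *\<^sub>R G i (?y r))"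
  have 1: "(?f has_integral (y1 s - y1 0)) {0..s}" if "s \<in> {0..t1}" for s
  \<comment> \<open>At \<open>t1\<close> the joined control already takes its value from
    \<open>u2\<close>, while the curve is still \<open>y1\<close>; a single point does not affect
    the integral.\<close>
  proof (rule has_integral_spike_finite[of "{t1}"])
    show "((\<lambda>r. F (y1 r) + (\<Sum>i<M. u1 r i *\<^sub>R G i (y1 r))) has_integral (y1 s - y1 0)) {0..s}"
      using tr1 that by (auto simp: trajectory_def)
  qed (use that in auto)
  show "(?f has_integral (?y s - ?y 0)) {0..s}"
  proof (cases "s \<le> t1")
    case True
    then show ?thesis using 1[of s] s t by auto
  next
    case False
    have "((\<lambda>r. F (y2 r) + (\<Sum>i<M. u2 r i *\<^sub>R G i (y2 r))) has_integral (y2 (s - t1) - y2 0)) {0..s - t1}"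
      using tr2 s False by (auto simp: trajectory_def)
    from has_integral_shift_real_ivl[OF this, of "- t1"]
    have "((\<lambda>r. F (y2 (r - t1)) + (\<Sum>i<M. u2 (r - t1) i *\<^sub>R G i (y2 (r - t1)))) has_integral (y2 (s - t1) - y2 0)) {t1..s}"
      by simp
    then have "(?f has_integral (y2 (s - t1) - y2 0)) {t1..s}"
      by (rule has_integral_eq[rotated]) (use eq in auto)
    from has_integral_combine[OF _ _ 1[of t1] this] show ?thesis using t False eq by auto
  qed
qed

lemma trajectory_of_arc:
  assumes "0 \<le> h" and v: "\<And>i. i < M \<Longrightarrow> \<bar>v i\<bar> \<le> 1"
    and d: "\<And>s. s \<in> {0..h} \<Longrightarrow>
      (y has_vector_derivative (F (y s) + (\<Sum>i<M. v i *\<^sub>R G i (y s)))) (at s within {0..h})"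
  shows "trajectory F G M h (\<lambda>_. v) y"
  unfolding trajectory_def admissible_control_def
proof (intro conjI allI impI ballI)
  show "continuous_on {0..h} y" using d by (rule continuous_on_vector_derivative)
  fix s assume s: "s \<in> {0..h}"
  show "((\<lambda>r. F (y r) + (\<Sum>i<M. v i *\<^sub>R G i (y r))) has_integral (y s - y 0)) {0..s}"
    using s by (intro fundamental_theorem_of_calculus has_vector_derivative_within_subset[OF d]) auto
qed (use assms in auto)

lemma min_time_le: "reaches_origin F G M x t \<Longrightarrow> min_time F G M x \<le> ereal t"
  unfolding min_time_def by (rule Inf_lower) auto

lemma min_time_nonneg: "0 \<le> min_time F G M x"
  unfolding min_time_def by (rule Inf_greatest) (auto simp: reaches_origin_def trajectory_def)

lemma min_time_le_trajectory:
  assumes "trajectory F G M t u y" "y t = 0"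
  shows "min_time F G M (y 0) \<le> ereal t"
  using assms by (intro min_time_le) (auto simp: reaches_origin_def)

lemma min_time_dynamic_programming:
  assumes tr: "trajectory F G M t u y"
  shows "min_time F G M (y 0) \<le> min_time F G M (y t) + ereal t"
proof -
  have "min_time F G M (y 0) - ereal t \<le> min_time F G M (y t)"
    unfolding min_time_def[of F G M "y t"]
  proof (rule Inf_greatest, clarify)
    fix t2 assume "reaches_origin F G M (y t) t2"
    then obtain u2 y2 where 2: "trajectory F G M t2 u2 y2" "y2 0 = y t" "y2 t2 = 0"
      by (auto simp: reaches_origin_def)
    have t: "0 \<le> t" "0 \<le> t2" using tr 2 by (auto simp: trajectory_def)
    from min_time_le_trajectory[OF trajectory_concat[OF tr 2(1) 2(2)[symmetric]]]
    have "min_time F G M (y 0) \<le> ereal (t + t2)"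
      \<comment> \<open>For \<open>t2 = 0\<close> the final time falls in the branch
        \<open>r \<le> t1\<close>, where the endpoint is \<open>y t\<close> itself.\<close>
      using t 2 by (cases "t2 = 0") auto
    then show "min_time F G M (y 0) - ereal t \<le> ereal t2"
      by (simp add: ereal_minus_le add.commute)
  qed
  then show ?thesis by (simp add: ereal_minus_le)
qed

text \<open>The principle of optimality: a faster way from \<open>y s\<close>, preceded by the
  initial piece of the trajectory, would beat the optimal time.\<close>

lemma min_time_along_optimal:
  assumes tr: "trajectory F G M t u y" and "y t = 0" and opt: "min_time F G M (y 0) = ereal t"
    and s: "s \<in> {0..t}"
  shows "min_time F G M (y s) = ereal (t - s)"
proof (rule antisym)
  show "min_time F G M (y s) \<le> ereal (t - s)"
    using min_time_le_trajectory[OF trajectory_tail[OF tr, of s]] s \<open>y t = 0\<close> by simp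
  have "ereal t \<le> min_time F G M (y s) + ereal s"
    using min_time_dynamic_programming[OF trajectory_initial[OF tr, of s]] opt s by simp
  then show "ereal (t - s) \<le> min_time F G M (y s)"
    by (cases "min_time F G M (y s)") auto
qed

lemma min_time_zero:
  assumes "F 0 = 0"
  shows "min_time F G M 0 = 0"
proof (rule antisym[OF _ min_time_nonneg])
  have "trajectory F G M 0 (\<lambda>_ _. 0) (\<lambda>_. 0)"
    by (rule trajectory_of_arc) (use assms in auto)
  from min_time_le_trajectory[OF this] show "min_time F G M 0 \<le> 0" by (simp add: zero_ereal_def)
qed

section \<open>The control system and its optimal curves\<close>

text \<open>The factor 4 is 2 for the two columns times 2 for passing from components to the
  norm.\<close>

lemma derivative_lipschitz_of_partials:
  fixes D :: "real^2 \<Rightarrow> real^2 \<Rightarrow> real^2"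
  assumes lin: "\<And>x. linear (D x)"
    and lip: "\<And>x y j k. \<bar>D x (axis j 1) $ k - D y (axis j 1) $ k\<bar> \<le> L * norm (x - y)"
  shows "norm (D x h - D y h) \<le> 4 * \<bar>L\<bar> * norm (x - y) * norm h"
proof -
  have ex: "D x h = (\<Sum>j\<in>UNIV. h $ j *\<^sub>R D x (axis j 1))" for x
  proof -
    have "D x h = D x (\<Sum>j\<in>UNIV. h $ j *\<^sub>R axis j 1)"
      by (simp add: basis_expansion flip: scalar_mult_eq_scaleR)
    then show ?thesis by (simp add: linear_sum[OF lin] linear_scale[OF lin])
  qed
  have ax: "norm (D x (axis j 1) - D y (axis j 1)) \<le> 2 * (\<bar>L\<bar> * norm (x - y))" for j
  proof -
    have "norm (D x (axis j 1) - D y (axis j 1)) \<le> (\<Sum>k\<in>UNIV. \<bar>(D x (axis j 1) - D y (axis j 1)) $ k\<bar>)"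
      by (rule norm_le_l1_cart)
    also have "\<dots> \<le> (\<Sum>k\<in>(UNIV::2 set). \<bar>L\<bar> * norm (x - y))"
    proof (rule sum_mono)
      fix k
      have "L * norm (x - y) \<le> \<bar>L\<bar> * norm (x - y)" by (intro mult_right_mono) auto
      then show "\<bar>(D x (axis j 1) - D y (axis j 1)) $ k\<bar> \<le> \<bar>L\<bar> * norm (x - y)"
        using lip[of x j k y] by simp
    qed
    finally show ?thesis by simp
  qed
  have "norm (D x h - D y h) = norm (\<Sum>j\<in>UNIV. h $ j *\<^sub>R (D x (axis j 1) - D y (axis j 1)))"
    by (simp add: ex[of x] ex[of y] sum_subtractf scaleR_right_diff_distrib)
  also have "\<dots> \<le> (\<Sum>j\<in>(UNIV::2 set). norm h * (2 * (\<bar>L\<bar> * norm (x - y))))"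
  proof (rule sum_norm_le)
    fix j :: 2
    show "norm (h $ j *\<^sub>R (D x (axis j 1) - D y (axis j 1))) \<le> norm h * (2 * (\<bar>L\<bar> * norm (x - y)))"
      unfolding norm_scaleR using ax[of j] component_le_norm_cart[of h j] by (intro mult_mono) auto
  qed
  finally show ?thesis by (simp add: mult.commute mult.left_commute)
qed

text \<open>On the segment from \<open>y\<close> to \<open>z\<close> the derivative of
  \<open>f - D y\<close> is at most \<open>K\<close> times the distance to \<open>y\<close>, so the
  mean value inequality gives a quadratic bound.\<close>

lemma taylor_remainder_quadratic:
  fixes f :: "'a::euclidean_space \<Rightarrow> 'b::euclidean_space"
  assumes d: "\<And>x. (f has_derivative D x) (at x)"
    and lip: "\<And>x y h. norm (D x h - D y h) \<le> K * norm (x - y) * norm h" and "K \<ge> 0"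
  shows "norm (f z - f y - D y (z - y)) \<le> K * (norm (z - y))\<^sup>2"
proof -
  have lin: "bounded_linear (D x)" for x using d has_derivative_bounded_linear by blast
  have "norm ((f z - D y z) - (f y - D y y)) \<le> (K * norm (z - y)) * norm (z - y)"
  proof (rule differentiable_bound[where S="closed_segment y z" and f="\<lambda>x. f x - D y x"
        and f'="\<lambda>x h. D x h - D y h" ])
    fix x assume x: "x \<in> closed_segment y z"
    show "((\<lambda>x. f x - D y x) has_derivative (\<lambda>h. D x h - D y h)) (at x within closed_segment y z)"
      by (intro derivative_intros has_derivative_at_withinI[OF d] bounded_linear_imp_has_derivative lin)
    have "norm (x - y) \<le> norm (z - y)" using segment_bound1[OF x] by simp
    then show "onorm (\<lambda>h. D x h - D y h) \<le> K * norm (z - y)"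
      using \<open>K \<ge> 0\<close>
      by (intro onorm_bound order.trans[OF lip] mult_right_mono mult_left_mono) auto
  qed auto
  then show ?thesis using bounded_linear.linear[OF lin[of y]]
    by (simp add: linear_diff algebra_simps power2_eq_square)
qed

section \<open>Velocity fields of constant controls\<close>

locale control_system =
  fixes F :: "real^2 \<Rightarrow> real^2" and G :: "nat \<Rightarrow> real^2 \<Rightarrow> real^2"
    and DF :: "real^2 \<Rightarrow> real^2 \<Rightarrow> real^2" and DG :: "nat \<Rightarrow> real^2 \<Rightarrow> real^2 \<Rightarrow> real^2"
    and M :: nat and L Tc :: real
  assumes M: "M \<in> {1, 2}"
    and DF: "\<And>x. (F has_derivative DF x) (at x)"
    and DG: "\<And>i x. i < M \<Longrightarrow> (G i has_derivative DG i x) (at x)"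
    and F_lip: "\<And>x y j k. \<bar>DF x (axis j 1) $ k - DF y (axis j 1) $ k\<bar> \<le> L * norm (x - y)"
    and G_lip: "\<And>i x y j k. i < M \<Longrightarrow>
                  \<bar>DG i x (axis j 1) $ k - DG i y (axis j 1) $ k\<bar> \<le> L * norm (x - y)"
    and F0: "F 0 = 0"
    and rank: "\<And>i. i < M \<Longrightarrow> rank (transpose (vector [G i 0, DF 0 (G i 0)] :: real^2^2)) = 2"
    and DG0: "\<And>i. i < M \<Longrightarrow> DG i 0 = (\<lambda>v. 0)"
    and Tc: "good_horizon F G M Tc"
begin

definition ctrl :: "(nat \<Rightarrow> real) \<Rightarrow> bool" where "ctrl v \<longleftrightarrow> (\<forall>i<M. \<bar>v i\<bar> \<le> 1)"

definition fv :: "(nat \<Rightarrow> real) \<Rightarrow> real^2 \<Rightarrow> real^2" where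
  "fv v x = F x + (\<Sum>i<M. v i *\<^sub>R G i x)"

definition Dv :: "(nat \<Rightarrow> real) \<Rightarrow> real^2 \<Rightarrow> real^2 \<Rightarrow> real^2" where
  "Dv v x h = DF x h + (\<Sum>i<M. v i *\<^sub>R DG i x h)"

abbreviation T :: "real^2 \<Rightarrow> ereal" where "T \<equiv> min_time F G M"

abbreviation R :: "real \<Rightarrow> (real^2) set" where "R r \<equiv> reach_set F G M (ereal r)"

definition K :: real where "K = 4 * \<bar>L\<bar> * (1 + real M)"

lemma K_nonneg: "K \<ge> 0" by (simp add: K_def)

lemma M_pos: "M > 0" using M by auto

lemma fv_derivative: "(fv v has_derivative Dv v x) (at x)"
proof -
  have "((\<lambda>x. \<Sum>i<M. v i *\<^sub>R G i x) has_derivative (\<lambda>h. \<Sum>i<M. v i *\<^sub>R DG i x h)) (at x)"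
    by (rule has_derivative_sum, rule has_derivative_scaleR_right) (simp add: DG)
  from has_derivative_add[OF DF this] show ?thesis
    unfolding fv_def[abs_def] Dv_def[abs_def] .
qed

lemma Dv_linear: "bounded_linear (Dv v x)"
  by (rule has_derivative_bounded_linear[OF fv_derivative])

lemma Dv_lipschitz:
  assumes "ctrl v" shows "norm (Dv v x h - Dv v y h) \<le> K * norm (x - y) * norm h"
proof -
  define c where "c = 4 * \<bar>L\<bar> * norm (x - y) * norm h"
  have F: "norm (DF x h - DF y h) \<le> c" unfolding c_def
    by (rule derivative_lipschitz_of_partials[where D=DF and L=L])
      (use DF has_derivative_linear F_lip in blast)+
  have G: "norm (v i *\<^sub>R (DG i x h - DG i y h)) \<le> c" if "i < M" for i
  proof -
    have "norm (DG i x h - DG i y h) \<le> c" unfolding c_def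
      by (rule derivative_lipschitz_of_partials[where D="DG i" and L=L])
        (use DG[OF that] has_derivative_linear G_lip[OF that] in blast)+
    moreover have "\<bar>v i\<bar> \<le> 1" using assms that by (simp add: ctrl_def)
    ultimately show ?thesis using mult_mono[of "\<bar>v i\<bar>" 1 "norm (DG i x h - DG i y h)" c] by simp
  qed
  have "Dv v x h - Dv v y h = (DF x h - DF y h) + (\<Sum>i<M. v i *\<^sub>R (DG i x h - DG i y h))"
    by (simp add: Dv_def scaleR_right_diff_distrib sum_subtractf)
  also have "norm \<dots> \<le> c + (\<Sum>i<M. c)"
    using F G by (intro norm_triangle_le add_mono sum_norm_le) auto
  also have "\<dots> = K * norm (x - y) * norm h" by (simp add: c_def K_def algebra_simps)
  finally show ?thesis .
qed

lemma fv_remainder: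
  assumes "ctrl v" shows "norm (fv v z - fv v y - Dv v y (z - y)) \<le> K * (norm (z - y))\<^sup>2"
  by (rule taylor_remainder_quadratic[OF fv_derivative Dv_lipschitz[OF assms] K_nonneg])

text \<open>Here \<open>DG0\<close> enters: the linearization at the origin is the same for every
  control.\<close>

lemma Dv_0: "Dv v 0 = DF 0"
  using DG0 by (auto simp: Dv_def fun_eq_iff)

text \<open>The fields may grow quadratically, so bounds are local in space; they are uniform over
  the admissible constant controls.\<close>

lemma fv_bounds:
  obtains C where "C > 0" "\<And>v x. ctrl v \<Longrightarrow> norm x \<le> r \<Longrightarrow> norm (fv v x) \<le> C"
    "\<And>v. ctrl v \<Longrightarrow> C-lipschitz_on (cball 0 r) (fv v)"
    "\<And>v x h. ctrl v \<Longrightarrow> norm x \<le> r \<Longrightarrow> norm (Dv v x h) \<le> C * norm h"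
proof -
  define B where "B = onorm (DF 0) + K * \<bar>r\<bar>"
  define g where "g = (\<Sum>i<M. norm (G i 0))"
  define C where "C = g + B * (1 + \<bar>r\<bar>) + 1"
  have bl: "bounded_linear (DF 0)" using DF has_derivative_bounded_linear by blast
  have B0: "B \<ge> 0" using onorm_pos_le[OF bl] K_nonneg by (simp add: B_def)
  have g0: "g \<ge> 0" by (auto simp: g_def intro: sum_nonneg)
  have "B * \<bar>r\<bar> \<ge> 0" using B0 by simp
  then have CB: "B \<le> C" "C > 0" "g + B * \<bar>r\<bar> \<le> C" using B0 g0 unfolding C_def distrib_left by linarith+
  have D: "norm (Dv v x h) \<le> B * norm h" if "ctrl v" "norm x \<le> r" for v x h
  proof -
    have "norm (Dv v x h - Dv v 0 h) \<le> K * norm (x - 0) * norm h" by (rule Dv_lipschitz[OF that(1)])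
    also have "\<dots> \<le> K * \<bar>r\<bar> * norm h" using that K_nonneg by (intro mult_right_mono mult_left_mono) auto
    finally have "norm (Dv v x h - DF 0 h) \<le> K * \<bar>r\<bar> * norm h" by (simp add: Dv_0)
    moreover have "norm (DF 0 h) \<le> onorm (DF 0) * norm h" by (rule onorm[OF bl])
    ultimately show ?thesis using norm_triangle_sub[of "Dv v x h" "DF 0 h"] by (simp add: B_def algebra_simps)
  qed
  have lip: "B-lipschitz_on (cball 0 r) (fv v)" if "ctrl v" for v
  proof (rule lipschitz_onI[OF _ B0])
    fix x y :: "real^2" assume xy: "x \<in> cball 0 r" "y \<in> cball 0 r"
    have "norm (fv v x - fv v y) \<le> B * norm (x - y)"
    proof (rule differentiable_bound[OF convex_cball _ _ xy])
      fix z :: "real^2" assume "z \<in> cball 0 r"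
      then show "onorm (Dv v z) \<le> B" using D[OF that] by (intro onorm_le) auto
      show "(fv v has_derivative Dv v z) (at z within cball 0 r)"
        using fv_derivative has_derivative_at_withinI by blast
    qed
    then show "dist (fv v x) (fv v y) \<le> B * dist x y" by (simp add: dist_norm)
  qed
  have b: "norm (fv v x) \<le> C" if "ctrl v" "norm x \<le> r" for v x
  proof -
    have "dist (fv v x) (fv v 0) \<le> B * dist x 0"
      using lipschitz_onD[OF lip[OF that(1)], of x 0] that order.trans[OF norm_ge_zero that(2)] by (auto simp: dist_norm)
    also have "\<dots> \<le> B * \<bar>r\<bar>" using that B0 by (intro mult_left_mono) auto
    finally have 1: "norm (fv v x - fv v 0) \<le> B * \<bar>r\<bar>" by (simp add: dist_norm)
    have "norm (fv v 0) \<le> g"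
      unfolding fv_def g_def using F0 that(1)
      by (auto intro!: sum_norm_le mult_left_le_one_le simp: ctrl_def)
    then show ?thesis using 1 norm_triangle_sub[of "fv v x" "fv v 0"] CB by simp
  qed
  show ?thesis
  proof (rule that[OF CB(2) b])
    show "C-lipschitz_on (cball 0 r) (fv v)" if "ctrl v" for v
      using lipschitz_on_mono[OF lip[OF that]] CB by auto
    show "norm (Dv v x h) \<le> C * norm h" if "ctrl v" "norm x \<le> r" for v x h
      using D[OF that] CB(1) by (meson mult_right_mono norm_ge_zero order.trans)
  qed auto
qed

lemma fv_continuous: "continuous_on A (fv v)"
  by (rule continuous_at_imp_continuous_on) (use fv_derivative has_derivative_continuous in blast)

text \<open>From here on curves are parametrised by the time to go, so that they solve the system
  backwards.\<close>

definition backward_arc :: "(nat \<Rightarrow> real) \<Rightarrow> (real \<Rightarrow> real^2) \<Rightarrow> real \<Rightarrow> real \<Rightarrow> bool" where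
  "backward_arc v z a b \<longleftrightarrow> ctrl v \<and> (\<forall>s\<in>{a..b}. (z has_vector_derivative - fv v (z s)) (at s within {a..b}))"

lemma backward_arc_subset: "backward_arc v z a b \<Longrightarrow> a \<le> a' \<Longrightarrow> b' \<le> b \<Longrightarrow> backward_arc v z a' b'"
  unfolding backward_arc_def
  by (intro conjI ballI has_vector_derivative_within_subset[where S="{a..b}" and T="{a'..b'}"]) auto

lemma backward_arc_continuous: "backward_arc v z a b \<Longrightarrow> continuous_on {a..b} z"
  unfolding backward_arc_def by (rule continuous_on_vector_derivative[of _ z "\<lambda>s. - fv v (z s)"]) auto

lemma backward_arc_ctrl: "backward_arc v z a b \<Longrightarrow> ctrl v" by (simp add: backward_arc_def)

lemma backward_arc_at:
  assumes "backward_arc v z a b" "s \<in> {a<..<b}"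
  shows "(z has_vector_derivative - fv v (z s)) (at s)"
  using assms unfolding backward_arc_def
  by (metis at_within_Icc_at atLeastAtMost_iff greaterThanLessThan_iff less_eq_real_def)

text \<open>Uniqueness at an equilibrium, by Gronwall for the squared distance in both time
  directions. It later excludes a vanishing velocity on arcs along which \<open>T\<close>
  grows.\<close>

lemma backward_arc_const_of_zero:
  assumes arc: "backward_arc v z a b" and c: "c \<in> {a..b}" "fv v (z c) = 0" and s: "s \<in> {a..b}"
  shows "z s = z c"
proof -
  have cont: "continuous_on {a..b} z" using arc by (rule backward_arc_continuous)
  have "compact (z ` {a..b})" using cont by (intro compact_continuous_image) auto
  then obtain r where "\<forall>x\<in>z ` {a..b}. norm x \<le> r" using compact_imp_bounded bounded_iff by blast
  then have r: "\<And>s. s \<in> {a..b} \<Longrightarrow> norm (z s) \<le> r" by auto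
  obtain C where C: "C > 0" "\<And>v. ctrl v \<Longrightarrow> C-lipschitz_on (cball 0 r) (fv v)"
    using fv_bounds[of r] by metis
  have lip: "norm (fv v (z s)) \<le> C * norm (z s - z c)" if "s \<in> {a..b}" for s
    using lipschitz_onD[OF C(2)[OF backward_arc_ctrl[OF arc]], of "z s" "z c"] r[OF that] r[OF c(1)] c(2) by (auto simp: dist_norm)
  have ip: "\<bar>2 * ((z s - z c) \<bullet> fv v (z s))\<bar> \<le> 2 * C * (norm (z s - z c))\<^sup>2" if "s \<in> {a..b}" for s
  proof -
    have "\<bar>(z s - z c) \<bullet> fv v (z s)\<bar> \<le> norm (z s - z c) * norm (fv v (z s))" by (rule Cauchy_Schwarz_ineq2)
    also have "\<dots> \<le> norm (z s - z c) * (C * norm (z s - z c))" using lip[OF that] by (intro mult_left_mono) auto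
    finally show ?thesis by (simp add: power2_eq_square algebra_simps)
  qed
  have der: "((\<lambda>s. (norm (z s - z c))\<^sup>2) has_real_derivative (- 2 * ((z s - z c) \<bullet> fv v (z s)))) (at s)"
    if "s \<in> {a<..<b}" for s
    using backward_arc_at[OF arc that]
    unfolding has_real_derivative_iff_has_vector_derivative power2_norm_eq_inner has_vector_derivative_def
    by (auto intro!: derivative_eq_intros simp: inner_commute algebra_simps)
  have "(norm (z s - z c))\<^sup>2 \<le> 0"
  proof (cases "c \<le> s")
    case True
    have "(norm (z s - z c))\<^sup>2 \<le> 0 * (s - c) * exp (2 * C * (s - c))"
    proof (rule gronwall_upper[where P="{}" and W'="\<lambda>s. - 2 * ((z s - z c) \<bullet> fv v (z s))"])
      show "continuous_on {c..s} (\<lambda>s. (norm (z s - z c))\<^sup>2)"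
        using c s by (intro continuous_intros continuous_on_subset[OF cont]) auto
      fix q assume q: "q \<in> {c<..<s} - {}"
      then have q': "q \<in> {a<..<b}" "q \<in> {a..b}" using c s by auto
      from der[OF q'(1)] show "((\<lambda>s. (norm (z s - z c))\<^sup>2) has_real_derivative (- 2 * ((z q - z c) \<bullet> fv v (z q)))) (at q)" .
      show "- 2 * ((z q - z c) \<bullet> fv v (z q)) \<le> 2 * C * (norm (z q - z c))\<^sup>2 + 0"
        using ip[OF q'(2)] by linarith
    qed (use True C in auto)
    then show ?thesis by simp
  next
    case False
    have "(norm (z (c - (c - s)) - z c))\<^sup>2 \<le> 0 * ((c - s) - 0) * exp (2 * C * ((c - s) - 0))"
    proof (rule gronwall_upper[where P="{}" and W="\<lambda>q. (norm (z (c - q) - z c))\<^sup>2"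
          and W'="\<lambda>q. 2 * ((z (c - q) - z c) \<bullet> fv v (z (c - q)))"])
      show "continuous_on {0..c - s} (\<lambda>q. (norm (z (c - q) - z c))\<^sup>2)"
        by (intro continuous_intros continuous_on_compose2[OF cont]) (use c s in auto)
      fix q assume q: "q \<in> {0<..<c - s} - {}"
      then have q': "c - q \<in> {a<..<b}" "c - q \<in> {a..b}" using c s by auto
      have "((\<lambda>q. (norm (z (c - q) - z c))\<^sup>2) has_real_derivative
          ((- 2 * ((z (c - q) - z c) \<bullet> fv v (z (c - q)))) * (- 1))) (at q)"
        by (rule DERIV_chain'[where f="\<lambda>q. c - q" and g="\<lambda>s. (norm (z s - z c))\<^sup>2"])
          (use der[OF q'(1)] in \<open>auto intro!: derivative_eq_intros\<close>)
      then show "((\<lambda>q. (norm (z (c - q) - z c))\<^sup>2) has_real_derivative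
          2 * ((z (c - q) - z c) \<bullet> fv v (z (c - q)))) (at q)" by simp
      show "2 * ((z (c - q) - z c) \<bullet> fv v (z (c - q))) \<le> 2 * C * (norm (z (c - q) - z c))\<^sup>2 + 0"
        using ip[OF q'(2)] by linarith
    qed (use False C in auto)
    then show ?thesis by simp
  qed
  then show ?thesis by simp
qed

end

text \<open>\<open>bang_bang\<close> gives only local constancy off \<open>P\<close>; connectedness
  of an interval free of \<open>P\<close> makes it global there.\<close>

lemma bang_bang_const_on_gap:
  fixes u :: "real \<Rightarrow> nat \<Rightarrow> real"
  assumes P: "\<forall>i<M. \<forall>s\<in>{0..t} - P. \<bar>u s i\<bar> = 1 \<and> (\<exists>e>0. \<forall>r\<in>{0..t} - P. \<bar>r - s\<bar> < e \<longrightarrow> u r i = u s i)"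
    and gap: "{a<..<b} \<inter> P = {}" "0 \<le> a" "b \<le> t" "a < b"
  obtains v :: "nat \<Rightarrow> real" where "\<And>i. i < M \<Longrightarrow> \<bar>v i\<bar> = 1" "\<And>r i. r \<in> {a<..<b} \<Longrightarrow> i < M \<Longrightarrow> u r i = v i"
proof (rule that[of "u ((a + b) / 2)"])
  have sub: "{a<..<b} \<subseteq> {0..t} - P" using gap by auto
  have mid: "(a + b) / 2 \<in> {a<..<b}" using gap by auto
  show "\<bar>u ((a + b) / 2) i\<bar> = 1" if "i < M" for i using P that sub mid by blast
  fix r i assume r: "r \<in> {a<..<b}" and i: "i < M"
  show "u r i = u ((a + b) / 2) i"
  proof (rule connected_local_const[where f="\<lambda>r. u r i" and A="{a<..<b}", OF _ r mid])
    show "\<forall>s\<in>{a<..<b}. eventually (\<lambda>r. u s i = u r i) (at s within {a<..<b})"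
    proof
      fix s assume s: "s \<in> {a<..<b}"
      then obtain e where e: "e > 0" "\<forall>r\<in>{0..t} - P. \<bar>r - s\<bar> < e \<longrightarrow> u r i = u s i"
        using P i sub by blast
      have "eventually (\<lambda>r. r \<in> {a<..<b} \<and> dist r s < e) (at s within {a<..<b})"
        using e(1) by (auto simp: eventually_at)
      then show "eventually (\<lambda>r. u s i = u r i) (at s within {a<..<b})"
        by (rule eventually_mono) (use e(2) sub in \<open>auto simp: dist_real_def\<close>)
    qed
  qed auto
qed

lemma finite_gap:
  fixes P :: "real set"
  assumes "finite P"
  obtains e where "e > 0" "{s<..<s + e} \<inter> P = {}" "{s - e<..<s} \<inter> P = {}"
proof -
  obtain d where d: "d > 0" "\<forall>x\<in>P. x \<noteq> s \<longrightarrow> d \<le> dist s x"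
    using finite_set_avoid[OF assms] by blast
  show ?thesis by (rule that[OF d(1)]) (use d(2) in \<open>fastforce simp: dist_real_def\<close>)+
qed

section \<open>Optimal curves in backward time\<close>

context control_system
begin

text \<open>The control may differ from \<open>v\<close> at the endpoints of the interval, but these
  are negligible for the integral; the remaining integrand is continuous, so the integral equation
  becomes a differential equation on the closed interval.\<close>

lemma backward_arc_of_trajectory:
  assumes tr: "trajectory F G M t u y" and ab: "0 \<le> a" "a < b" "b \<le> t" and v: "ctrl v"
    and const: "\<And>r i. r \<in> {a<..<b} \<Longrightarrow> i < M \<Longrightarrow> u r i = v i"
  shows "backward_arc v (\<lambda>s. y (t - s)) (t - b) (t - a)"
proof -
  have conty: "continuous_on {a..b} y"
    using tr ab by (auto simp: trajectory_def intro: continuous_on_subset[where s="{0..t}"])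
  have I: "((\<lambda>r. fv v (y r)) has_integral (y s - y a)) {a..s}" if s: "s \<in> {a..b}" for s
  proof (rule has_integral_spike_finite[of "{a, b}"])
    show "((\<lambda>r. F (y r) + (\<Sum>i<M. u r i *\<^sub>R G i (y r))) has_integral (y s - y a)) {a..s}"
      using s ab by (intro trajectory_integral[OF tr]) auto
    show "fv v (y r) = F (y r) + (\<Sum>i<M. u r i *\<^sub>R G i (y r))" if "r \<in> {a..s} - {a, b}" for r
      using const[of r] that s by (auto simp: fv_def)
  qed auto
  have cont: "continuous_on {a..b} (\<lambda>r. fv v (y r))"
    by (rule continuous_on_compose2[OF fv_continuous conty]) auto
  have dy: "(y has_vector_derivative fv v (y s)) (at s within {a..b})" if s: "s \<in> {a..b}" for s
  proof -
    have "((\<lambda>s. y a + integral {a..s} (\<lambda>r. fv v (y r))) has_vector_derivative 0 + fv v (y s)) (at s within {a..b})"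
      by (rule has_vector_derivative_add[OF has_vector_derivative_const integral_has_vector_derivative[OF cont s]])
    then show ?thesis
      by (intro has_vector_derivative_transform[OF s, of y "\<lambda>s. y a + integral {a..s} (\<lambda>r. fv v (y r))"])
        (use integral_unique[OF I] in auto)
  qed
  show ?thesis unfolding backward_arc_def
  proof (intro conjI ballI v)
    fix s assume s: "s \<in> {t - b..t - a}"
    have img: "(\<lambda>s. t - s) ` {t - b..t - a} = {a..b}"
      by (auto simp: image_iff intro!: bexI[of _ "t - _"])
    have "((\<lambda>s. t - s) has_vector_derivative - 1) (at s within {t - b..t - a})"
      by (auto intro!: derivative_eq_intros)
    moreover have "(y has_vector_derivative fv v (y (t - s))) (at (t - s) within (\<lambda>s. t - s) ` {t - b..t - a})"
      unfolding img using s by (intro dy) auto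
    ultimately have "((y \<circ> (\<lambda>s. t - s)) has_vector_derivative (- 1) *\<^sub>R fv v (y (t - s))) (at s within {t - b..t - a})"
      by (rule vector_diff_chain_within)
    then show "((\<lambda>s. y (t - s)) has_vector_derivative - fv v (y (t - s))) (at s within {t - b..t - a})"
      by (simp add: comp_def)
  qed
qed

text \<open>Piecewise constancy of the control is encoded by one arc on each side of every time
  instead of a list of switching times, the form needed for continuation arguments. The last clause
  keeps a finite exceptional set for the integral estimates.\<close>

definition opt_curve :: "real \<Rightarrow> (real \<Rightarrow> real^2) \<Rightarrow> bool" where
  "opt_curve t z \<longleftrightarrow> 0 < t \<and> t < Tc \<and> z 0 = 0 \<and> continuous_on {0..t} z \<and>
     (\<forall>s\<in>{0..t}. T (z s) = ereal s) \<and>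
     (\<forall>s\<in>{0..<t}. \<exists>e>0. s + e \<le> t \<and> (\<exists>v. backward_arc v z s (s + e))) \<and>
     (\<forall>s\<in>{0<..t}. \<exists>e>0. 0 \<le> s - e \<and> (\<exists>v. backward_arc v z (s - e) s)) \<and>
     (\<exists>P. finite P \<and> (\<forall>s\<in>{0<..<t} - P. \<exists>v. ctrl v \<and> (z has_vector_derivative - fv v (z s)) (at s)))"

lemma opt_curveD:
  assumes "opt_curve t z"
  shows "0 < t" "t < Tc" "z 0 = 0" "continuous_on {0..t} z" "s \<in> {0..t} \<Longrightarrow> T (z s) = ereal s"
    "s \<in> {0..<t} \<Longrightarrow> \<exists>e>0. s + e \<le> t \<and> (\<exists>v. backward_arc v z s (s + e))"
    "s \<in> {0<..t} \<Longrightarrow> \<exists>e>0. 0 \<le> s - e \<and> (\<exists>v. backward_arc v z (s - e) s)"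
    "\<exists>P. finite P \<and> (\<forall>s\<in>{0<..<t} - P. \<exists>v. ctrl v \<and> (z has_vector_derivative - fv v (z s)) (at s))"
  using assms unfolding opt_curve_def by blast+

lemma opt_curve_restrict:
  assumes opt: "opt_curve t z" and t': "0 < t'" "t' \<le> t"
  shows "opt_curve t' z"
  unfolding opt_curve_def
proof (intro conjI ballI)
  show "\<exists>e>0. s + e \<le> t' \<and> (\<exists>v. backward_arc v z s (s + e))" if s: "s \<in> {0..<t'}" for s
  proof -
    have "s \<in> {0..<t}" using s t' by auto
    from opt_curveD(6)[OF opt this] obtain e v where e: "e > 0" "s + e \<le> t" "backward_arc v z s (s + e)" by blast
    have "backward_arc v z s (s + min e (t' - s))" by (rule backward_arc_subset[OF e(3)]) auto
    then show ?thesis using e s by (intro exI[of _ "min e (t' - s)"]) auto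
  qed
  show "continuous_on {0..t'} z"
    using t' by (intro continuous_on_subset[OF opt_curveD(4)[OF opt]]) auto
  show "\<exists>P. finite P \<and> (\<forall>s\<in>{0<..<t'} - P. \<exists>v. ctrl v \<and> (z has_vector_derivative - fv v (z s)) (at s))"
  proof -
    obtain P where "finite P" "\<forall>s\<in>{0<..<t} - P. \<exists>v. ctrl v \<and> (z has_vector_derivative - fv v (z s)) (at s)"
      using opt_curveD(8)[OF opt] by blast
    then show ?thesis using t' by (intro exI[of _ P]) auto
  qed
  show "\<exists>e>0. 0 \<le> s - e \<and> (\<exists>v. backward_arc v z (s - e) s)" if "s \<in> {0<..t'}" for s
    by (rule opt_curveD(7)[OF opt]) (use that t' in auto)
qed (use opt_curveD(1-5)[OF opt] t' in auto)

lemma opt_curve_of_bang_bang: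
  assumes tr: "trajectory F G M t u y" "y t = 0" and opt: "T (y 0) = ereal t" and bb: "bang_bang M t u"
    and t: "0 < t" "t < Tc"
  shows "opt_curve t (\<lambda>s. y (t - s))"
proof -
  obtain P where P: "finite P" "\<forall>i<M. \<forall>s\<in>{0..t} - P. \<bar>u s i\<bar> = 1 \<and>
        (\<exists>e>0. \<forall>r\<in>{0..t} - P. \<bar>r - s\<bar> < e \<longrightarrow> u r i = u s i)"
    using bb by (auto simp: bang_bang_def)
  have arc: "\<exists>v. backward_arc v (\<lambda>s. y (t - s)) (t - b) (t - a)"
    if ab: "{a<..<b} \<inter> P = {}" "0 \<le> a" "b \<le> t" "a < b" for a b
  proof -
    obtain v :: "nat \<Rightarrow> real" where v: "\<And>i. i < M \<Longrightarrow> \<bar>v i\<bar> = 1" "\<And>r i. r \<in> {a<..<b} \<Longrightarrow> i < M \<Longrightarrow> u r i = v i"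
      using bang_bang_const_on_gap[OF P(2) ab] by metis
    then have "ctrl v" by (simp add: ctrl_def)
    from backward_arc_of_trajectory[OF tr(1) ab(2,4,3) this v(2)] show ?thesis by blast
  qed
  show ?thesis unfolding opt_curve_def
  proof (intro conjI ballI)
    show "continuous_on {0..t} (\<lambda>s. y (t - s))"
      by (rule continuous_on_compose2[of "{0..t}" y])
        (use tr in \<open>auto simp: trajectory_def intro: continuous_intros\<close>)
    show "T (y (t - s)) = ereal s" if "s \<in> {0..t}" for s
      using min_time_along_optimal[OF tr opt, of "t - s"] that by auto
    show "\<exists>e>0. s + e \<le> t \<and> (\<exists>v. backward_arc v (\<lambda>s. y (t - s)) s (s + e))" if s: "s \<in> {0..<t}" for s
    proof -
      obtain e where e: "e > 0" "{(t - s) - e<..<t - s} \<inter> P = {}" using finite_gap[OF P(1), of "t - s"] by metis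
      define e' where "e' = min e (t - s)"
      have "{t - s - e'<..<t - s} \<subseteq> {(t - s) - e<..<t - s}" by (auto simp: e'_def)
      then have "\<exists>v. backward_arc v (\<lambda>s. y (t - s)) (t - (t - s)) (t - (t - s - e'))"
        by (intro arc) (use e s in \<open>auto simp: e'_def\<close>)
      then show ?thesis using e s by (intro exI[of _ e']) (auto simp: e'_def)
    qed
    show "\<exists>e>0. 0 \<le> s - e \<and> (\<exists>v. backward_arc v (\<lambda>s. y (t - s)) (s - e) s)" if s: "s \<in> {0<..t}" for s
    proof -
      obtain e where e: "e > 0" "{t - s<..<t - s + e} \<inter> P = {}" using finite_gap[OF P(1), of "t - s"] by metis
      define e' where "e' = min e s"
      have "{t - s<..<t - s + e'} \<subseteq> {t - s<..<t - s + e}" by (auto simp: e'_def)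
      then have "\<exists>v. backward_arc v (\<lambda>s. y (t - s)) (t - (t - s + e')) (t - (t - s))"
        by (intro arc) (use e s in \<open>auto simp: e'_def\<close>)
      then show ?thesis using e s by (intro exI[of _ e']) (auto simp: e'_def)
    qed
    show "\<exists>P. finite P \<and> (\<forall>s\<in>{0<..<t} - P. \<exists>v. ctrl v \<and>
        ((\<lambda>s. y (t - s)) has_vector_derivative - fv v (y (t - s))) (at s))"
    proof (intro exI[of _ "(\<lambda>p. t - p) ` P"] conjI ballI)
      show "finite ((\<lambda>p. t - p) ` P)" using P by simp
      fix s assume s: "s \<in> {0<..<t} - (\<lambda>p. t - p) ` P"
      then have nP: "t - s \<notin> P" by force
      obtain e where e: "e > 0" "{t - s<..<t - s + e} \<inter> P = {}" "{(t - s) - e<..<t - s} \<inter> P = {}"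
        using finite_gap[OF P(1), of "t - s"] by metis
      define e' where "e' = min e (min s (t - s))"
      have e': "0 < e'" "e' \<le> e" "e' \<le> s" "e' \<le> t - s" using e s by (auto simp: e'_def)
      have "\<exists>v. backward_arc v (\<lambda>s. y (t - s)) (t - (t - s + e')) (t - (t - s - e'))"
      proof (rule arc)
        show "{t - s - e'<..<t - s + e'} \<inter> P = {}"
        proof (rule ccontr)
          assume "{t - s - e'<..<t - s + e'} \<inter> P \<noteq> {}"
          then obtain p where p: "p \<in> P" "t - s - e' < p" "p < t - s + e'" by auto
          then have "p \<in> {t - s<..<t - s + e} \<or> p \<in> {(t - s) - e<..<t - s} \<or> p = t - s" using e' by auto
          then show False using p e nP by auto
        qed
      qed (use e' in auto)
      then obtain v where v: "backward_arc v (\<lambda>s. y (t - s)) (s - e') (s + e')" by auto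
      then show "\<exists>v. ctrl v \<and> ((\<lambda>s. y (t - s)) has_vector_derivative - fv v (y (t - s))) (at s)"
        using backward_arc_at[OF v, of s] backward_arc_ctrl[OF v] e' by auto
    qed
  qed (use t tr in auto)
qed

lemma horizon:
  assumes "0 < r" "r < Tc"
  shows "strictly_convex (R r)" "x \<in> frontier (R r) \<Longrightarrow> unique_bang_bang_optimal F G M x"
    "x \<in> R r \<Longrightarrow> optimal_point F G M x"
  using Tc assms unfolding good_horizon_def by (meson greaterThanLessThan_iff)+

lemma Tc_pos: "Tc > 0" using Tc by (simp add: good_horizon_def)

text \<open>A bang-bang control is granted only at frontier points. As an optimal point,
  \<open>x\<close> is preceded on an optimal trajectory by points of larger minimum time arbitrarily
  close to it, so it is not interior to its own reachable set.\<close>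

lemma optimal_curve_exists:
  assumes r: "0 < r" "r < Tc" and x: "x \<in> R r" "x \<noteq> 0"
  obtains t z where "opt_curve t z" "z t = x" "T x = ereal t" "t \<le> r"
proof -
  obtain w u y t s where o: "ereal t = T w" "trajectory F G M t u y" "y 0 = w" "y t = 0"
      "0 < s" "s \<le> t" "y s = x"
    using horizon(3)[OF r x(1)] by (auto simp: optimal_point_def)
  have T: "T (y q) = ereal (t - q)" if "q \<in> {0..t}" for q
    using min_time_along_optimal[OF o(2,4) _ that] o by simp
  have Tx: "T x = ereal (t - s)" using T[of s] o by auto
  have "s \<noteq> t" using o x by auto
  then have pos: "0 < t - s" using o by simp
  have le: "t - s \<le> r" using x Tx by (simp add: reach_set_def)
  have "x \<notin> interior (R (t - s))"
  proof
    assume "x \<in> interior (R (t - s))"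
    then obtain e where e: "e > 0" "ball x e \<subseteq> R (t - s)" using mem_interior by blast
    have "continuous_on {0..t} y" using o by (simp add: trajectory_def)
    then obtain d where d: "d > 0" "\<And>q. q \<in> {0..t} \<Longrightarrow> dist q s < d \<Longrightarrow> dist (y q) (y s) < e"
      unfolding continuous_on_iff using e o by (metis atLeastAtMost_iff less_eq_real_def)
    define q where "q = s - min (d / 2) s"
    have q: "q \<in> {0..t}" "dist q s < d" "q < s" using o d by (auto simp: q_def dist_real_def)
    then have "y q \<in> R (t - s)" using d(2)[OF q(1,2)] e o by (auto simp: dist_commute)
    then show False using T[OF q(1)] q by (simp add: reach_set_def)
  qed
  moreover have "x \<in> R (t - s)" using Tx by (simp add: reach_set_def)
  ultimately have "x \<in> frontier (R (t - s))" using closure_subset by (auto simp: frontier_def)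
  then obtain u' where u': "optimal_control F G M x u'" "bang_bang M (real_of_ereal (T x)) u'"
    using horizon(2)[of "t - s" x] pos le r by (auto simp: unique_bang_bang_optimal_def)
  then obtain t' y' where y': "ereal t' = T x" "trajectory F G M t' u' y'" "y' 0 = x" "y' t' = 0"
    by (auto simp: optimal_control_def)
  have t': "t' = t - s" using y'(1) Tx by simp
  have "opt_curve t' (\<lambda>s. y' (t' - s))"
    by (rule opt_curve_of_bang_bang[OF y'(2,4)]) (use y' u' t' pos le r Tx in auto)
  then show ?thesis by (rule that) (use y' t' Tx le in auto)
qed

section \<open>Convexity and interior of the reachable sets\<close>

lemma T_zero: "T 0 = 0" by (rule min_time_zero) (rule F0)

lemma R_zero: "R 0 = {0}"
proof -
  have "x = 0" if "x \<in> R 0" for x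
  proof (rule ccontr)
    assume "x \<noteq> 0"
    have "T x = 0" using that min_time_nonneg[of F G M x] by (simp add: reach_set_def zero_ereal_def[symmetric])
    then have "x \<in> R (Tc / 2)" using Tc_pos by (simp add: reach_set_def)
    then obtain t z where "opt_curve t z" "T x = ereal t"
      by (rule optimal_curve_exists[rotated 2]) (use Tc_pos \<open>x \<noteq> 0\<close> in auto)
    then show False using \<open>T x = 0\<close> by (auto simp: opt_curve_def)
  qed
  then show ?thesis using T_zero by (auto simp: reach_set_def)
qed

lemma R_convex: assumes "0 \<le> r" "r < Tc" shows "convex (R r)"
  using horizon(1)[of r] R_zero assms by (cases "r = 0") (auto simp: strictly_convex_def)

lemma R_mono: "r \<le> r' \<Longrightarrow> R r \<subseteq> R r'"
  by (auto simp: reach_set_def intro: order.trans)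

lemma zero_in_R: "0 \<le> r \<Longrightarrow> 0 \<in> R r" using T_zero by (simp add: reach_set_def)

text \<open>Strict convexity puts the midpoint of \<open>x\<close> and the origin into the
  interior.\<close>

lemma R_interior_nonempty:
  assumes "0 < r" "r < Tc" "x \<in> R r" "x \<noteq> 0"
  shows "interior (R r) \<noteq> {}"
proof -
  have "(1 - 1/2) *\<^sub>R x + (1/2) *\<^sub>R 0 \<in> interior (R r)"
    using horizon(1)[OF assms(1,2)] assms zero_in_R[of r] unfolding strictly_convex_def
    by (auto simp: Ball_def)
  then show ?thesis by blast
qed

end

section \<open>Transport of normals\<close>

text \<open>The planar determinant; with \<open>rot\<close>, the rotation by a right angle, it is
  also an inner product, which links it to normals.\<close>

definition cross2 :: "real^2 \<Rightarrow> real^2 \<Rightarrow> real" where "cross2 a b = a $ 1 * b $ 2 - a $ 2 * b $ 1"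

definition rot :: "real^2 \<Rightarrow> real^2" where "rot a = vector [- a $ 2, a $ 1]"

lemma inner_2: "(a::real^2) \<bullet> b = a $ 1 * b $ 1 + a $ 2 * b $ 2"
  by (simp add: inner_vec_def UNIV_2)

lemma rot_nth [simp]: "rot a $ 1 = - a $ 2" "rot a $ 2 = a $ 1"
  by (auto simp: rot_def)

lemma rot_inner: "rot a \<bullet> b = cross2 a b"
  by (simp add: inner_2 cross2_def)

lemma norm_rot [simp]: "norm (rot a) = norm a"
  by (simp add: norm_eq_sqrt_inner inner_2)

lemma cross2_self [simp]: "cross2 a a = 0" by (simp add: cross2_def)

lemma cross2_le: "\<bar>cross2 a b\<bar> \<le> norm a * norm b"
  using Cauchy_Schwarz_ineq2[of "rot a" b] by (simp add: rot_inner)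

lemma cross2_bilinear: "bounded_bilinear cross2"
proof
  show "\<exists>K. \<forall>a b. norm (cross2 a b) \<le> norm a * norm b * K" using cross2_le by (intro exI[of _ 1]) auto
qed (auto simp: cross2_def algebra_simps)

lemmas cross2_simps = bounded_bilinear.add_left[OF cross2_bilinear] bounded_bilinear.add_right[OF cross2_bilinear]
  bounded_bilinear.diff_left[OF cross2_bilinear] bounded_bilinear.diff_right[OF cross2_bilinear]
  bounded_bilinear.scaleR_left[OF cross2_bilinear] bounded_bilinear.scaleR_right[OF cross2_bilinear]
  bounded_bilinear.minus_left[OF cross2_bilinear] bounded_bilinear.minus_right[OF cross2_bilinear]

text \<open>The infinitesimal form of Liouville's formula: a linear flow changes areas at the rate
  of its trace. It turns the linearized system into a scalar equation for a determinant.\<close>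

lemma cross2_trace:
  assumes "linear A"
  shows "cross2 (A w) d + cross2 w (A d) = (A (axis 1 1) $ 1 + A (axis 2 1) $ 2) * cross2 w d"
proof -
  have ex: "A h = h $ 1 *\<^sub>R A (axis 1 1) + h $ 2 *\<^sub>R A (axis 2 1)" for h
  proof -
    have "h = h $ 1 *\<^sub>R axis 1 1 + h $ 2 *\<^sub>R axis 2 1"
      by (simp add: vec_eq_iff forall_2 axis_def)
    then have "A h = A (h $ 1 *\<^sub>R axis 1 1 + h $ 2 *\<^sub>R axis 2 1)" by simp
    then show ?thesis using assms by (simp add: linear_add linear_scale)
  qed
  show ?thesis by (subst ex[of w], subst ex[of d]) (simp add: cross2_def algebra_simps)
qed

lemma orthogonal_is_rot_multiple:
  assumes "p \<bullet> a = 0" "a \<noteq> (0::real^2)"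
  shows "p = ((p \<bullet> rot a) / (norm a)\<^sup>2) *\<^sub>R rot a"
proof -
  have n: "(norm a)\<^sup>2 = a $ 1 * a $ 1 + a $ 2 * a $ 2"
    by (simp only: power2_norm_eq_inner inner_2)
  have nz: "(norm a)\<^sup>2 \<noteq> 0" using assms by simp
  have eq: "(norm a)\<^sup>2 *\<^sub>R p = (p \<bullet> rot a) *\<^sub>R rot a"
  proof -
    have "(norm a)\<^sup>2 * p $ 1 - (p \<bullet> rot a) * rot a $ 1 = a $ 1 * (p \<bullet> a)"
         "(norm a)\<^sup>2 * p $ 2 - (p \<bullet> rot a) * rot a $ 2 = a $ 2 * (p \<bullet> a)"
      unfolding n inner_2 by (simp_all add: algebra_simps)
    then show ?thesis using assms by (simp add: vec_eq_iff forall_2)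
  qed
  have "p = (1 / (norm a)\<^sup>2) *\<^sub>R ((norm a)\<^sup>2 *\<^sub>R p)" using nz by simp
  also have "\<dots> = (1 / (norm a)\<^sup>2) *\<^sub>R ((p \<bullet> rot a) *\<^sub>R rot a)"
    by (simp only: eq)
  finally show ?thesis by simp
qed

lemma has_real_derivative_norm_square:
  fixes d :: "real \<Rightarrow> 'a::real_inner"
  assumes "(d has_vector_derivative g) (at q)"
  shows "((\<lambda>q. (norm (d q))\<^sup>2) has_real_derivative 2 * (d q \<bullet> g)) (at q)"
  using assms
  unfolding has_real_derivative_iff_has_vector_derivative power2_norm_eq_inner has_vector_derivative_def
  by (auto intro!: derivative_eq_intros simp: inner_commute algebra_simps)

section \<open>Minimum conditions and normals along arcs\<close>

context control_system
begin

text \<open>Together with \<open>hamiltonian_attained\<close> this identifies the Hamiltonian as a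
  minimum over admissible constant controls.\<close>

lemma hamiltonian_le: "ctrl v \<Longrightarrow> hamiltonian F G M x p \<le> p \<bullet> fv v x"
proof -
  assume v: "ctrl v"
  have "(\<Sum>i<M. - \<bar>p \<bullet> G i x\<bar>) \<le> (\<Sum>i<M. v i * (p \<bullet> G i x))"
  proof (rule sum_mono)
    fix i assume "i \<in> {..<M}"
    then have "\<bar>v i\<bar> \<le> 1" using v by (simp add: ctrl_def)
    then have "\<bar>v i * (p \<bullet> G i x)\<bar> \<le> \<bar>p \<bullet> G i x\<bar>"
      by (simp add: abs_mult mult_left_le_one_le)
    then show "- \<bar>p \<bullet> G i x\<bar> \<le> v i * (p \<bullet> G i x)" by linarith
  qed
  then show ?thesis
    by (simp add: hamiltonian_def fv_def inner_add_right inner_sum_right sum_negf)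
qed

lemma hamiltonian_attained: "\<exists>v. ctrl v \<and> hamiltonian F G M x p = p \<bullet> fv v x"
proof (intro exI[of _ "\<lambda>i. - sgn (p \<bullet> G i x)"] conjI)
  show "ctrl (\<lambda>i. - sgn (p \<bullet> G i x))" by (auto simp: ctrl_def sgn_if)
  show "hamiltonian F G M x p = p \<bullet> fv (\<lambda>i. - sgn (p \<bullet> G i x)) x"
    by (simp add: hamiltonian_def fv_def inner_diff_right inner_sum_right sum_negf abs_sgn mult.commute)
qed

text \<open>Normality is meant in the convex sense, without a quadratic term;
  \<open>singular_set_iff\<close> shows that for these convex sets nothing is lost. The radius
  \<open>r\<close> is a separate argument, later specialised to the minimum time.\<close>

definition singular_at :: "real \<Rightarrow> real^2 \<Rightarrow> bool" where
  "singular_at r x \<longleftrightarrow> (\<exists>p. norm p = 1 \<and> (\<forall>y\<in>R r. p \<bullet> (y - x) \<le> 0) \<and> hamiltonian F G M x p = 0)"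

lemma backward_arc_inner_increment:
  assumes arc: "backward_arc v z a b" and "a \<le> b" and c: "\<And>s. s \<in> {a<..<b} \<Longrightarrow> p \<bullet> fv v (z s) \<ge> c"
  shows "p \<bullet> (z a - z b) \<ge> c * (b - a)"
proof -
  have "c * (b - a) + p \<bullet> (z b - z a) \<le> 0 * (b - a) * exp (0 * (b - a))"
  proof (rule gronwall_upper[where P="{}" and W="\<lambda>s. c * (s - a) + p \<bullet> (z s - z a)" and W'="\<lambda>s. c - p \<bullet> fv v (z s)"])
    show "continuous_on {a..b} (\<lambda>s. c * (s - a) + p \<bullet> (z s - z a))"
      by (intro continuous_intros backward_arc_continuous[OF arc])
    fix s assume s: "s \<in> {a<..<b} - {}"
    show "((\<lambda>s. c * (s - a) + p \<bullet> (z s - z a)) has_real_derivative c - p \<bullet> fv v (z s)) (at s)"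
      using backward_arc_at[OF arc, of s] s unfolding has_real_derivative_iff_has_vector_derivative
      by (auto intro!: derivative_eq_intros bounded_linear.has_vector_derivative[OF bounded_linear_inner_right])
    show "c - p \<bullet> fv v (z s) \<le> 0 * (c * (s - a) + p \<bullet> (z s - z a)) + 0" using c[of s] s by simp
  qed (use \<open>a \<le> b\<close> in auto)
  then show ?thesis by (simp add: inner_diff_right)
qed

text \<open>Run in reverse, the arc is an admissible trajectory from \<open>z b\<close> to
  \<open>z a\<close>.\<close>

lemma backward_arc_min_time:
  assumes arc: "backward_arc v z a b" and "a \<le> b"
  shows "T (z b) \<le> T (z a) + ereal (b - a)"
proof -
  have "trajectory F G M (b - a) (\<lambda>_. v) (\<lambda>s. z (b - s))"
  proof (rule trajectory_of_arc)
    fix s assume s: "s \<in> {0..b - a}"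
    have img: "(\<lambda>s. b - s) ` {0..b - a} = {a..b}"
      by (auto simp: image_iff intro!: bexI[of _ "b - _"])
    have "((\<lambda>s. b - s) has_vector_derivative - 1) (at s within {0..b - a})"
      by (auto intro!: derivative_eq_intros)
    moreover have "(z has_vector_derivative - fv v (z (b - s))) (at (b - s) within (\<lambda>s. b - s) ` {0..b - a})"
      unfolding img using s arc by (auto simp: backward_arc_def)
    ultimately have "((z \<circ> (\<lambda>s. b - s)) has_vector_derivative (- 1) *\<^sub>R (- fv v (z (b - s)))) (at s within {0..b - a})"
      by (rule vector_diff_chain_within)
    then show "((\<lambda>s. z (b - s)) has_vector_derivative F (z (b - s)) + (\<Sum>i<M. v i *\<^sub>R G i (z (b - s)))) (at s within {0..b - a})"
      by (simp add: comp_def fv_def add.commute)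
  qed (use backward_arc_ctrl[OF arc] \<open>a \<le> b\<close> in \<open>auto simp: ctrl_def\<close>)
  from min_time_dynamic_programming[OF this] show ?thesis by simp
qed

lemma backward_arc_in_R: "backward_arc v z a b \<Longrightarrow> a \<le> b \<Longrightarrow> z a \<in> R r \<Longrightarrow> z b \<in> R (r + (b - a))"
proof -
  assume "backward_arc v z a b" "a \<le> b" "z a \<in> R r"
  then have "T (z b) \<le> T (z a) + ereal (b - a)" "T (z a) \<le> ereal r"
    using backward_arc_min_time by (auto simp: reach_set_def)
  then have "T (z b) \<le> ereal r + ereal (b - a)" by (meson add_right_mono order.trans)
  then show ?thesis by (simp add: reach_set_def)
qed

text \<open>\<open>fv v\<close> is only locally Lipschitz; composing it with the nearest-point
  projection onto a ball makes it globally Lipschitz and leaves solutions inside the ball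
  unchanged.\<close>

lemma truncated_solution:
  assumes v: "ctrl v" and r: "r > 0" and lip: "C-lipschitz_on (cball 0 r) (fv v)" and C: "C > 0" and "a \<le> b"
  obtains Z where "Z a = z0"
    "\<And>s. s \<in> {a..b} \<Longrightarrow> (Z has_vector_derivative - fv v (closest_point (cball 0 r) (Z s))) (at s within {a..b})"
proof -
  have cp: "closest_point (cball 0 r) x \<in> cball 0 r" for x :: "real^2"
    using r by (intro closest_point_in_set) auto
  have "C-lipschitz_on UNIV (\<lambda>x. - fv v (closest_point (cball 0 r) x))"
  proof (rule lipschitz_onI)
    fix x y :: "real^2"
    have "dist (- fv v (closest_point (cball 0 r) x)) (- fv v (closest_point (cball 0 r) y))
        = dist (fv v (closest_point (cball 0 r) x)) (fv v (closest_point (cball 0 r) y))"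
      by (simp add: dist_norm norm_minus_commute)
    also have "\<dots> \<le> C * dist (closest_point (cball 0 r) x) (closest_point (cball 0 r) y)"
      by (rule lipschitz_onD[OF lip cp cp])
    also have "\<dots> \<le> C * dist x y"
      using C r by (intro mult_left_mono closest_point_lipschitz) auto
    finally show "dist (- fv v (closest_point (cball 0 r) x)) (- fv v (closest_point (cball 0 r) y)) \<le> C * dist x y" .
  qed (use C in auto)
  then obtain y where y: "y 0 = z0" "\<And>s. s \<in> {0..b - a} \<Longrightarrow>
      (y has_vector_derivative - fv v (closest_point (cball 0 r) (y s))) (at s within {0..b - a})"
    by (rule picard_exists[where h="b - a" and ?x0.0=z0]) (use C \<open>a \<le> b\<close> in auto)
  show ?thesis
  proof (rule that[of "\<lambda>s. y (s - a)"])
    show "y (a - a) = z0" using y by simp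
    fix s assume s: "s \<in> {a..b}"
    have img: "(\<lambda>s. s - a) ` {a..b} = {0..b - a}" by (auto simp: image_iff intro!: bexI[of _ "_ + a"])
    have "((\<lambda>s. s - a) has_vector_derivative 1) (at s within {a..b})"
      by (auto intro!: derivative_eq_intros)
    moreover have "(y has_vector_derivative - fv v (closest_point (cball 0 r) (y (s - a)))) (at (s - a) within (\<lambda>s. s - a) ` {a..b})"
      unfolding img using s by (intro y) auto
    ultimately have "((y \<circ> (\<lambda>s. s - a)) has_vector_derivative 1 *\<^sub>R (- fv v (closest_point (cball 0 r) (y (s - a))))) (at s within {a..b})"
      by (rule vector_diff_chain_within)
    then show "((\<lambda>s. y (s - a)) has_vector_derivative - fv v (closest_point (cball 0 r) (y (s - a)))) (at s within {a..b})"
      by (simp add: comp_def)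
  qed
qed

text \<open>The time \<open>h\<close> is uniform over controls and over starting points in a ball:
  with speed at most \<open>C\<close> on the ball enlarged by 1, a time \<open>1 / C\<close> moves
  the solution by at most 1, so the truncation is invisible.\<close>

lemma local_backward_solution:
  obtains h C where "h > 0" "C > 0"
    "\<And>v (w::real^2). ctrl v \<Longrightarrow> norm w \<le> r \<Longrightarrow> \<exists>Z. Z 0 = w \<and> backward_arc v Z 0 h \<and> (\<forall>s\<in>{0..h}. norm (Z s - w) \<le> C * s)"
proof -
  define r' where "r' = \<bar>r\<bar> + 1"
  obtain C where C: "C > 0" "\<And>v x. ctrl v \<Longrightarrow> norm x \<le> r' \<Longrightarrow> norm (fv v x) \<le> C"
    "\<And>v. ctrl v \<Longrightarrow> C-lipschitz_on (cball 0 r') (fv v)"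
    using fv_bounds[of r'] by metis
  show ?thesis
  proof (rule that[of "1 / C" C])
    fix v and w :: "real^2" assume v: "ctrl v" and w: "norm w \<le> r"
    obtain Z where Z: "Z 0 = w" "\<And>s. s \<in> {0..1 / C} \<Longrightarrow>
        (Z has_vector_derivative - fv v (closest_point (cball 0 r') (Z s))) (at s within {0..1 / C})"
      by (rule truncated_solution[OF v _ C(3)[OF v] C(1), of 0 "1 / C" w]) (use C(1) in \<open>auto simp: r'_def\<close>)
    have contZ: "continuous_on {0..1 / C} Z" using Z(2) by (rule continuous_on_vector_derivative)
    have cp: "norm (closest_point (cball 0 r') x) \<le> r'" for x :: "real^2"
      using closest_point_in_set[of "cball 0 r'" x] by (auto simp: r'_def)
    have near: "norm (Z s - w) \<le> C * s" if s: "s \<in> {0..1 / C}" for s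
    proof -
      have "norm (Z s - Z 0) \<le> C * (s - 0)"
      proof (rule norm_increment_le[where P="{}" and z'="\<lambda>s. - fv v (closest_point (cball 0 r') (Z s))"])
        show "continuous_on {0..s} Z" using s by (intro continuous_on_subset[OF contZ]) auto
        fix q assume q: "q \<in> {0<..<s} - {}"
        then have "q \<in> {0..1 / C}" "0 < q" "q < 1 / C" using s by auto
        with Z(2)[of q] show "(Z has_vector_derivative - fv v (closest_point (cball 0 r') (Z q))) (at q)"
          by (metis at_within_Icc_at)
        show "norm (- fv v (closest_point (cball 0 r') (Z q))) \<le> C" using C(2)[OF v cp] by simp
      qed (use s C in auto)
      then show ?thesis using Z by simp
    qed
    have "Z s \<in> cball 0 r'" if "s \<in> {0..1 / C}" for s
    proof -
      have "C * s \<le> C * (1 / C)" using that C by (intro mult_left_mono) auto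
      then have "norm (Z s - w) \<le> 1" using near[OF that] C by simp
      then show ?thesis using w norm_triangle_sub[of "Z s" w] by (simp add: r'_def)
    qed
    then have "backward_arc v Z 0 (1 / C)"
      unfolding backward_arc_def using v Z(2) closest_point_self by metis
    then show "\<exists>Z. Z 0 = w \<and> backward_arc v Z 0 (1 / C) \<and> (\<forall>s\<in>{0..1 / C}. norm (Z s - w) \<le> C * s)"
      using near Z by blast
  qed (use C in auto)
qed

text \<open>Continuous dependence at a linear rate; it makes the Taylor remainder quadratic in the
  initial perturbation when normals are transported.\<close>

lemma perturbed_solution:
  assumes arc: "backward_arc v z a b" and "a \<le> b"
  obtains d E where "d > 0" "E > 0"
    "\<And>z0. norm (z0 - z a) \<le> d \<Longrightarrow> \<exists>Z. Z a = z0 \<and> backward_arc v Z a b \<and>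
        (\<forall>s\<in>{a..b}. norm (Z s - z s) \<le> E * norm (z0 - z a))"
proof -
  have v: "ctrl v" using arc by (rule backward_arc_ctrl)
  have cont: "continuous_on {a..b} z" using arc by (rule backward_arc_continuous)
  have "compact (z ` {a..b})" using cont by (intro compact_continuous_image) auto
  then obtain r0 where "\<forall>x\<in>z ` {a..b}. norm x \<le> r0" using compact_imp_bounded bounded_iff by blast
  then have r0: "\<And>s. s \<in> {a..b} \<Longrightarrow> norm (z s) \<le> r0" by auto
  define r where "r = \<bar>r0\<bar> + 1"
  have r: "\<And>s. s \<in> {a..b} \<Longrightarrow> norm (z s) \<le> r - 1" "r > 0" using r0 by (force simp: r_def)+
  obtain C where C: "C > 0" "C-lipschitz_on (cball 0 r) (fv v)"
    using fv_bounds[of r] v by metis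
  define E2 where "E2 = 1 + 2 * C * (b - a) * exp (2 * C * (b - a))"
  have E2: "E2 \<ge> 1" using C \<open>a \<le> b\<close> by (simp add: E2_def)
  have "\<exists>Z. Z a = z0 \<and> backward_arc v Z a b \<and> (\<forall>s\<in>{a..b}. norm (Z s - z s) \<le> sqrt E2 * norm (z0 - z a))"
    if z0: "norm (z0 - z a) \<le> 1 / sqrt E2" for z0
  proof -
    obtain Z where Z: "Z a = z0"
      "\<And>s. s \<in> {a..b} \<Longrightarrow> (Z has_vector_derivative - fv v (closest_point (cball 0 r) (Z s))) (at s within {a..b})"
      using truncated_solution[OF v r(2) C(2,1) \<open>a \<le> b\<close>] by metis
    have contZ: "continuous_on {a..b} Z" using Z(2) by (rule continuous_on_vector_derivative)
    have near: "norm (Z s - z s) \<le> sqrt E2 * norm (z0 - z a)" if s: "s \<in> {a..b}" for s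
    proof -
      \<comment> \<open>Subtracting the initial squared distance makes the Gronwall quantity start
        at 0; \<open>m\<close> then reappears as a constant source term.\<close>
      define m where "m = (norm (z0 - z a))\<^sup>2"
      define g where "g q = - fv v (closest_point (cball 0 r) (Z q)) - (- fv v (z q))" for q
      have "(norm (Z s - z s))\<^sup>2 - m \<le> (2 * C * m) * (s - a) * exp (2 * C * (s - a))"
      proof (rule gronwall_upper[where P="{}" and W="\<lambda>q. (norm (Z q - z q))\<^sup>2 - m" and W'="\<lambda>q. 2 * ((Z q - z q) \<bullet> g q)"])
        show "continuous_on {a..s} (\<lambda>q. (norm (Z q - z q))\<^sup>2 - m)"
          using s by (intro continuous_intros continuous_on_subset[OF cont] continuous_on_subset[OF contZ]) auto
        fix q assume q: "q \<in> {a<..<s} - {}"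
        then have q': "q \<in> {a..b}" "a < q" "q < b" using s by auto
        have "(Z has_vector_derivative - fv v (closest_point (cball 0 r) (Z q))) (at q)"
          using Z(2)[of q] q' by (metis at_within_Icc_at)
        moreover have "(z has_vector_derivative - fv v (z q)) (at q)" using backward_arc_at[OF arc] q' by auto
        ultimately have "((\<lambda>q. Z q - z q) has_vector_derivative g q) (at q)"
          unfolding g_def by (rule has_vector_derivative_diff)
        from DERIV_diff[OF has_real_derivative_norm_square[OF this] DERIV_const[of m]]
        show "((\<lambda>q. (norm (Z q - z q))\<^sup>2 - m) has_real_derivative 2 * ((Z q - z q) \<bullet> g q)) (at q)" by simp
        have zq: "z q \<in> cball 0 r" using r(1)[OF q'(1)] by simp
        have "norm (g q) = dist (fv v (closest_point (cball 0 r) (Z q))) (fv v (closest_point (cball 0 r) (z q)))"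
          using closest_point_self[OF zq] by (simp add: g_def dist_norm norm_minus_commute)
        also have "\<dots> \<le> C * dist (closest_point (cball 0 r) (Z q)) (closest_point (cball 0 r) (z q))"
          using r by (intro lipschitz_onD[OF C(2)] closest_point_in_set) auto
        also have "\<dots> \<le> C * dist (Z q) (z q)"
          using C r by (intro mult_left_mono closest_point_lipschitz) auto
        finally have g: "norm (g q) \<le> C * norm (Z q - z q)" by (simp add: dist_norm)
        have "(Z q - z q) \<bullet> g q \<le> norm (Z q - z q) * norm (g q)" by (rule norm_cauchy_schwarz)
        also have "\<dots> \<le> norm (Z q - z q) * (C * norm (Z q - z q))" using g by (intro mult_left_mono) auto
        finally show "2 * ((Z q - z q) \<bullet> g q) \<le> 2 * C * ((norm (Z q - z q))\<^sup>2 - m) + 2 * C * m"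
          by (simp add: power2_eq_square algebra_simps)
      qed (use s C Z in \<open>auto simp: m_def\<close>)
      also have "\<dots> \<le> (2 * C * m) * (b - a) * exp (2 * C * (b - a))"
        using s C by (intro mult_mono) (auto simp: m_def intro!: mult_left_mono)
      finally have "(norm (Z s - z s))\<^sup>2 \<le> E2 * m" by (simp add: E2_def algebra_simps)
      also have "\<dots> = (sqrt E2 * norm (z0 - z a))\<^sup>2" using E2 by (simp add: m_def power_mult_distrib)
      finally show ?thesis by (rule power2_le_imp_le) (use E2 in auto)
    qed
    have "Z s \<in> cball 0 r" if "s \<in> {a..b}" for s
    proof -
      have "sqrt E2 * norm (z0 - z a) \<le> sqrt E2 * (1 / sqrt E2)" using z0 E2 by (intro mult_left_mono) auto
      then have "norm (Z s - z s) \<le> 1" using near[OF that] E2 by simp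
      then show ?thesis using r(1)[OF that] norm_triangle_sub[of "Z s" "z s"] by simp
    qed
    then have "backward_arc v Z a b"
      unfolding backward_arc_def using v Z(2) closest_point_self by metis
    then show ?thesis using Z near by blast
  qed
  then show ?thesis using that[of "1 / sqrt E2" "sqrt E2"] E2 by auto
qed


text \<open>The velocity along an arc solves the linearized equation, so by
  \<open>cross2_trace\<close> its determinant with the displacement satisfies a scalar linear
  equation up to a remainder. \<open>Z'\<close> is arbitrary so that competitors with other controls
  are covered too.\<close>

lemma cross2_velocity_derivative:
  assumes z: "(z has_vector_derivative - fv v (z s)) (at s)" and Z: "(Z has_vector_derivative - Z') (at s)"
  shows "((\<lambda>s. cross2 (fv v (z s)) (Z s - z s)) has_real_derivative
     (- (Dv v (z s) (axis 1 1) $ 1 + Dv v (z s) (axis 2 1) $ 2) * cross2 (fv v (z s)) (Z s - z s)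
      - cross2 (fv v (z s)) (Z' - fv v (z s) - Dv v (z s) (Z s - z s)))) (at s)"
proof -
  let ?A = "Dv v (z s)" and ?f = "fv v (z s)" and ?d = "Z s - z s"
  have lin: "linear ?A" using Dv_linear bounded_linear.linear by blast
  have "((fv v \<circ> z) has_vector_derivative ?A (- ?f)) (at s)"
    using vector_derivative_diff_chain_within[of z "- ?f" s UNIV "fv v" ?A] z fv_derivative has_derivative_at_withinI by force
  then have f: "((\<lambda>s. fv v (z s)) has_vector_derivative ?A (- ?f)) (at s)" by (simp add: comp_def)
  have d: "((\<lambda>s. Z s - z s) has_vector_derivative (- Z' - (- ?f))) (at s)"
    by (rule has_vector_derivative_diff[OF Z z])
  have "((\<lambda>s. cross2 (fv v (z s)) (Z s - z s)) has_vector_derivative (cross2 ?f (- Z' - (- ?f)) + cross2 (?A (- ?f)) ?d)) (at s)"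
    by (rule bounded_bilinear.has_vector_derivative[OF cross2_bilinear f d])
  moreover have "cross2 ?f (- Z' - (- ?f)) + cross2 (?A (- ?f)) ?d =
     - (?A (axis 1 1) $ 1 + ?A (axis 2 1) $ 2) * cross2 ?f ?d - cross2 ?f (Z' - ?f - ?A ?d)"
    using cross2_trace[OF lin, of ?f ?d] by (simp add: linear_neg[OF lin] cross2_simps algebra_simps)
  ultimately show ?thesis by (simp add: has_real_derivative_iff_has_vector_derivative)
qed

lemma trace_bound:
  assumes "\<And>h. norm (Dv v x h) \<le> C * norm h"
  shows "\<bar>Dv v x (axis 1 1) $ 1 + Dv v x (axis 2 1) $ 2\<bar> \<le> 2 * C"
proof -
  have "\<bar>Dv v x (axis j 1) $ j\<bar> \<le> C" for j
    using component_le_norm_cart[of "Dv v x (axis j 1)" j] assms[of "axis j 1"] by simp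
  from this[of 1] this[of 2] show ?thesis by linarith
qed

text \<open>A point of \<open>R a\<close> close to \<open>z a\<close>, carried along by the control
  \<open>v\<close>, lands in \<open>R b\<close>, where the determinant has a sign. Integrating the
  determinant equation back to \<open>a\<close> keeps this sign up to an error quadratic in the
  perturbation, which disappears after division by its size.\<close>

lemma normal_transport:
  assumes arc: "backward_arc v z a b" and ab: "0 \<le> a" "a \<le> b" "b < Tc" and za: "z a \<in> R a"
    and nb: "\<And>y. y \<in> R b \<Longrightarrow> l * cross2 (fv v (z b)) (y - z b) \<le> 0" and y: "y \<in> R a"
  shows "l * cross2 (fv v (z a)) (y - z a) \<le> 0"
proof -
  have v: "ctrl v" using arc by (rule backward_arc_ctrl)
  have cont: "continuous_on {a..b} z" using arc by (rule backward_arc_continuous)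
  have "compact (z ` {a..b})" using cont by (intro compact_continuous_image) auto
  then obtain r where "\<forall>x\<in>z ` {a..b}. norm x \<le> r" using compact_imp_bounded bounded_iff by blast
  then have r: "\<And>s. s \<in> {a..b} \<Longrightarrow> norm (z s) \<le> r" by auto
  obtain C where C: "C > 0" "\<And>x. norm x \<le> r \<Longrightarrow> norm (fv v x) \<le> C"
    "\<And>x h. norm x \<le> r \<Longrightarrow> norm (Dv v x h) \<le> C * norm h"
    using fv_bounds[of r] v by metis
  obtain d0 E where E: "d0 > 0" "E > 0"
    "\<And>z0. norm (z0 - z a) \<le> d0 \<Longrightarrow> \<exists>Z. Z a = z0 \<and> backward_arc v Z a b \<and>
        (\<forall>s\<in>{a..b}. norm (Z s - z s) \<le> E * norm (z0 - z a))"
    using perturbed_solution[OF arc ab(2)] by metis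
  define d where "d = y - z a"
  define c where "c = \<bar>l\<bar> * (C * (K * (E * norm d)\<^sup>2)) * (b - a) * exp (2 * C * (b - a))"
  \<comment> \<open>The segment from \<open>z a\<close> to \<open>y\<close> lies in the convex set
    \<open>R a\<close>, so the test point may be brought as close to \<open>z a\<close> as
    needed.\<close>
  have main: "l * cross2 (fv v (z a)) d \<le> e * c" if e: "0 < e" "e \<le> 1" "e * norm d \<le> d0" for e
  proof -
    obtain Z where Z: "Z a = z a + e *\<^sub>R d" "backward_arc v Z a b"
      "\<And>s. s \<in> {a..b} \<Longrightarrow> norm (Z s - z s) \<le> E * (e * norm d)"
      using E(3)[of "z a + e *\<^sub>R d"] e by auto
    have "Z a = (1 - e) *\<^sub>R z a + e *\<^sub>R y" using Z(1) by (simp add: d_def algebra_simps)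
    then have "Z a \<in> R a"
      using R_convex[of a] ab za y e by (auto intro: convexD_alt)
    then have "Z b \<in> R b" using backward_arc_in_R[OF Z(2) ab(2)] by fastforce
    then have Zb: "l * cross2 (fv v (z b)) (Z b - z b) \<le> 0" by (rule nb)
    define tr where "tr s = Dv v (z s) (axis 1 1) $ 1 + Dv v (z s) (axis 2 1) $ 2" for s
    define g where "g s = fv v (Z s) - fv v (z s) - Dv v (z s) (Z s - z s)" for s
    define be where "be s = l * cross2 (fv v (z s)) (Z s - z s)" for s
    define m where "m = \<bar>l\<bar> * (C * (K * (E * (e * norm d))\<^sup>2))"
    \<comment> \<open>Gronwall runs from \<open>b\<close>, where the sign is known, down to
      \<open>a\<close>.\<close>
    have "be (b - (b - a)) \<le> m * ((b - a) - 0) * exp (2 * C * ((b - a) - 0))"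
    proof (rule gronwall_upper[where P="{}" and W="\<lambda>q. be (b - q)"
          and W'="\<lambda>q. tr (b - q) * be (b - q) + l * cross2 (fv v (z (b - q))) (g (b - q))"])
      have cb: "continuous_on {a..b} be" unfolding be_def
        by (intro continuous_intros bounded_bilinear.continuous_on[OF cross2_bilinear]
            continuous_on_compose2[OF fv_continuous[of UNIV] cont] cont backward_arc_continuous[OF Z(2)]) auto
      show "continuous_on {0..b - a} (\<lambda>q. be (b - q))"
        by (rule continuous_on_compose2[OF cb]) (auto intro: continuous_intros)
      fix q assume q: "q \<in> {0<..<b - a} - {}"
      define s where "s = b - q"
      have s: "s \<in> {a<..<b}" "s \<in> {a..b}" using q by (auto simp: s_def)
      have "((\<lambda>s. cross2 (fv v (z s)) (Z s - z s)) has_real_derivative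
          (- tr s * cross2 (fv v (z s)) (Z s - z s) - cross2 (fv v (z s)) (g s))) (at s)"
        unfolding tr_def g_def by (rule cross2_velocity_derivative[OF backward_arc_at[OF arc s(1)] backward_arc_at[OF Z(2) s(1)]])
      from DERIV_cmult[OF this, of l]
      have "(be has_real_derivative (l * (- tr s * cross2 (fv v (z s)) (Z s - z s) - cross2 (fv v (z s)) (g s)))) (at (b - q))"
        by (simp add: be_def[abs_def] s_def)
      then have "((\<lambda>q. be (b - q)) has_real_derivative
          (l * (- tr s * cross2 (fv v (z s)) (Z s - z s) - cross2 (fv v (z s)) (g s))) * (- 1)) (at q)"
        by (intro DERIV_chain'[where f="\<lambda>q. b - q" and g=be]) (auto intro!: derivative_eq_intros)
      then show "((\<lambda>q. be (b - q)) has_real_derivative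
          tr (b - q) * be (b - q) + l * cross2 (fv v (z (b - q))) (g (b - q))) (at q)"
        by (simp add: be_def s_def algebra_simps)
      assume pos: "be (b - q) > 0"
      have "tr s \<le> 2 * C" unfolding tr_def
        using trace_bound[of v "z s" C] C(3)[OF r[OF s(2)]] by simp
      then have 1: "tr s * be s \<le> 2 * C * be s" using pos by (intro mult_right_mono) (auto simp: s_def)
      have "norm (g s) \<le> K * (norm (Z s - z s))\<^sup>2" unfolding g_def by (rule fv_remainder[OF v])
      also have "\<dots> \<le> K * (E * (e * norm d))\<^sup>2"
        using K_nonneg Z(3)[OF s(2)] by (intro mult_left_mono power_mono) auto
      finally have g: "norm (g s) \<le> K * (E * (e * norm d))\<^sup>2" .
      have "\<bar>l * cross2 (fv v (z s)) (g s)\<bar> \<le> \<bar>l\<bar> * (norm (fv v (z s)) * norm (g s))"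
        unfolding abs_mult by (intro mult_left_mono cross2_le) auto
      also have "\<dots> \<le> m" unfolding m_def
        using g C r[OF s(2)] by (intro mult_left_mono mult_mono) auto
      finally show "tr (b - q) * be (b - q) + l * cross2 (fv v (z (b - q))) (g (b - q)) \<le> 2 * C * be (b - q) + m"
        using 1 by (simp add: s_def)
    qed (use ab C K_nonneg Zb in \<open>auto simp: be_def m_def\<close>)
    also have "m * ((b - a) - 0) * exp (2 * C * ((b - a) - 0)) = e * (e * c)"
      by (simp add: m_def c_def power2_eq_square algebra_simps)
    finally have "l * cross2 (fv v (z a)) (e *\<^sub>R d) \<le> e * (e * c)" by (simp add: be_def Z(1))
    then have "e * (l * cross2 (fv v (z a)) d) \<le> e * (e * c)" by (simp add: cross2_simps algebra_simps)
    then show ?thesis using e by simp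
  qed
  have c0: "c \<ge> 0" unfolding c_def using C K_nonneg ab by simp
  have "l * cross2 (fv v (z a)) d \<le> 0 + k" if "k > 0" for k
  proof -
    \<comment> \<open>Small enough for the perturbed solution to exist and for the error
      \<open>e * c\<close> to be at most \<open>k\<close>.\<close>
    define e where "e = min 1 (min (d0 / (norm d + 1)) (k / (c + 1)))"
    have e: "0 < e" "e \<le> 1" "e \<le> d0 / (norm d + 1)" "e \<le> k / (c + 1)"
      using E c0 that by (auto simp: e_def add_nonneg_pos)
    have "e * norm d \<le> d0 / (norm d + 1) * (norm d + 1)" using e E by (intro mult_mono) auto
    also have "\<dots> = d0" by (simp add: add_nonneg_eq_0_iff)
    finally have "l * cross2 (fv v (z a)) d \<le> e * c" using e by (intro main) auto
    also have "\<dots> \<le> k / (c + 1) * (c + 1)" using e c0 that by (intro mult_mono) auto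
    also have "\<dots> = k" using c0 by simp
    finally show ?thesis by simp
  qed
  then show ?thesis unfolding d_def[symmetric] by (rule field_le_epsilon)
qed

text \<open>Leaving \<open>z (b - n)\<close> backwards with \<open>v'\<close> for a time
  \<open>n\<close> leads to a point of \<open>R b\<close>. To first order its displacement from
  \<open>z b\<close> along \<open>p\<close> is \<open>- n\<close> times
  \<open>p \<bullet> fv v' (z b)\<close>, because \<open>v\<close> contributes nothing; normality
  then fixes the sign.\<close>

lemma needle_variation:
  assumes arc: "backward_arc v z a b" and ab: "0 \<le> a" "a < b" and T: "\<And>s. s \<in> {a..b} \<Longrightarrow> T (z s) = ereal s"
    and p: "\<And>y. y \<in> R b \<Longrightarrow> p \<bullet> (y - z b) \<le> 0" "p \<bullet> fv v (z b) = 0" and v': "ctrl v'"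
  shows "p \<bullet> fv v' (z b) \<ge> 0"
proof (rule ccontr)
  assume "\<not> p \<bullet> fv v' (z b) \<ge> 0"
  define c where "c = - (p \<bullet> fv v' (z b))"
  have c: "c > 0" using \<open>\<not> p \<bullet> fv v' (z b) \<ge> 0\<close> by (simp add: c_def)
  have v: "ctrl v" using arc by (rule backward_arc_ctrl)
  have cont: "continuous_on {a..b} z" using arc by (rule backward_arc_continuous)
  have near: "\<exists>e>0. \<forall>x. norm (x - z b) < e \<longrightarrow> \<bar>p \<bullet> fv w x - p \<bullet> fv w (z b)\<bar> < c / 4" for w
  proof -
    have "continuous_on UNIV (\<lambda>x. p \<bullet> fv w x)" by (intro continuous_intros fv_continuous)
    moreover have "c / 4 > 0" using c by simp
    ultimately show ?thesis unfolding continuous_on_iff dist_norm real_norm_def by blast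
  qed
  obtain e1 where e1: "e1 > 0" "\<And>x. norm (x - z b) < e1 \<Longrightarrow> \<bar>p \<bullet> fv v' x - p \<bullet> fv v' (z b)\<bar> < c / 4"
    using near by blast
  obtain e2 where e2: "e2 > 0" "\<And>x. norm (x - z b) < e2 \<Longrightarrow> \<bar>p \<bullet> fv v x - p \<bullet> fv v (z b)\<bar> < c / 4"
    using near by blast
  define e where "e = min e1 e2"
  have e: "e > 0" using e1 e2 by (simp add: e_def)
  \<comment> \<open>The margins \<open>c / 2\<close> here and \<open>c / 4\<close> for
    \<open>v\<close> leave a net displacement of at least \<open>c / 4 * n\<close> along
    \<open>p\<close>.\<close>
  have ev': "p \<bullet> fv v' x \<le> - c / 2" if "norm (x - z b) < e" for x
    using e1(2)[of x] that c unfolding e_def c_def by linarith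
  have ev: "p \<bullet> fv v x \<ge> - c / 4" if "norm (x - z b) < e" for x
    using e2(2)[of x] that c p(2) unfolding e_def by linarith
  have "compact (z ` {a..b})" using cont by (intro compact_continuous_image) auto
  then obtain r where "\<forall>x\<in>z ` {a..b}. norm x \<le> r" using compact_imp_bounded bounded_iff by blast
  then have r: "\<And>s. s \<in> {a..b} \<Longrightarrow> norm (z s) \<le> r" by auto
  obtain h C where h: "h > 0" "C > 0"
    "\<And>v (w::real^2). ctrl v \<Longrightarrow> norm w \<le> r \<Longrightarrow> \<exists>Z. Z 0 = w \<and> backward_arc v Z 0 h \<and> (\<forall>s\<in>{0..h}. norm (Z s - w) \<le> C * s)"
    using local_backward_solution[of r] by metis
  obtain d where d: "d > 0" "\<And>s. s \<in> {a..b} \<Longrightarrow> dist s b < d \<Longrightarrow> dist (z s) (z b) < e / 2"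
    using cont half_gt_zero[OF e] ab unfolding continuous_on_iff by (metis atLeastAtMost_iff less_eq_real_def)
  define n where "n = min (min h (b - a)) (min (d / 2) (e / (4 * C)))"
  have n: "n > 0" "n \<le> h" "n \<le> b - a" "n < d" "C * n < e / 2"
  proof -
    show "n > 0" "n \<le> h" "n \<le> b - a" "n < d" using h ab d e by (auto simp: n_def)
    have "C * n \<le> C * (e / (4 * C))" using h by (intro mult_left_mono) (auto simp: n_def)
    then show "C * n < e / 2" using h e by simp
  qed
  obtain Z where Z: "Z 0 = z (b - n)" "backward_arc v' Z 0 h" "\<And>s. s \<in> {0..h} \<Longrightarrow> norm (Z s - z (b - n)) \<le> C * s"
    using h(3)[OF v', of "z (b - n)"] r[of "b - n"] n by auto
  have "(- p) \<bullet> (Z 0 - Z n) \<ge> (c / 2) * (n - 0)"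
  proof (rule backward_arc_inner_increment[of v'])
    show "backward_arc v' Z 0 n" using backward_arc_subset[OF Z(2)] n by auto
    fix s assume s: "s \<in> {0<..<n}"
    have "norm (Z s - z (b - n)) \<le> C * s" using Z(3) s n by auto
    also have "\<dots> \<le> C * n" using s h by (intro mult_left_mono) auto
    finally have "norm (Z s - z (b - n)) < e / 2" using n by simp
    moreover have "norm (z (b - n) - z b) < e / 2" using d(2)[of "b - n"] n ab by (auto simp: dist_norm)
    ultimately have "norm (Z s - z b) < e" using norm_triangle_ineq[of "Z s - z (b - n)" "z (b - n) - z b"] by simp
    then show "(- p) \<bullet> fv v' (Z s) \<ge> c / 2" using ev'[of "Z s"] by simp
  qed (use n in auto)
  moreover have "p \<bullet> (z (b - n) - z b) \<ge> (- c / 4) * (b - (b - n))"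
  proof (rule backward_arc_inner_increment[of v])
    show "backward_arc v z (b - n) b" using backward_arc_subset[OF arc] n by auto
    fix s assume s: "s \<in> {b - n<..<b}"
    then have "norm (z s - z b) < e / 2" using d(2)[of s] n ab by (auto simp: dist_norm dist_real_def)
    then show "p \<bullet> fv v (z s) \<ge> - c / 4" using e ev[of "z s"] by simp
  qed (use n in auto)
  moreover have "p \<bullet> (Z n - z b) \<le> 0"
  proof (rule p(1))
    have "T (z (b - n)) = ereal (b - n)" using T[of "b - n"] n by auto
    then have "Z 0 \<in> R (b - n)" using Z(1) by (simp add: reach_set_def)
    moreover have "backward_arc v' Z 0 n" using backward_arc_subset[OF Z(2)] n by auto
    ultimately have "Z n \<in> R (b - n + (n - 0))" using backward_arc_in_R n by (meson less_imp_le)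
    then show "Z n \<in> R b" by simp
  qed
  ultimately have "c / 2 * n \<le> c / 4 * n" using Z(1) by (simp add: inner_diff_right algebra_simps)
  moreover have "c * n > 0" using c n by simp
  ultimately show False by simp
qed

text \<open>One inequality is the vanishing of the Hamiltonian; the other holds because the arc
  itself runs inside \<open>R b\<close>, so the normal has no positive component along the
  velocity.\<close>

lemma singular_at_normal_orthogonal:
  assumes arc: "backward_arc v z a b" and ab: "0 \<le> a" "a < b" and T: "\<And>s. s \<in> {a..b} \<Longrightarrow> T (z s) = ereal s"
    and p: "\<And>y. y \<in> R b \<Longrightarrow> p \<bullet> (y - z b) \<le> 0" "hamiltonian F G M (z b) p = 0"
  shows "p \<bullet> fv v (z b) = 0"
proof (rule antisym)
  show "0 \<le> p \<bullet> fv v (z b)" using hamiltonian_le[OF backward_arc_ctrl[OF arc], of "z b" p] p by simp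
  show "p \<bullet> fv v (z b) \<le> 0"
  proof (rule ccontr)
    assume "\<not> p \<bullet> fv v (z b) \<le> 0"
    define c where "c = p \<bullet> fv v (z b)"
    have c: "c > 0" using \<open>\<not> p \<bullet> fv v (z b) \<le> 0\<close> by (simp add: c_def)
    have "continuous_on {a..b} (\<lambda>s. p \<bullet> fv v (z s))"
      by (intro continuous_intros continuous_on_compose2[OF fv_continuous[of UNIV]] backward_arc_continuous[OF arc]) auto
    then obtain d where d: "d > 0" "\<And>s. s \<in> {a..b} \<Longrightarrow> dist s b < d \<Longrightarrow> dist (p \<bullet> fv v (z s)) (p \<bullet> fv v (z b)) < c / 2"
      unfolding continuous_on_iff using c ab by (metis atLeastAtMost_iff half_gt_zero less_eq_real_def)
    define s where "s = max a (b - d / 2)"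
    have s: "s \<in> {a..b}" "s < b" "b - s < d" using d ab by (auto simp: s_def)
    have "p \<bullet> (z s - z b) \<ge> (c / 2) * (b - s)"
    proof (rule backward_arc_inner_increment[of v])
      show "backward_arc v z s b" using backward_arc_subset[OF arc] s by auto
      fix q assume q: "q \<in> {s<..<b}"
      then have "dist (p \<bullet> fv v (z q)) (p \<bullet> fv v (z b)) < c / 2" using s by (intro d) (auto simp: dist_real_def)
      then show "p \<bullet> fv v (z q) \<ge> c / 2" unfolding c_def dist_real_def by linarith
    qed (use s in auto)
    moreover have "z s \<in> R b" using T[OF s(1)] s by (simp add: reach_set_def)
    then have "p \<bullet> (z s - z b) \<le> 0" by (rule p)
    moreover have "c / 2 * (b - s) > 0" using c s by simp
    ultimately show False by simp
  qed
qed

text \<open>The normal at \<open>z b\<close> is orthogonal to the velocity, hence a multiple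
  \<open>l\<close> of its rotation; transport and needle variations then apply with this same
  \<open>l\<close> along the whole arc.\<close>

lemma singular_at_transport:
  assumes arc: "backward_arc v z a b" and ab: "0 \<le> a" "a < b" "b < Tc" and T: "\<And>s. s \<in> {a..b} \<Longrightarrow> T (z s) = ereal s"
    and S: "singular_at b (z b)"
  obtains l where "l \<noteq> 0" "\<And>s. s \<in> {a..b} \<Longrightarrow> fv v (z s) \<noteq> 0"
    "\<And>s y. s \<in> {a..b} \<Longrightarrow> y \<in> R s \<Longrightarrow> l * cross2 (fv v (z s)) (y - z s) \<le> 0"
    "\<And>s v'. s \<in> {a..b} \<Longrightarrow> ctrl v' \<Longrightarrow> l * cross2 (fv v (z s)) (fv v' (z s)) \<ge> 0"
    "\<And>s. s \<in> {a..b} \<Longrightarrow> singular_at s (z s)"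
proof -
  obtain p where p: "norm p = 1" "\<And>y. y \<in> R b \<Longrightarrow> p \<bullet> (y - z b) \<le> 0" "hamiltonian F G M (z b) p = 0"
    using S by (auto simp: singular_at_def)
  have cont: "continuous_on {a..b} z" using arc by (rule backward_arc_continuous)
  have po: "p \<bullet> fv v (z b) = 0" by (rule singular_at_normal_orthogonal[OF arc ab(1,2) T p(2,3)])
  have nz: "fv v (z s) \<noteq> 0" if "s \<in> {a..b}" for s
  proof
    assume "fv v (z s) = 0"
    then have "z a = z b"
      using backward_arc_const_of_zero[OF arc that, of a] backward_arc_const_of_zero[OF arc that, of b] ab by auto
    then show False using T[of a] T[of b] ab by auto
  qed
  define l where "l = (p \<bullet> rot (fv v (z b))) / (norm (fv v (z b)))\<^sup>2"
  have pl: "p = l *\<^sub>R rot (fv v (z b))"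
    unfolding l_def by (rule orthogonal_is_rot_multiple[OF po]) (use nz ab in auto)
  have l0: "l \<noteq> 0" using pl p(1) by force
  have zR: "z s \<in> R s" if "s \<in> {a..b}" for s using T[OF that] by (simp add: reach_set_def)
  have N: "l * cross2 (fv v (z s)) (y - z s) \<le> 0" if "s \<in> {a..b}" "y \<in> R s" for s y
  proof (rule normal_transport[of v z s b])
    show "backward_arc v z s b" using backward_arc_subset[OF arc] that by auto
    show "l * cross2 (fv v (z b)) (y - z b) \<le> 0" if "y \<in> R b" for y
      using p(2)[OF that] by (simp add: pl rot_inner)
  qed (use that ab zR in auto)
  have H0: "l * cross2 (fv v (z s)) (fv v' (z s)) \<ge> 0" if s: "s \<in> {a<..b}" and v': "ctrl v'" for s v'
  proof -
    have "(l *\<^sub>R rot (fv v (z s))) \<bullet> fv v' (z s) \<ge> 0"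
    proof (rule needle_variation[of v z a s])
      show "backward_arc v z a s" using backward_arc_subset[OF arc] s by auto
    qed (use s ab N T v' in \<open>auto simp: rot_inner\<close>)
    then show ?thesis by (simp add: rot_inner)
  qed
  \<comment> \<open>A needle variation needs a nontrivial piece of arc below \<open>s\<close>, so
    the endpoint \<open>a\<close> is reached by continuity.\<close>
  have H: "l * cross2 (fv v (z s)) (fv v' (z s)) \<ge> 0" if s: "s \<in> {a..b}" and v': "ctrl v'" for s v'
  proof (cases "s = a")
    case True
    have c: "continuous_on {a..b} (\<lambda>s. l * cross2 (fv v (z s)) (fv v' (z s)))"
      by (intro continuous_intros bounded_bilinear.continuous_on[OF cross2_bilinear]
            continuous_on_compose2[OF fv_continuous[of UNIV] cont]) auto
    have "((\<lambda>s. l * cross2 (fv v (z s)) (fv v' (z s))) \<longlongrightarrow> l * cross2 (fv v (z a)) (fv v' (z a))) (at a within {a..b})"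
      using c ab by (auto simp: continuous_on_def)
    moreover have "eventually (\<lambda>s. 0 \<le> l * cross2 (fv v (z s)) (fv v' (z s))) (at a within {a..b})"
      unfolding eventually_at_filter using H0[OF _ v'] by (intro always_eventually) auto
    moreover have "at a within {a..b} \<noteq> bot" using ab by (simp add: at_within_Icc_at_right)
    ultimately show ?thesis unfolding True by (intro tendsto_lowerbound)
  qed (use s H0 v' in auto)
  have S: "singular_at s (z s)" if s: "s \<in> {a..b}" for s
  proof -
    define k where "k = 1 / (\<bar>l\<bar> * norm (fv v (z s)))"
    have k: "k > 0" using l0 nz[OF s] by (simp add: k_def)
    define q where "q = (k * l) *\<^sub>R rot (fv v (z s))"
    have q: "q \<bullet> x = k * (l * cross2 (fv v (z s)) x)" for x by (simp add: q_def rot_inner)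
    have "norm q = 1" using l0 nz[OF s] by (simp add: q_def k_def abs_mult)
    moreover have "q \<bullet> (y - z s) \<le> 0" if "y \<in> R s" for y
      unfolding q using N[OF s that] k by (simp add: mult_nonneg_nonpos)
    moreover have "hamiltonian F G M (z s) q = 0"
    proof (rule antisym)
      show "hamiltonian F G M (z s) q \<le> 0"
        using hamiltonian_le[OF backward_arc_ctrl[OF arc], of "z s" q] q[of "fv v (z s)"] by simp
      obtain v' where "ctrl v'" "hamiltonian F G M (z s) q = q \<bullet> fv v' (z s)"
        using hamiltonian_attained by blast
      then show "0 \<le> hamiltonian F G M (z s) q" using H[OF s] k by (simp add: q)
    qed
    ultimately show ?thesis by (auto simp: singular_at_def)
  qed
  show ?thesis by (rule that[OF l0 nz N H S])
qed

text \<open>Continuous induction downwards in time to go: the arc to the right of the infimum shows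
  that it is attained, the arc to its left that it is 0.\<close>

lemma singular_at_along:
  assumes opt: "opt_curve t z" and S: "singular_at t (z t)" and s: "s \<in> {0..t}"
  shows "singular_at s (z s)"
proof -
  note o = opt_curveD[OF opt]
  define A where "A = {s \<in> {0..t}. \<forall>q\<in>{s..t}. singular_at q (z q)}"
  have tA: "t \<in> A" using S o(1) by (auto simp: A_def)
  have bdd: "bdd_below A" by (auto simp: A_def)
  define c where "c = Inf A"
  have ct: "c \<le> t" unfolding c_def by (rule cInf_lower[OF tA bdd])
  have c0: "0 \<le> c" unfolding c_def by (rule cInf_greatest) (use tA in \<open>auto simp: A_def\<close>)
  have step: "a \<in> A" if arc: "backward_arc v z a b" and b: "b \<in> A" and "0 \<le> a" "a < b" for a b v
  proof -
    have b': "b \<le> t" "singular_at b (z b)" using b by (auto simp: A_def)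
    obtain l :: real where "\<And>s. s \<in> {a..b} \<Longrightarrow> singular_at s (z s)"
      by (rule singular_at_transport[OF arc \<open>0 \<le> a\<close> \<open>a < b\<close>]) (use b' o(2,5) \<open>0 \<le> a\<close> in auto)
    then show ?thesis using b \<open>0 \<le> a\<close> \<open>a < b\<close> by (force simp: A_def)
  qed
  have "c \<in> A"
  proof (cases "c = t")
    case False
    then have "c \<in> {0..<t}" using ct c0 by auto
    from o(6)[OF this] obtain e v where e: "e > 0" "c + e \<le> t" "backward_arc v z c (c + e)" by blast
    have "\<exists>b\<in>A. b < c + e" unfolding c_def using e(1) cInf_less_iff[of A "Inf A + e"] tA bdd by auto
    then obtain b where b: "b \<in> A" "b < c + e" by blast
    have "c \<le> b" unfolding c_def by (rule cInf_lower[OF b(1) bdd])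
    show ?thesis
    proof (cases "c = b")
      case False
      then show ?thesis using step[OF backward_arc_subset[OF e(3)] b(1)] b \<open>c \<le> b\<close> c0 by auto
    qed (use b in simp)
  qed (use tA in simp)
  moreover have "c = 0"
  proof (rule ccontr)
    assume "c \<noteq> 0"
    then have "c \<in> {0<..t}" using ct c0 by auto
    from o(7)[OF this] obtain e v where e: "e > 0" "0 \<le> c - e" "backward_arc v z (c - e) c" by blast
    then have "c - e \<in> A" using step \<open>c \<in> A\<close> by auto
    then have "c \<le> c - e" unfolding c_def by (rule cInf_lower[OF _ bdd])
    then show False using e by simp
  qed
  ultimately show ?thesis using s by (auto simp: A_def)
qed

end

section \<open>Uniqueness of singular curves\<close>

lemma frame_cross:
  assumes "norm g = 1"
  shows "(g \<bullet> a) * cross2 g b - cross2 g a * (g \<bullet> b) = cross2 a b"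
proof -
  have "(g \<bullet> a) * cross2 g b - cross2 g a * (g \<bullet> b) = (norm g)\<^sup>2 * cross2 a b"
    unfolding power2_norm_eq_inner inner_2 cross2_def by (simp add: algebra_simps)
  then show ?thesis using assms by simp
qed

lemma frame_decomposition:
  assumes "norm g = 1" "o' * o' = 1"
  shows "z = (g \<bullet> z) *\<^sub>R g + ((o' *\<^sub>R rot g) \<bullet> z) *\<^sub>R (o' *\<^sub>R rot g)"
proof -
  have 1: "g $ 1 * g $ 1 + g $ 2 * g $ 2 = 1"
    using assms(1) by (metis inner_2 norm_eq_1)
  have "z $ 1 = (g \<bullet> z) * g $ 1 + ((o' * o') * cross2 g z) * rot g $ 1"
    "z $ 2 = (g \<bullet> z) * g $ 2 + ((o' * o') * cross2 g z) * rot g $ 2"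
    using 1 unfolding assms(2) inner_2 cross2_def rot_nth by algebra+
  then show ?thesis by (simp add: vec_eq_iff forall_2 rot_inner algebra_simps)
qed

lemma cross2_zero_imp_parallel:
  assumes "cross2 a b = 0" "a \<noteq> 0"
  shows "b = ((a \<bullet> b) / (norm a)\<^sup>2) *\<^sub>R a"
proof -
  have nz: "(norm a)\<^sup>2 \<noteq> 0" using assms by simp
  have n: "(norm a)\<^sup>2 = a $ 1 * a $ 1 + a $ 2 * a $ 2"
    by (simp only: power2_norm_eq_inner inner_2)
  have "(norm a)\<^sup>2 * b $ 1 - (a \<bullet> b) * a $ 1 = - a $ 2 * cross2 a b" "(norm a)\<^sup>2 * b $ 2 - (a \<bullet> b) * a $ 2 = a $ 1 * cross2 a b"
    unfolding n inner_2 cross2_def by (simp_all add: algebra_simps)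
  then have "(norm a)\<^sup>2 *\<^sub>R b = (a \<bullet> b) *\<^sub>R a" using assms by (simp add: vec_eq_iff forall_2)
  then have "(1 / (norm a)\<^sup>2) *\<^sub>R ((norm a)\<^sup>2 *\<^sub>R b) = (1 / (norm a)\<^sup>2) *\<^sub>R ((a \<bullet> b) *\<^sub>R a)" by (simp only:)
  then show ?thesis using nz by simp
qed

lemma cross2_rot_right: "cross2 a (rot g) = a \<bullet> g"
  by (simp add: cross2_def inner_2)

lemma sgn_mult_nonneg: "0 \<le> l * x \<Longrightarrow> 0 \<le> sgn l * x" for l x :: real
  by (auto simp: sgn_if zero_le_mult_iff)

lemma cross2_commute: "cross2 a b = - cross2 b a" by (simp add: cross2_def)

section \<open>Continuation of singular arcs through switching times\<close>

context control_system
begin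

lemma hamiltonian_zeroI:
  assumes "ctrl w" "p \<bullet> fv w x = 0" "\<And>v. ctrl v \<Longrightarrow> p \<bullet> fv v x \<ge> 0"
  shows "hamiltonian F G M x p = 0"
  using hamiltonian_le[OF assms(1), of x p] hamiltonian_attained[of x p] assms by force

text \<open>Opposite normals would confine \<open>R c\<close> to a line, whereas strict convexity
  gives it interior.\<close>

lemma opposite_normals_False:
  assumes c: "0 < c" "c < Tc" and x: "x \<in> R c" "x \<noteq> 0" and "p \<noteq> 0"
    and n: "\<And>y. y \<in> R c \<Longrightarrow> p \<bullet> (y - x) \<le> 0" "\<And>y. y \<in> R c \<Longrightarrow> p \<bullet> (y - x) \<ge> 0"
  shows False
proof -
  obtain q where "q \<in> interior (R c)" using R_interior_nonempty[OF c x] by blast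
  then obtain e where e: "e > 0" "ball q e \<subseteq> R c" using mem_interior by blast
  define y where "y = q + (e / (2 * norm p)) *\<^sub>R p"
  have "dist q y = e / 2" using e \<open>p \<noteq> 0\<close> by (simp add: y_def dist_norm)
  then have "y \<in> R c" "q \<in> R c" using e by (auto intro!: subsetD[OF e(2)])
  then have "p \<bullet> (y - x) = 0" "p \<bullet> (q - x) = 0" using n by (auto intro: antisym)
  then have "p \<bullet> (y - q) = 0" by (simp add: inner_diff_right)
  then show False using e \<open>p \<noteq> 0\<close> by (simp add: y_def)
qed

text \<open>In the frame \<open>g\<close>, \<open>o' *\<^sub>R rot g\<close> both cross-slope
  conditions become signs of the determinant of the two velocities. The factors \<open>s1\<close>,
  \<open>s2\<close> select the sense of time in which each arc is run, so that a forward and a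
  backward arc can be compared at a cusp.\<close>

lemma curve_comparison:
  fixes c1 c2 :: "real \<Rightarrow> real^2"
  assumes e: "e > 0" and start: "c1 0 = w" "c2 0 = w" and v: "ctrl v1" "ctrl v2" and sg: "\<bar>s1\<bar> = 1" "\<bar>s2\<bar> = 1"
    and d1: "\<And>s. s \<in> {0..e} \<Longrightarrow> (c1 has_vector_derivative s1 *\<^sub>R fv v1 (c1 s)) (at s within {0..e})"
    and d2: "\<And>s. s \<in> {0..e} \<Longrightarrow> (c2 has_vector_derivative s2 *\<^sub>R fv v2 (c2 s)) (at s within {0..e})"
    and g: "norm g = 1" and o': "o' * o' = 1"
    and pos: "g \<bullet> (s1 *\<^sub>R fv v1 w) > 0" "g \<bullet> (s2 *\<^sub>R fv v2 w) > 0"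
    and A: "\<And>s. s \<in> {0<..e} \<Longrightarrow> o' * cross2 (s1 *\<^sub>R fv v1 (c2 s)) (s2 *\<^sub>R fv v2 (c2 s)) \<ge> 0"
    and B: "\<And>q1 q2. q1 \<in> {0<..e} \<Longrightarrow> q2 \<in> {0<..e} \<Longrightarrow> g \<bullet> c1 q1 = g \<bullet> c2 q2 \<Longrightarrow>
        o' * cross2 g (c1 q1) < o' * cross2 g (c2 q2) \<Longrightarrow>
        o' * cross2 (s2 *\<^sub>R fv v2 (c1 q1)) (s1 *\<^sub>R fv v1 (c1 q1)) \<ge> 0"
  shows "\<exists>e'>0. e' \<le> e \<and> (\<forall>s\<in>{0<..e'}. \<exists>q\<in>{0<..e}. c1 s = c2 q)"
proof -
  obtain C where C: "C > 0" "\<And>v. ctrl v \<Longrightarrow> C-lipschitz_on (cball 0 (norm w + 1)) (fv v)"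
    using fv_bounds[of "norm w + 1"] by metis
  have sub: "cball w 1 \<subseteq> cball 0 (norm w + 1)"
  proof
    fix x assume "x \<in> cball w 1"
    then show "x \<in> cball 0 (norm w + 1)" using norm_triangle_sub[of x w] by (simp add: dist_norm norm_minus_commute)
  qed
  have lip: "C-lipschitz_on (cball w 1) (\<lambda>x. s *\<^sub>R fv u x)" if "ctrl u" "\<bar>s\<bar> = 1" for s u
  proof (rule lipschitz_onI)
    fix x y assume "x \<in> cball w 1" "y \<in> cball w 1"
    then have "dist (fv u x) (fv u y) \<le> C * dist x y" using lipschitz_onD[OF C(2)[OF that(1)]] sub by blast
    then show "dist (s *\<^sub>R fv u x) (s *\<^sub>R fv u y) \<le> C * dist x y"
      using that(2) by (simp add: dist_norm flip: scaleR_right_diff_distrib)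
  qed (use C in simp)
  have absn: "norm (o' *\<^sub>R rot g) = 1"
  proof -
    have "o' = 1 \<or> o' = - 1" using o' square_eq_1_iff by blast
    then show ?thesis using g by auto
  qed
  show ?thesis
  proof (rule slope_comparison[where g=g and n="o' *\<^sub>R rot g" and R=1 and C=C, OF e start d1 d2 g absn
        frame_decomposition[OF g o'] lip[OF v(1) sg(1)] lip[OF v(2) sg(2)] _ pos])
    fix s assume "s \<in> {0<..e}"
    let ?a = "s1 *\<^sub>R fv v1 (c2 s)" and ?b = "s2 *\<^sub>R fv v2 (c2 s)"
    have "o' * ((g \<bullet> ?a) * cross2 g ?b - cross2 g ?a * (g \<bullet> ?b)) \<ge> 0"
      unfolding frame_cross[OF g] by (rule A) fact
    then show "(o' *\<^sub>R rot g \<bullet> ?a) * (g \<bullet> ?b) \<le> (o' *\<^sub>R rot g \<bullet> ?b) * (g \<bullet> ?a)"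
      by (simp add: rot_inner cross2_simps algebra_simps)
  next
    fix q1 q2 assume q: "q1 \<in> {0<..e}" "q2 \<in> {0<..e}" "g \<bullet> c1 q1 = g \<bullet> c2 q2"
      "o' *\<^sub>R rot g \<bullet> c1 q1 < o' *\<^sub>R rot g \<bullet> c2 q2"
    let ?a = "s2 *\<^sub>R fv v2 (c1 q1)" and ?b = "s1 *\<^sub>R fv v1 (c1 q1)"
    have "o' * ((g \<bullet> ?a) * cross2 g ?b - cross2 g ?a * (g \<bullet> ?b)) \<ge> 0"
      unfolding frame_cross[OF g] by (rule B) (use q in \<open>auto simp: rot_inner\<close>)
    then show "(o' *\<^sub>R rot g \<bullet> ?a) * (g \<bullet> ?b) \<le> (o' *\<^sub>R rot g \<bullet> ?b) * (g \<bullet> ?a)"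
      by (simp add: rot_inner cross2_simps algebra_simps)
  qed auto
qed

lemma backward_arc_shift:
  assumes "backward_arc v z c (c + e)" "s \<in> {0..e}"
  shows "((\<lambda>s. z (c + s)) has_vector_derivative (- 1) *\<^sub>R fv v (z (c + s))) (at s within {0..e})"
proof -
  have img: "(\<lambda>s. c + s) ` {0..e} = {c..c + e}" by (auto simp: image_iff intro!: bexI[of _ "_ - c"])
  have "((\<lambda>s. c + s) has_vector_derivative 1) (at s within {0..e})"
    by (auto intro!: derivative_eq_intros)
  moreover have "(z has_vector_derivative - fv v (z (c + s))) (at (c + s) within (\<lambda>s. c + s) ` {0..e})"
    unfolding img using assms by (auto simp: backward_arc_def)
  ultimately have "((z \<circ> (\<lambda>s. c + s)) has_vector_derivative 1 *\<^sub>R (- fv v (z (c + s)))) (at s within {0..e})"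
    by (rule vector_diff_chain_within)
  then show ?thesis by (simp add: comp_def)
qed

lemma backward_arc_reflect:
  assumes "backward_arc v z (c - e) c" "s \<in> {0..e}"
  shows "((\<lambda>s. z (c - s)) has_vector_derivative 1 *\<^sub>R fv v (z (c - s))) (at s within {0..e})"
proof -
  have img: "(\<lambda>s. c - s) ` {0..e} = {c - e..c}" by (auto simp: image_iff intro!: bexI[of _ "c - _"])
  have "((\<lambda>s. c - s) has_vector_derivative - 1) (at s within {0..e})"
    by (auto intro!: derivative_eq_intros)
  moreover have "(z has_vector_derivative - fv v (z (c - s))) (at (c - s) within (\<lambda>s. c - s) ` {0..e})"
    unfolding img using assms by (auto simp: backward_arc_def)
  ultimately have "((z \<circ> (\<lambda>s. c - s)) has_vector_derivative (- 1) *\<^sub>R (- fv v (z (c - s)))) (at s within {0..e})"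
    by (rule vector_diff_chain_within)
  then show ?thesis by (simp add: comp_def)
qed

text \<open>An arc together with the sign of its normal field: \<^term>\<open>l *\<^sub>R rot (fv v (z s))\<close> is normal to
  \<^term>\<open>R s\<close> at \<^term>\<open>z s\<close> and annihilates the Hamiltonian.\<close>

definition normal_arc :: "(nat \<Rightarrow> real) \<Rightarrow> real \<Rightarrow> (real \<Rightarrow> real^2) \<Rightarrow> real \<Rightarrow> real \<Rightarrow> bool" where
  "normal_arc v l z a b \<longleftrightarrow> backward_arc v z a b \<and> l \<noteq> 0 \<and> (\<forall>s\<in>{a..b}. fv v (z s) \<noteq> 0 \<and> T (z s) = ereal s \<and>
     (\<forall>y\<in>R s. l * cross2 (fv v (z s)) (y - z s) \<le> 0) \<and>
     (\<forall>v'. ctrl v' \<longrightarrow> l * cross2 (fv v (z s)) (fv v' (z s)) \<ge> 0))"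

lemma normal_arcD:
  assumes "normal_arc v l z a b"
  shows "backward_arc v z a b" "l \<noteq> 0" "s \<in> {a..b} \<Longrightarrow> fv v (z s) \<noteq> 0" "s \<in> {a..b} \<Longrightarrow> T (z s) = ereal s"
    "s \<in> {a..b} \<Longrightarrow> y \<in> R s \<Longrightarrow> l * cross2 (fv v (z s)) (y - z s) \<le> 0"
    "s \<in> {a..b} \<Longrightarrow> ctrl v' \<Longrightarrow> l * cross2 (fv v (z s)) (fv v' (z s)) \<ge> 0"
  using assms unfolding normal_arc_def by blast+

lemma normal_arc_subset:
  assumes "normal_arc v l z a b" "a \<le> a'" "b' \<le> b" shows "normal_arc v l z a' b'"
  using assms backward_arc_subset[of v z a b a' b'] unfolding normal_arc_def by auto

lemma normal_arc_exists:
  assumes arc: "backward_arc v z a b" and ab: "0 \<le> a" "a < b" "b < Tc" and T: "\<And>s. s \<in> {a..b} \<Longrightarrow> T (z s) = ereal s"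
    and S: "singular_at b (z b)"
  shows "\<exists>l. normal_arc v l z a b"
proof -
  obtain l where "l \<noteq> 0" "\<And>s. s \<in> {a..b} \<Longrightarrow> fv v (z s) \<noteq> 0"
    "\<And>s y. s \<in> {a..b} \<Longrightarrow> y \<in> R s \<Longrightarrow> l * cross2 (fv v (z s)) (y - z s) \<le> 0"
    "\<And>s v'. s \<in> {a..b} \<Longrightarrow> ctrl v' \<Longrightarrow> l * cross2 (fv v (z s)) (fv v' (z s)) \<ge> 0"
    using singular_at_transport[OF assms] by metis
  then show ?thesis using arc T unfolding normal_arc_def by blast
qed

text \<open>Each arc satisfies its minimum condition against the velocity of the other. As
  \<open>l\<close> and \<open>l'\<close> have the same sign, these are the two cross-slope
  inequalities, so the curves have the same points; equality of minimum times then matches the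
  parameters.\<close>

lemma no_branching:
  assumes n1: "normal_arc v l z c (c + e)" and n2: "normal_arc v' l' z' c (c + e)" and e: "e > 0"
    and eq: "z c = z' c" and ll: "l * l' > 0" and k: "fv v' (z c) = k *\<^sub>R fv v (z c)" "k > 0"
  shows "\<exists>e'>0. e' \<le> e \<and> (\<forall>s\<in>{c..c + e'}. z s = z' s)"
proof -
  define g where "g = - (fv v (z c) /\<^sub>R norm (fv v (z c)))"
  define o' where "o' = - sgn l"
  have nz: "fv v (z c) \<noteq> 0" using normal_arcD(3)[OF n1] e by auto
  have g: "norm g = 1" using nz by (simp add: g_def)
  have o1: "o' * o' = 1" using normal_arcD(2)[OF n1] by (simp add: o'_def sgn_if)
  have gf: "g \<bullet> fv v (z c) = - norm (fv v (z c))"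
    using nz by (simp add: g_def power2_norm_eq_inner[symmetric] power2_eq_square)
  have ol: "o' * x \<ge> 0" if "- l * x \<ge> 0" for x
    using sgn_mult_nonneg[of l "- x"] that by (simp add: o'_def)
  have ol': "o' * x \<ge> 0" if "- l' * x \<ge> 0" for x
    using ol[of x] that ll by (auto simp: zero_less_mult_iff mult_le_0_iff)
  have ct: "ctrl v" "ctrl v'" using n1 n2 normal_arcD(1) backward_arc_ctrl by blast+
  have "\<exists>e'>0. e' \<le> e \<and> (\<forall>s\<in>{0<..e'}. \<exists>q\<in>{0<..e}. z (c + s) = z' (c + q))"
  proof (rule curve_comparison[OF e _ _ ct, where ?s1.0="- 1" and ?s2.0="- 1" and g=g and o'=o' and w="z c"])
    show "((\<lambda>s. z (c + s)) has_vector_derivative (- 1) *\<^sub>R fv v (z (c + s))) (at s within {0..e})" if "s \<in> {0..e}" for s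
      by (rule backward_arc_shift[OF normal_arcD(1)[OF n1] that])
    show "((\<lambda>s. z' (c + s)) has_vector_derivative (- 1) *\<^sub>R fv v' (z' (c + s))) (at s within {0..e})" if "s \<in> {0..e}" for s
      by (rule backward_arc_shift[OF normal_arcD(1)[OF n2] that])
    show "0 < g \<bullet> ((- 1) *\<^sub>R fv v (z c))" "0 < g \<bullet> ((- 1) *\<^sub>R fv v' (z c))" using gf nz k by auto
    fix s assume s: "s \<in> {0<..e}"
    have "l' * cross2 (fv v' (z' (c + s))) (fv v (z' (c + s))) \<ge> 0" using s normal_arcD(6)[OF n2 _ ct(1)] by auto
    then have "- l' * cross2 (fv v (z' (c + s))) (fv v' (z' (c + s))) \<ge> 0"
      by (subst cross2_commute) simp
    from ol'[OF this] show "0 \<le> o' * cross2 ((- 1) *\<^sub>R fv v (z' (c + s))) ((- 1) *\<^sub>R fv v' (z' (c + s)))"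
      by (simp add: cross2_simps)
  next
    fix q1 q2 assume "q1 \<in> {0<..e}"
    then have "l * cross2 (fv v (z (c + q1))) (fv v' (z (c + q1))) \<ge> 0" using normal_arcD(6)[OF n1 _ ct(2)] by auto
    then have "- l * cross2 (fv v' (z (c + q1))) (fv v (z (c + q1))) \<ge> 0"
      by (subst cross2_commute) simp
    from ol[OF this] show "0 \<le> o' * cross2 ((- 1) *\<^sub>R fv v' (z (c + q1))) ((- 1) *\<^sub>R fv v (z (c + q1)))"
      by (simp add: cross2_simps)
  qed (use g o1 eq in auto)
  then obtain e' where e': "e' > 0" "e' \<le> e" "\<And>s. s \<in> {0<..e'} \<Longrightarrow> \<exists>q\<in>{0<..e}. z (c + s) = z' (c + q)" by blast
  have "z s = z' s" if s: "s \<in> {c..c + e'}" for s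
  proof (cases "s = c")
    case False
    then obtain q where q: "q \<in> {0<..e}" "z s = z' (c + q)" using e'(3)[of "s - c"] s by auto
    have "T (z s) = ereal s" using normal_arcD(4)[OF n1, of s] s e' by auto
    moreover have "T (z' (c + q)) = ereal (c + q)" using normal_arcD(4)[OF n2, of "c + q"] q by auto
    ultimately show ?thesis using q by simp
  qed (use eq in simp)
  then show ?thesis using e' by blast
qed

text \<open>If the velocity reversed, both arcs would leave \<open>z c\<close> in one direction
  \<open>g\<close>, one with time to go increasing, the other with it decreasing. Their coefficients
  \<open>l\<close>, \<open>l'\<close> would have opposite signs, which makes the arcs coincide near
  \<open>z c\<close> although their minimum times lie on different sides of
  \<open>c\<close>.\<close>

lemma no_cusp:
  assumes n1: "normal_arc v l z c (c + e)" and n2: "normal_arc v' l' z (c - e) c" and e: "e > 0" "0 \<le> c - e" "c < Tc"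
  shows "\<exists>k>0. fv v (z c) = k *\<^sub>R fv v' (z c)"
proof -
  have ct: "ctrl v" "ctrl v'" using n1 n2 normal_arcD(1) backward_arc_ctrl by blast+
  have cc: "c \<in> {c..c + e}" "c \<in> {c - e..c}" using e by auto
  have nz: "fv v (z c) \<noteq> 0" "fv v' (z c) \<noteq> 0" using normal_arcD(3)[OF n1 cc(1)] normal_arcD(3)[OF n2 cc(2)] by auto
  have Tz: "T (z c) = ereal c" by (rule normal_arcD(4)[OF n1 cc(1)])
  have c0: "c > 0" using e by simp
  have zc: "z c \<in> R c" "z c \<noteq> 0" using Tz c0 T_zero by (auto simp: reach_set_def)
  define p where "p = l *\<^sub>R rot (fv v (z c))"
  have p: "p \<bullet> x = l * cross2 (fv v (z c)) x" for x by (simp add: p_def rot_inner)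
  have pn: "p \<bullet> (y - z c) \<le> 0" if "y \<in> R c" for y unfolding p by (rule normal_arcD(5)[OF n1 cc(1) that])
  have p0: "p \<noteq> 0" using normal_arcD(2)[OF n1] nz by (metis norm_rot norm_eq_zero p_def scaleR_eq_0_iff)
  have "p \<bullet> fv v' (z c) = 0"
  proof (rule singular_at_normal_orthogonal[OF normal_arcD(1)[OF n2]])
    show "hamiltonian F G M (z c) p = 0"
      by (rule hamiltonian_zeroI[OF ct(1)]) (use normal_arcD(6)[OF n1 cc(1)] in \<open>auto simp: p\<close>)
  qed (use e pn normal_arcD(4)[OF n2] in auto)
  then have "cross2 (fv v (z c)) (fv v' (z c)) = 0" using normal_arcD(2)[OF n1] by (simp add: p)
  then have "cross2 (fv v' (z c)) (fv v (z c)) = 0" by (subst cross2_commute) simp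
  from cross2_zero_imp_parallel[OF this nz(2)] obtain k where k: "fv v (z c) = k *\<^sub>R fv v' (z c)" by blast
  have "k > 0"
  proof (rule ccontr)
    assume "\<not> k > 0"
    then have k0: "k < 0" using k nz by (cases "k = 0") auto
    \<comment> \<open>Equal signs together with reversed velocities would give opposite normals at
      \<open>z c\<close>.\<close>
    have sgl: "l * l' < 0"
    proof (rule ccontr)
      assume "\<not> l * l' < 0"
      then have ll: "l * l' > 0" using normal_arcD(2)[OF n1] normal_arcD(2)[OF n2] by (simp add: less_le)
      have "p \<bullet> (y - z c) \<ge> 0" if "y \<in> R c" for y
      proof -
        have "l' * cross2 (fv v' (z c)) (y - z c) \<le> 0" by (rule normal_arcD(5)[OF n2 cc(2) that])
        then have "l * cross2 (fv v' (z c)) (y - z c) \<le> 0" using ll by (auto simp: zero_less_mult_iff mult_le_0_iff)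
        then have "k * (l * cross2 (fv v' (z c)) (y - z c)) \<ge> 0" using k0 by (simp add: zero_le_mult_iff)
        then show ?thesis unfolding p k by (simp add: cross2_simps algebra_simps)
      qed
      then show False using opposite_normals_False[OF c0 e(3) zc p0 pn] by blast
    qed
    define g where "g = fv v' (z c) /\<^sub>R norm (fv v' (z c))"
    define o' where "o' = sgn l'"
    have g: "norm g = 1" using nz by (simp add: g_def)
    have o1: "o' * o' = 1" using normal_arcD(2)[OF n2] by (simp add: o'_def sgn_if)
    have gf: "g \<bullet> fv v' (z c) = norm (fv v' (z c))"
      using nz by (simp add: g_def power2_norm_eq_inner[symmetric] power2_eq_square)
    have gfv: "g \<bullet> fv v (z c) < 0" using gf k k0 nz by (simp add: mult_neg_pos)
    have ol: "o' * x \<ge> 0" if "l' * x \<ge> 0" for x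
      using sgn_mult_nonneg[OF that] by (simp add: o'_def)
    have cont: "continuous_on {c..c + e} (\<lambda>s. g \<bullet> fv v (z s))"
      by (intro continuous_intros continuous_on_compose2[OF fv_continuous[of UNIV]] backward_arc_continuous[OF normal_arcD(1)[OF n1]]) auto
    then obtain d where d: "d > 0" "\<And>s. s \<in> {c..c + e} \<Longrightarrow> dist s c < d \<Longrightarrow>
        dist (g \<bullet> fv v (z s)) (g \<bullet> fv v (z c)) < - (g \<bullet> fv v (z c))"
      unfolding continuous_on_iff using gfv cc(1) by (metis neg_0_less_iff_less)
    define e1 where "e1 = min e (d / 2)"
    have e1: "e1 > 0" "e1 \<le> e" using e d by (auto simp: e1_def)
    have neg: "g \<bullet> fv v (z (c + s)) < 0" if "s \<in> {0..e1}" for s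
      using d(2)[of "c + s"] that d(1) e1 by (auto simp: e1_def dist_real_def abs_less_iff)
    have n1': "normal_arc v l z c (c + e1)" and n2': "normal_arc v' l' z (c - e1) c"
      using e1 by (auto intro: normal_arc_subset[OF n1] normal_arc_subset[OF n2])
    have "\<exists>e'>0. e' \<le> e1 \<and> (\<forall>s\<in>{0<..e'}. \<exists>q\<in>{0<..e1}. z (c + s) = z (c - q))"
    proof (rule curve_comparison[OF e1(1) _ _ ct, where ?s1.0="- 1" and ?s2.0="1" and g=g and o'=o' and w="z c"])
      show "((\<lambda>s. z (c + s)) has_vector_derivative (- 1) *\<^sub>R fv v (z (c + s))) (at s within {0..e1})" if "s \<in> {0..e1}" for s
        by (rule backward_arc_shift[OF normal_arcD(1)[OF n1'] that])
      show "((\<lambda>s. z (c - s)) has_vector_derivative 1 *\<^sub>R fv v' (z (c - s))) (at s within {0..e1})" if "s \<in> {0..e1}" for s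
        by (rule backward_arc_reflect[OF normal_arcD(1)[OF n2'] that])
      show "0 < g \<bullet> ((- 1) *\<^sub>R fv v (z c))" "0 < g \<bullet> (1 *\<^sub>R fv v' (z c))" using gf gfv nz by auto
      fix s assume s: "s \<in> {0<..e1}"
      have "l' * cross2 (fv v' (z (c - s))) (fv v (z (c - s))) \<ge> 0" using s normal_arcD(6)[OF n2' _ ct(1)] by auto
      from ol[OF this] have "o' * (- cross2 (fv v (z (c - s))) (fv v' (z (c - s)))) \<ge> 0"
        by (subst (asm) cross2_commute)
      then show "0 \<le> o' * cross2 ((- 1) *\<^sub>R fv v (z (c - s))) (1 *\<^sub>R fv v' (z (c - s)))"
        by (simp add: cross2_simps)
    next
      fix q1 q2 assume q: "q1 \<in> {0<..e1}" "q2 \<in> {0<..e1}" "g \<bullet> z (c + q1) = g \<bullet> z (c - q2)"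
        "o' * cross2 g (z (c + q1)) < o' * cross2 g (z (c - q2))"
      \<comment> \<open>Hypothesis \<open>B\<close> of the comparison is settled by refuting its
        premise: \<open>z (c - q2)\<close> belongs to \<open>R (c + q1)\<close>, and the normal of
        that set at \<open>z (c + q1)\<close> excludes a point straight above it in the
        frame.\<close>
      define x where "x = z (c - q2) - z (c + q1)"
      define D where "D = o' * cross2 g x"
      have D: "D > 0" using q(4) by (simp add: D_def x_def cross2_simps algebra_simps)
      have gx: "g \<bullet> x = 0" "(o' *\<^sub>R rot g) \<bullet> x = D"
        using q(3) by (simp_all add: x_def D_def rot_inner inner_diff_right cross2_simps algebra_simps)
      have x: "x = (D * o') *\<^sub>R rot g" using frame_decomposition[OF g o1, of x] unfolding gx by simp
      have "T (z (c - q2)) = ereal (c - q2)" using normal_arcD(4)[OF n2', of "c - q2"] q by auto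
      then have "z (c - q2) \<in> R (c + q1)" using q by (simp add: reach_set_def)
      then have "l * cross2 (fv v (z (c + q1))) x \<le> 0"
        unfolding x_def using q by (intro normal_arcD(5)[OF n1']) auto
      then have "D * ((l * o') * (g \<bullet> fv v (z (c + q1)))) \<le> 0"
        unfolding x by (simp add: cross2_simps cross2_rot_right inner_commute algebra_simps)
      moreover have "l * o' < 0" using sgl by (auto simp: o'_def sgn_if mult_less_0_iff)
      moreover have "g \<bullet> fv v (z (c + q1)) < 0" using neg q by auto
      ultimately have False using D by (simp add: mult_le_0_iff zero_less_mult_iff not_le mult_less_0_iff)
      then show "0 \<le> o' * cross2 (1 *\<^sub>R fv v' (z (c + q1))) ((- 1) *\<^sub>R fv v (z (c + q1)))" ..
    qed (use g o1 in auto)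
    then obtain s q where sq: "s \<in> {0<..e1}" "q \<in> {0<..e1}" "z (c + s) = z (c - q)"
      by (metis greaterThanAtMost_iff order_refl)
    then have "ereal (c + s) = ereal (c - q)"
      using normal_arcD(4)[OF n1', of "c + s"] normal_arcD(4)[OF n2', of "c - q"] by auto
    then show False using sq by simp
  qed
  then show ?thesis using k by blast
qed

end

section \<open>The singular set\<close>

text \<open>Singular curves of one terminal class extend one another, so curves for a countable
  cofinal set of final times cover all of them.\<close>

lemma countable_cofinal:
  fixes A :: "real set"
  obtains D where "countable D" "D \<subseteq> A" "\<And>a. a \<in> A \<Longrightarrow> \<exists>d\<in>D. a \<le> d"
proof (cases "\<exists>m\<in>A. \<forall>a\<in>A. a \<le> m")
  case True
  then obtain m where "m \<in> A" "\<forall>a\<in>A. a \<le> m" by blast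
  then show ?thesis using that[of "{m}"] by auto
next
  case False
  define Q where "Q = {q \<in> \<rat>. \<exists>d\<in>A. q \<le> d}"
  have "\<forall>q\<in>Q. \<exists>d. d \<in> A \<and> q \<le> d" by (auto simp: Q_def)
  then obtain d where d: "\<And>q. q \<in> Q \<Longrightarrow> d q \<in> A \<and> q \<le> d q" by metis
  show ?thesis
  proof (rule that[of "d ` Q"])
    have "countable Q" unfolding Q_def by (rule countable_subset[OF _ countable_rat]) auto
    then show "countable (d ` Q)" by simp
    show "d ` Q \<subseteq> A" using d by auto
    fix a assume "a \<in> A"
    then obtain a' where a': "a' \<in> A" "a < a'" using False by (meson not_le)
    then obtain q where "q \<in> \<rat>" "a < q" "q < a'" using Rats_dense_in_real by blast
    then have "q \<in> Q" using a' by (auto simp: Q_def intro: less_imp_le)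
    then show "\<exists>d\<in>d ` Q. a \<le> d" using d \<open>a < q\<close> by force
  qed
qed

lemma rectifiable_of_countable_cover:
  fixes S :: "'a::metric_space set" and Fs :: "(real \<Rightarrow> 'a) set"
  assumes "countable Fs" and lip: "\<And>f. f \<in> Fs \<Longrightarrow> \<exists>C. C-lipschitz_on UNIV f" and sub: "S \<subseteq> (\<Union>f\<in>Fs. range f)"
  shows "countably_H1_rectifiable S"
proof (cases "Fs = {}")
  case True
  then have "S = {}" using sub by auto
  moreover have "\<exists>C. C-lipschitz_on UNIV (\<lambda>_::real. undefined :: 'a)"
    by (intro exI[of _ 0] lipschitz_onI) auto
  ultimately show ?thesis
    unfolding countably_H1_rectifiable_def by (intro exI[of _ "\<lambda>_ _. undefined"]) (simp add: hausdorff1_empty)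
next
  case False
  define f where "f = from_nat_into Fs"
  have rf: "range f = Fs" unfolding f_def by (rule range_from_nat_into[OF False \<open>countable Fs\<close>])
  have "S - (\<Union>k. range (f k)) = {}" using sub rf by force
  then show ?thesis
    unfolding countably_H1_rectifiable_def using lip rf
    by (intro exI[of _ f] conjI) (blast, simp only: hausdorff1_empty)
qed

section \<open>Terminal configurations and rectifiability\<close>

context control_system
begin

lemma rank_cross: assumes "i < M" shows "cross2 (G i 0) (DF 0 (G i 0)) \<noteq> 0"
proof -
  define A where "A = (vector [G i 0, DF 0 (G i 0)] :: real^2^2)"
  have "rank (transpose A) = CARD(2)" using rank[OF assms] by (simp add: A_def)
  then have "inj ((*v) (transpose A))" by (simp only: full_rank_injective)
  then have "invertible (transpose A)"
    using matrix_left_invertible_injective invertible_left_inverse by blast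
  then have "det (transpose A) \<noteq> 0" by (simp add: invertible_det_nz)
  then show ?thesis by (simp add: det_2 A_def cross2_def transpose_def mult.commute)
qed

lemma G_nonzero: "i < M \<Longrightarrow> G i 0 \<noteq> 0"
  using rank_cross[of i] by (auto simp: cross2_def)

definition g0 :: "real^2" where "g0 = G 0 0"

text \<open>\<open>a\<close> is the sign of the normal coefficient and \<open>b\<close> the sense of
  the terminal velocity along \<open>g0\<close>; these are the data in which two singular curves can
  differ at the origin.\<close>

definition terminal_class :: "real \<Rightarrow> real \<Rightarrow> (real \<Rightarrow> real^2) \<Rightarrow> bool" where
  "terminal_class a b z \<longleftrightarrow> (\<exists>e>0. \<exists>w l. normal_arc w l z 0 e \<and> sgn l = a \<and> sgn (g0 \<bullet> fv w 0) = b)"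

text \<open>As \<open>F 0 = 0\<close>, the first control alone produces both \<open>g0\<close> and
  \<open>- g0\<close> as velocities at the origin; the minimum condition against both forces the
  terminal velocity to be parallel to \<open>g0\<close>.\<close>

lemma normal_arc_terminal_velocity:
  assumes n: "normal_arc w l z 0 e" and "e > 0" "z 0 = 0"
  obtains k where "k \<noteq> 0" "fv w 0 = k *\<^sub>R g0" "sgn (g0 \<bullet> fv w 0) = sgn k"
proof -
  have nz: "fv w 0 \<noteq> 0" using normal_arcD(3)[OF n, of 0] assms by auto
  have gz: "g0 \<noteq> 0" unfolding g0_def using G_nonzero[OF M_pos] .
  have "l * cross2 (fv w 0) (s *\<^sub>R g0) \<ge> 0" if "\<bar>s\<bar> \<le> 1" for s
  proof -
    define v where "v = (\<lambda>j::nat. if j = 0 then s else 0)"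
    have "(\<Sum>i<M. v i *\<^sub>R G i 0) = (\<Sum>i<M. if i = 0 then s *\<^sub>R G 0 0 else 0)"
      by (rule sum.cong) (auto simp: v_def)
    also have "\<dots> = s *\<^sub>R g0" using M_pos by (simp add: g0_def sum.delta)
    finally have "fv v 0 = s *\<^sub>R g0" by (simp add: fv_def F0)
    moreover have "ctrl v" using that by (auto simp: v_def ctrl_def)
    ultimately show ?thesis using normal_arcD(6)[OF n, of 0 v] assms by auto
  qed
  from this[of 1] this[of "- 1"] have "l * cross2 (fv w 0) g0 = 0" by (simp add: cross2_simps)
  then have "cross2 (fv w 0) g0 = 0" using normal_arcD(2)[OF n] by simp
  then have "cross2 g0 (fv w 0) = 0" by (subst cross2_commute) simp
  from cross2_zero_imp_parallel[OF this gz] obtain k where k: "fv w 0 = k *\<^sub>R g0" by blast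
  have "k \<noteq> 0" using k nz by auto
  moreover have "sgn (g0 \<bullet> fv w 0) = sgn k" unfolding k using gz by (simp add: sgn_mult)
  ultimately show ?thesis using that k by blast
qed

lemma terminal_class_exists:
  assumes opt: "opt_curve t z" and S: "singular_at t (z t)"
  obtains a b where "a \<in> {1, - 1}" "b \<in> {1, - 1}" "terminal_class a b z"
proof -
  note o = opt_curveD[OF opt]
  have "0 \<in> {0..<t}" using o(1) by simp
  from o(6)[OF this] obtain e w where e: "e > 0" "e \<le> t" "backward_arc w z 0 e" by auto
  have "\<exists>l. normal_arc w l z 0 e"
    by (rule normal_arc_exists[OF e(3)]) (use e o(2,5) singular_at_along[OF opt S] in auto)
  then obtain l where n: "normal_arc w l z 0 e" by blast
  obtain k where k: "k \<noteq> 0" "sgn (g0 \<bullet> fv w 0) = sgn k"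
    by (rule normal_arc_terminal_velocity[OF n e(1) o(3)])
  show ?thesis
    by (rule that[of "sgn l" "sgn k"])
      (use n e(1) k normal_arcD(2)[OF n] in \<open>auto simp: terminal_class_def sgn_if split: if_splits\<close>)
qed

lemma normal_arc_cong:
  assumes n: "normal_arc v l z a b" and eq: "\<And>s. s \<in> {a..b} \<Longrightarrow> z' s = z s"
  shows "normal_arc v l z' a b"
proof -
  have "backward_arc v z' a b" unfolding backward_arc_def
  proof (intro conjI ballI)
    show "ctrl v" using normal_arcD(1)[OF n] backward_arc_ctrl by blast
    fix s assume s: "s \<in> {a..b}"
    have "(z has_vector_derivative - fv v (z s)) (at s within {a..b})"
      using normal_arcD(1)[OF n] s by (simp add: backward_arc_def)
    then show "(z' has_vector_derivative - fv v (z' s)) (at s within {a..b})"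
      unfolding eq[OF s] by (rule has_vector_derivative_transform[OF s, rotated]) (rule eq)
  qed
  then show ?thesis using n eq unfolding normal_arc_def by auto
qed

text \<open>Continuous induction from the origin. There the class supplies matching signs; at a
  later time the common past does: \<open>no_cusp\<close> makes both outgoing velocities positive
  multiples of the incoming one, and coefficients of opposite sign would give opposite
  normals.\<close>

lemma same_class_eq:
  assumes opt: "opt_curve t z" "opt_curve t z'" and S: "singular_at t (z t)" "singular_at t (z' t)"
    and cl: "terminal_class a b z" "terminal_class a b z'" and s: "s \<in> {0..t}"
  shows "z s = z' s"
proof -
  note o = opt_curveD[OF opt(1)] and o' = opt_curveD[OF opt(2)]
  define A where "A = {s \<in> {0..t}. \<forall>q\<in>{0..s}. z q = z' q}"
  have A0: "0 \<in> A" using o(1,3) o'(3) by (auto simp: A_def)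
  have bdd: "bdd_above A" by (auto simp: A_def)
  define c where "c = Sup A"
  have c: "0 \<le> c" "c \<le> t"
    unfolding c_def by (rule cSup_upper[OF A0 bdd]) (rule cSup_least, use A0 in \<open>auto simp: A_def\<close>)
  have below: "z q = z' q" if q: "0 \<le> q" "q < c" for q
  proof -
    obtain s where "s \<in> A" "q < s" using q(2) less_cSup_iff[of A q] A0 bdd unfolding c_def by blast
    then show ?thesis using q by (auto simp: A_def)
  qed
  have zc: "z c = z' c"
  proof (cases "c = 0")
    case False
    then have c0: "c > 0" using c by simp
    have "continuous_on {0..t} (\<lambda>s. z s - z' s)" by (intro continuous_intros o o')
    then have "((\<lambda>s. z s - z' s) \<longlongrightarrow> z c - z' c) (at c within {0..t})"
      using c by (auto simp: continuous_on_def)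
    then have "((\<lambda>s. z s - z' s) \<longlongrightarrow> z c - z' c) (at c within {0..c})"
      by (rule tendsto_within_subset) (use c in auto)
    moreover have "((\<lambda>s. z s - z' s) \<longlongrightarrow> 0) (at c within {0..c})"
      by (rule tendsto_eventually) (use below in \<open>auto simp: eventually_at_filter\<close>)
    moreover have "at c within {0..c} \<noteq> bot" using c0 by (simp add: at_within_Icc_at_left)
    ultimately have "z c - z' c = 0" using tendsto_unique by blast
    then show ?thesis by simp
  qed (use o(3) o'(3) in simp)
  have eqc: "z q = z' q" if "q \<in> {0..c}" for q using below[of q] zc that by (cases "q = c") auto
  have "c = t"
  proof (rule ccontr)
    assume "c \<noteq> t"
    then have ct: "c \<in> {0..<t}" using c by auto
    have "\<exists>e>0. c + e \<le> t \<and> (\<forall>s\<in>{c..c + e}. z s = z' s)"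
    proof (cases "c = 0")
      case True
      obtain e1 w1 l1 where 1: "e1 > 0" "normal_arc w1 l1 z 0 e1" "sgn l1 = a" "sgn (g0 \<bullet> fv w1 0) = b"
        using cl by (auto simp: terminal_class_def)
      obtain e2 w2 l2 where 2: "e2 > 0" "normal_arc w2 l2 z' 0 e2" "sgn l2 = a" "sgn (g0 \<bullet> fv w2 0) = b"
        using cl by (auto simp: terminal_class_def)
      obtain k1 where k1: "k1 \<noteq> 0" "fv w1 0 = k1 *\<^sub>R g0" "sgn (g0 \<bullet> fv w1 0) = sgn k1"
        by (rule normal_arc_terminal_velocity[OF 1(2,1) o(3)])
      obtain k2 where k2: "k2 \<noteq> 0" "fv w2 0 = k2 *\<^sub>R g0" "sgn (g0 \<bullet> fv w2 0) = sgn k2"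
        by (rule normal_arc_terminal_velocity[OF 2(2,1) o'(3)])
      define e where "e = min t (min e1 e2)"
      have "sgn k1 = sgn k2" "sgn l1 = sgn l2" using 1 2 k1 k2 by auto
      then have kk: "k2 / k1 > 0" "l1 * l2 > 0"
        using k1 k2 normal_arcD(2)[OF 1(2)] normal_arcD(2)[OF 2(2)]
        by (auto simp: sgn_if zero_less_divide_iff zero_less_mult_iff split: if_splits)
      have "\<exists>e'>0. e' \<le> e \<and> (\<forall>s\<in>{0..0 + e'}. z s = z' s)"
      proof (rule no_branching[of w1 l1 z 0 e w2 l2 z' "k2 / k1"])
        show "normal_arc w1 l1 z 0 (0 + e)" by (rule normal_arc_subset[OF 1(2)]) (auto simp: e_def)
        show "normal_arc w2 l2 z' 0 (0 + e)" by (rule normal_arc_subset[OF 2(2)]) (auto simp: e_def)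
        show "e > 0" using 1 2 o(1) by (simp add: e_def)
        show "fv w2 (z 0) = (k2 / k1) *\<^sub>R fv w1 (z 0)" using k1 k2 o(3) by simp
      qed (use kk o(3) o'(3) in auto)
      then show ?thesis using True by (auto simp: e_def)
    next
      case False
      then have c0: "c > 0" using c by simp
      from o(6)[OF ct] obtain e1 w1 where 1: "e1 > 0" "c + e1 \<le> t" "backward_arc w1 z c (c + e1)" by blast
      from o'(6)[OF ct] obtain e2 w2 where 2: "e2 > 0" "c + e2 \<le> t" "backward_arc w2 z' c (c + e2)" by blast
      from o(7)[of c] obtain e3 v where 3: "e3 > 0" "0 \<le> c - e3" "backward_arc v z (c - e3) c" using c0 c by auto
      define e where "e = min e1 (min e2 e3)"
      have e: "e > 0" "e \<le> e1" "e \<le> e2" "e \<le> e3" using 1 2 3 by (auto simp: e_def)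
      have "\<exists>l. normal_arc w1 l z c (c + e)"
        by (rule normal_arc_exists[OF backward_arc_subset[OF 1(3)]]) (use e 1 c o(2,5) singular_at_along[OF opt(1) S(1)] in auto)
      then obtain l1 where n1: "normal_arc w1 l1 z c (c + e)" by blast
      have "\<exists>l. normal_arc w2 l z' c (c + e)"
        by (rule normal_arc_exists[OF backward_arc_subset[OF 2(3)]]) (use e 2 c o'(2,5) singular_at_along[OF opt(2) S(2)] in auto)
      then obtain l2 where n2: "normal_arc w2 l2 z' c (c + e)" by blast
      have "\<exists>l. normal_arc v l z (c - e) c"
        by (rule normal_arc_exists[OF backward_arc_subset[OF 3(3)]]) (use e 3 c o(2,5) singular_at_along[OF opt(1) S(1)] in auto)
      then obtain l3 where n3: "normal_arc v l3 z (c - e) c" by blast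
      have n3': "normal_arc v l3 z' (c - e) c" by (rule normal_arc_cong[OF n3]) (use eqc e 3 in auto)
      have cT: "c < Tc" using c o(2) by simp
      have ce: "0 \<le> c - e" using e 3 by simp
      obtain k1 where k1: "k1 > 0" "fv w1 (z c) = k1 *\<^sub>R fv v (z c)"
        using no_cusp[OF n1 n3 e(1) ce cT] by blast
      obtain k2 where k2: "k2 > 0" "fv w2 (z c) = k2 *\<^sub>R fv v (z c)"
        using no_cusp[OF n2 n3' e(1) ce cT] zc by auto
      have kk: "fv w2 (z c) = (k2 / k1) *\<^sub>R fv w1 (z c)" using k1 k2 by simp
      have k0: "k2 / k1 > 0" using k1 k2 by simp
      have cin: "c \<in> {c..c + e}" using e by simp
      have "l1 * l2 > 0"
      proof (rule ccontr)
        assume "\<not> l1 * l2 > 0"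
        then have ll: "l1 * l2 < 0" using normal_arcD(2)[OF n1] normal_arcD(2)[OF n2] by (simp add: less_le not_less)
        have Tz: "T (z c) = ereal c" by (rule normal_arcD(4)[OF n1 cin])
        show False
        proof (rule opposite_normals_False[OF c0 cT, of "z c" "l1 *\<^sub>R rot (fv w1 (z c))"])
          show "z c \<in> R c" "z c \<noteq> 0" using Tz c0 T_zero by (auto simp: reach_set_def)
          have "norm (rot (fv w1 (z c))) \<noteq> 0" using normal_arcD(3)[OF n1 cin] by simp
          then show "l1 *\<^sub>R rot (fv w1 (z c)) \<noteq> 0" using normal_arcD(2)[OF n1] by (metis norm_eq_zero scaleR_eq_0_iff)
          fix y assume y: "y \<in> R c"
          show "l1 *\<^sub>R rot (fv w1 (z c)) \<bullet> (y - z c) \<le> 0"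
            using normal_arcD(5)[OF n1 cin y] by (simp add: rot_inner)
          have "l2 * cross2 (fv w2 (z c)) (y - z c) \<le> 0" using normal_arcD(5)[OF n2 cin y] zc by simp
          then have "(k2 / k1) * (l2 * cross2 (fv w1 (z c)) (y - z c)) \<le> 0"
            unfolding kk by (simp only: bounded_bilinear.scaleR_left[OF cross2_bilinear] ac_simps real_scaleR_def)
          then have "l2 * cross2 (fv w1 (z c)) (y - z c) \<le> 0" using k0 by (simp only: mult_le_0_iff) auto
          then have "l1 * cross2 (fv w1 (z c)) (y - z c) \<ge> 0"
            using ll by (auto simp: mult_less_0_iff mult_le_0_iff zero_le_mult_iff)
          then show "l1 *\<^sub>R rot (fv w1 (z c)) \<bullet> (y - z c) \<ge> 0" by (simp add: rot_inner)
        qed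
      qed
      from no_branching[OF n1 n2 e(1) zc this kk k0]
      obtain e' where "e' > 0" "e' \<le> e" "\<forall>s\<in>{c..c + e'}. z s = z' s" by blast
      then show ?thesis using e 1 by (intro exI[of _ e']) auto
    qed
    then obtain e where e: "e > 0" "c + e \<le> t" "\<And>s. s \<in> {c..c + e} \<Longrightarrow> z s = z' s" by blast
    have "z q = z' q" if "q \<in> {0..c + e}" for q
      using eqc[of q] e(3)[of q] that by (cases "q \<le> c") auto
    then have "c + e \<in> A" using e c by (auto simp: A_def)
    then have "c + e \<le> c" unfolding c_def by (rule cSup_upper[OF _ bdd])
    then show False using e by simp
  qed
  then show ?thesis using eqc s by auto
qed

text \<open>Time is clamped because rectifiability asks for maps that are Lipschitz on the whole
  line.\<close>

lemma opt_curve_lipschitz: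
  assumes opt: "opt_curve t z"
  shows "\<exists>C. C-lipschitz_on UNIV (\<lambda>s. z (max 0 (min t s)))"
proof -
  note o = opt_curveD[OF opt]
  have "compact (z ` {0..t})" using o(4) by (intro compact_continuous_image) auto
  then obtain r where "\<forall>x\<in>z ` {0..t}. norm x \<le> r" using compact_imp_bounded bounded_iff by blast
  then have r: "\<And>s. s \<in> {0..t} \<Longrightarrow> norm (z s) \<le> r" by auto
  obtain C where C: "C > 0" "\<And>v x. ctrl v \<Longrightarrow> norm x \<le> r \<Longrightarrow> norm (fv v x) \<le> C"
    using fv_bounds[of r] by metis
  obtain P where P: "finite P" "\<forall>s\<in>{0<..<t} - P. \<exists>v. ctrl v \<and> (z has_vector_derivative - fv v (z s)) (at s)"
    using o(8) by blast
  then obtain v where v: "\<And>s. s \<in> {0<..<t} - P \<Longrightarrow> ctrl (v s) \<and> (z has_vector_derivative - fv (v s) (z s)) (at s)"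
    by metis
  have inc: "norm (z b - z a) \<le> C * (b - a)" if "a \<le> b" "a \<in> {0..t}" "b \<in> {0..t}" for a b
  proof (rule norm_increment_le[OF that(1) _ P(1)])
    show "continuous_on {a..b} z" using that by (intro continuous_on_subset[OF o(4)]) auto
    fix s assume "s \<in> {a<..<b} - P"
    then have s: "s \<in> {0<..<t} - P" "s \<in> {0..t}" using that by auto
    show "(z has_vector_derivative - fv (v s) (z s)) (at s)" using v[OF s(1)] by blast
    show "norm (- fv (v s) (z s)) \<le> C" using C(2)[of "v s" "z s"] v[OF s(1)] r[OF s(2)] by simp
  qed (use C in simp)
  have "C-lipschitz_on UNIV (\<lambda>s. z (max 0 (min t s)))"
  proof (rule lipschitz_onI)
    fix x y :: real
    define a b where "a = max 0 (min t x)" and "b = max 0 (min t y)"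
    have ab: "a \<in> {0..t}" "b \<in> {0..t}" "\<bar>a - b\<bar> \<le> \<bar>x - y\<bar>" using o(1) by (auto simp: a_def b_def)
    have "norm (z a - z b) \<le> C * \<bar>a - b\<bar>"
      using inc[of a b] inc[of b a] ab by (cases "a \<le> b") (auto simp: norm_minus_commute)
    also have "\<dots> \<le> C * \<bar>x - y\<bar>" using ab C by (intro mult_left_mono) auto
    finally show "dist (z (max 0 (min t x))) (z (max 0 (min t y))) \<le> C * dist x y"
      by (simp add: a_def b_def dist_norm)
  qed (use C in simp)
  then show ?thesis by blast
qed

definition singular_set :: "real \<Rightarrow> (real^2) set" where
  "singular_set \<tau> = {x \<in> R \<tau>. \<exists>\<zeta>. norm \<zeta> = 1 \<and> \<zeta> \<in> prox_normal (reach_set F G M (T x)) x \<and> hamiltonian F G M x \<zeta> = 0}"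

text \<open>A proximal normal to a convex set is an ordinary one: moving \<open>y\<close> towards
  \<open>x\<close> along their segment shrinks the inner product linearly but the error term
  quadratically.\<close>

lemma singular_set_iff:
  assumes "\<tau> < Tc"
  shows "x \<in> singular_set \<tau> \<longleftrightarrow> (\<exists>r. 0 \<le> r \<and> r \<le> \<tau> \<and> T x = ereal r \<and> singular_at r x)"
proof
  assume x: "x \<in> singular_set \<tau>"
  then have "T x \<le> ereal \<tau>" by (simp add: singular_set_def reach_set_def)
  moreover have "0 \<le> T x" by (rule min_time_nonneg)
  ultimately obtain r where r: "T x = ereal r" "0 \<le> r" "r \<le> \<tau>" by (cases "T x") auto
  obtain p s where p: "norm p = 1" "hamiltonian F G M x p = 0" "s \<ge> 0"
    "\<And>y. y \<in> R r \<Longrightarrow> p \<bullet> (y - x) \<le> s * (norm (y - x))\<^sup>2"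
    using x r by (auto simp: singular_set_def prox_normal_def)
  have "p \<bullet> (y - x) \<le> 0" if y: "y \<in> R r" for y
  proof (rule ccontr)
    assume "\<not> p \<bullet> (y - x) \<le> 0"
    define q where "q = p \<bullet> (y - x)"
    define m where "m = s * (norm (y - x))\<^sup>2 + 1"
    have q: "q > 0" using \<open>\<not> p \<bullet> (y - x) \<le> 0\<close> by (simp add: q_def)
    have m: "m > 0" using p by (simp add: m_def add_nonneg_pos)
    define e where "e = min 1 (q / (2 * m))"
    have e: "0 < e" "e \<le> 1" "e * m \<le> q / 2"
    proof -
      show "0 < e" "e \<le> 1" using q m by (auto simp: e_def)
      have "e * m \<le> q / (2 * m) * m" using m by (intro mult_right_mono) (auto simp: e_def)
      then show "e * m \<le> q / 2" using m by simp
    qed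
    have "(1 - e) *\<^sub>R x + e *\<^sub>R y \<in> R r"
      using R_convex[of r] r assms y e by (intro convexD_alt) (auto simp: reach_set_def)
    moreover have "(1 - e) *\<^sub>R x + e *\<^sub>R y - x = e *\<^sub>R (y - x)" by (simp add: algebra_simps)
    ultimately have "p \<bullet> (e *\<^sub>R (y - x)) \<le> s * (norm (e *\<^sub>R (y - x)))\<^sup>2" using p(4) by metis
    then have "e * q \<le> e * (e * (s * (norm (y - x))\<^sup>2))"
      unfolding q_def inner_scaleR_right norm_scaleR power_mult_distrib
      by (simp add: power2_eq_square[of e] mult.left_commute mult.assoc)
    then have "q \<le> e * (s * (norm (y - x))\<^sup>2)" using e by simp
    also have "\<dots> \<le> e * m" using e by (simp add: m_def)
    finally show False using e q by simp
  qed
  then show "\<exists>r. 0 \<le> r \<and> r \<le> \<tau> \<and> T x = ereal r \<and> singular_at r x" using r p by (auto simp: singular_at_def)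
next
  assume "\<exists>r. 0 \<le> r \<and> r \<le> \<tau> \<and> T x = ereal r \<and> singular_at r x"
  then obtain r p where r: "r \<le> \<tau>" "T x = ereal r"
    and p: "norm p = 1" "\<forall>y\<in>R r. p \<bullet> (y - x) \<le> 0" "hamiltonian F G M x p = 0"
    by (auto simp: singular_at_def)
  have "p \<in> prox_normal (reach_set F G M (T x)) x"
    unfolding prox_normal_def r(2) using p by (auto intro!: exI[of _ "0::real"])
  then show "x \<in> singular_set \<tau>" using r p by (auto simp: singular_set_def reach_set_def)
qed

lemma singular_set_curve:
  assumes tau: "0 < \<tau>" "\<tau> < Tc" and x: "x \<in> singular_set \<tau>" "x \<noteq> 0"
  obtains t z where "opt_curve t z" "z t = x" "t \<le> \<tau>" "singular_at t (z t)"
proof -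
  obtain r where r: "T x = ereal r" "singular_at r x" using singular_set_iff[OF tau(2)] x by auto
  have "x \<in> R \<tau>" using x by (simp add: singular_set_def)
  then obtain t z where t: "opt_curve t z" "z t = x" "T x = ereal t" "t \<le> \<tau>"
    using optimal_curve_exists[OF tau _ x(2)] by metis
  then have "r = t" using r by simp
  then show ?thesis using that[OF t(1,2,4)] r t by simp
qed

lemma singular_set_rectifiable:
  assumes tau: "0 < \<tau>" "\<tau> < Tc"
  shows "countably_H1_rectifiable (singular_set \<tau>)"
proof -
  define good where "good a b t z \<longleftrightarrow> opt_curve t z \<and> singular_at t (z t) \<and> t \<le> \<tau> \<and> terminal_class a b z" for a b t z
  define A where "A a b = {t. \<exists>z. good a b t z}" for a b
  have "\<exists>D. countable D \<and> D \<subseteq> A a b \<and> (\<forall>t\<in>A a b. \<exists>d\<in>D. t \<le> d)" for a b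
    using countable_cofinal[of "A a b"] by metis
  then obtain D where D: "\<And>a b. countable (D a b)" "\<And>a b. D a b \<subseteq> A a b"
    "\<And>a b t. t \<in> A a b \<Longrightarrow> \<exists>d\<in>D a b. t \<le> d" by metis
  have "\<forall>a b. \<forall>t\<in>D a b. \<exists>z. good a b t z" using D(2) by (auto simp: A_def)
  then obtain Z where Z: "\<And>a b t. t \<in> D a b \<Longrightarrow> good a b t (Z a b t)" by metis
  define fs where "fs a b = (\<lambda>t s. Z a b t (max 0 (min t s))) ` D a b" for a b
  \<comment> \<open>The constant map covers the origin, to which \<open>singular_set_curve\<close>
    does not apply.\<close>
  define Fs where "Fs = insert (\<lambda>_. 0) (\<Union>a\<in>{1, - 1}. \<Union>b\<in>{1, - 1}. fs a b)"
  show ?thesis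
  proof (rule rectifiable_of_countable_cover[of Fs])
    show "countable Fs" unfolding Fs_def fs_def using D(1) by auto
    fix f assume "f \<in> Fs"
    then consider "f = (\<lambda>_. 0)" | a b t where "t \<in> D a b" "f = (\<lambda>s. Z a b t (max 0 (min t s)))"
      unfolding Fs_def fs_def by blast
    then show "\<exists>C. C-lipschitz_on UNIV f"
    proof cases
      case 1
      then show ?thesis by (intro exI[of _ 0] lipschitz_onI) auto
    next
      case 2
      then show ?thesis using Z[OF 2(1)] opt_curve_lipschitz by (auto simp: good_def)
    qed
  next
    show "singular_set \<tau> \<subseteq> (\<Union>f\<in>Fs. range f)"
    proof
      fix x assume x: "x \<in> singular_set \<tau>"
      show "x \<in> (\<Union>f\<in>Fs. range f)"
      proof (cases "x = 0")
        case False
        obtain t z where z: "opt_curve t z" "z t = x" "t \<le> \<tau>" "singular_at t (z t)"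
          by (rule singular_set_curve[OF tau x False])
        obtain a b where ab: "a \<in> {1, - 1}" "b \<in> {1, - 1}" "terminal_class a b z"
          by (rule terminal_class_exists[OF z(1,4)])
        have "t \<in> A a b" using z ab by (auto simp: A_def good_def)
        then obtain d where d: "d \<in> D a b" "t \<le> d" using D(3) by blast
        have t0: "0 < t" by (rule opt_curveD(1)[OF z(1)])
        have Zd: "opt_curve d (Z a b d)" "singular_at d (Z a b d d)" "terminal_class a b (Z a b d)"
          using Z[OF d(1)] by (auto simp: good_def)
        \<comment> \<open>The selected curve of longer duration, restricted to \<open>t\<close>,
          stays in the same class and therefore agrees with \<open>z\<close>.\<close>
        have "z t = Z a b d t"
        proof (rule same_class_eq[OF z(1) opt_curve_restrict[OF Zd(1) t0 d(2)] z(4) _ ab(3) Zd(3)])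
          show "singular_at t (Z a b d t)" by (rule singular_at_along[OF Zd(1,2)]) (use d t0 in auto)
        qed (use t0 in auto)
        then have "x = (\<lambda>s. Z a b d (max 0 (min d s))) t" using z(2) t0 d(2) by simp
        moreover have "(\<lambda>s. Z a b d (max 0 (min d s))) \<in> Fs"
          unfolding Fs_def fs_def using ab(1,2) d(1) by blast
        ultimately show ?thesis by blast
      qed (auto simp: Fs_def)
    qed
  qed
qed

text \<open>Along an optimal curve the parameter is the value of \<open>T\<close>, so a short piece
  of it is a nondegenerate connected set of singular points.\<close>

lemma singular_set_positive_near_curve:
  assumes tau: "\<tau> < Tc" and opt: "opt_curve t z" and S: "singular_at t (z t)" "t \<le> \<tau>" and c: "c \<in> {0..t}"
  shows "hausdorff1 (singular_set \<tau> \<inter> ball (z c) 1) > 0"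
proof -
  note o = opt_curveD[OF opt]
  obtain d where d: "d > 0" "\<And>s. s \<in> {0..t} \<Longrightarrow> dist s c < d \<Longrightarrow> dist (z s) (z c) < 1"
    using o(4) c unfolding continuous_on_iff by (metis zero_less_one)
  define a b where "a = max 0 (c - d / 2)" and "b = min t (c + d / 2)"
  have ab: "a < b" "{a..b} \<subseteq> {0..t}" using c d o(1) by (auto simp: a_def b_def)
  have 1: "z s \<in> ball (z c) 1" if "s \<in> {a..b}" for s
  proof -
    have "dist s c < d" using that d(1) by (auto simp: a_def b_def dist_real_def)
    then have "dist (z s) (z c) < 1" using that ab by (intro d(2)) auto
    then show ?thesis by (simp add: dist_commute)
  qed
  have 2: "z s \<in> singular_set \<tau>" if "s \<in> {a..b}" for s
    unfolding singular_set_iff[OF tau] using o(5)[of s] singular_at_along[OF opt S(1), of s] that ab S(2) by (intro exI[of _ s]) auto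
  have "ennreal (dist (z a) (z b)) \<le> hausdorff1 (singular_set \<tau> \<inter> ball (z c) 1)"
  proof (rule connected_dist_le_hausdorff1[of "z ` {a..b}"])
    show "connected (z ` {a..b})" by (intro connected_continuous_image continuous_on_subset[OF o(4)] ab) auto
  qed (use 1 2 ab in auto)
  moreover have "z a \<noteq> z b"
  proof
    assume "z a = z b"
    then have "ereal a = ereal b" using o(5)[of a] o(5)[of b] ab by auto
    then show False using ab by simp
  qed
  ultimately show ?thesis by (metis dist_pos_lt ennreal_less_zero_iff less_le_trans)
qed

end

section \<open>Singular points near a singular origin\<close>

text \<open>Here \<open>b\<close> is the determinant with the velocity, \<open>a\<close> the
  tangential displacement, \<open>d\<close> the size of the full one and \<open>ph\<close> the total
  deviation of the control. The choice of \<open>k\<close> lets the gain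
  \<open>c / 2 * s * ph\<close> absorb the cross term \<open>8 * k * B * ph * \<bar>a\<bar>\<close>,
  because \<open>\<bar>a\<bar> \<le> 2 * B * s\<close>. The decreasing weight
  \<open>2 - La * s\<close> contributes \<open>- k * La * a\<^sup>2\<close>, which pays for the
  remaining quadratic terms.\<close>

lemma lyapunov_rate:
  fixes a b d a' b' :: real
  assumes b': "b' \<le> 2 * B * \<bar>b\<bar> + B * K * d\<^sup>2 - c / 2 * s * ph" and a': "\<bar>a'\<bar> \<le> B * d + 2 * B * ph"
    and d: "\<bar>a\<bar> \<le> d" "d \<le> 2 * B * s" "d \<le> m * (\<bar>a\<bar> + \<bar>b\<bar>)" and small: "\<bar>a\<bar> \<le> 1" "\<bar>b\<bar> \<le> 1"
    and pos: "B > 0" "K \<ge> 0" "c > 0" "m > 0" "ph \<ge> 0" "s \<ge> 0"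
    and k: "k = c / (32 * B\<^sup>2)" and N: "N = 2 * B + 2 * B * K * m\<^sup>2 + 4 * k * B * m"
    and La: "La = (N + 2 * k * N) / k" "0 \<le> La * s" "La * s \<le> 1"
    and V: "V = b + k * (2 - La * s) * a\<^sup>2" "V > 0"
  shows "b' - k * La * a\<^sup>2 + k * (2 - La * s) * (2 * a * a') \<le> N * V"
proof -
  have k0: "k > 0" using pos by (simp add: k)
  have N0: "N > 0" unfolding N using pos k0 by (intro add_pos_nonneg) auto
  have d0: "d \<ge> 0" using d(1) by simp
  have aa: "a * a' \<le> \<bar>a\<bar> * (B * d + 2 * B * ph)"
  proof -
    have "a * a' \<le> \<bar>a\<bar> * \<bar>a'\<bar>" by (metis abs_ge_self abs_mult)
    also have "\<dots> \<le> \<bar>a\<bar> * (B * d + 2 * B * ph)" using a' by (intro mult_left_mono) auto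
    finally show ?thesis .
  qed
  have "k * (2 - La * s) * (2 * a * a') = (2 * k * (2 - La * s)) * (a * a')" by simp
  also have "\<dots> \<le> (2 * k * (2 - La * s)) * (\<bar>a\<bar> * (B * d + 2 * B * ph))"
    using aa k0 La(2,3) by (intro mult_left_mono) auto
  also have "\<dots> \<le> (2 * k * 2) * (\<bar>a\<bar> * (B * d + 2 * B * ph))"
    using k0 La(2,3) pos d0 by (intro mult_right_mono) auto
  also have "\<dots> = 4 * k * B * (\<bar>a\<bar> * d) + 8 * k * B * ph * \<bar>a\<bar>" by (simp add: algebra_simps)
  also have "8 * k * B * ph * \<bar>a\<bar> \<le> 8 * k * B * ph * (2 * B * s)"
    using d k0 pos by (intro mult_left_mono) auto
  also have "8 * k * B * ph * (2 * B * s) = c / 2 * s * ph"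
    using pos by (simp add: k power2_eq_square)
  finally have 1: "k * (2 - La * s) * (2 * a * a') \<le> 4 * k * B * (\<bar>a\<bar> * d) + c / 2 * s * ph" by simp
  have ab: "\<bar>a\<bar> * \<bar>b\<bar> \<le> \<bar>b\<bar>" using small by (simp add: mult_left_le_one_le)
  have "\<bar>a\<bar> * d \<le> \<bar>a\<bar> * (m * (\<bar>a\<bar> + \<bar>b\<bar>))" using d by (intro mult_left_mono) auto
  also have "\<dots> = m * (a\<^sup>2 + \<bar>a\<bar> * \<bar>b\<bar>)"
    by (simp add: algebra_simps power2_eq_square)
  also have "\<dots> \<le> m * (a\<^sup>2 + \<bar>b\<bar>)" using ab pos by (intro mult_left_mono) auto
  finally have 2: "4 * k * B * (\<bar>a\<bar> * d) \<le> 4 * k * B * (m * (a\<^sup>2 + \<bar>b\<bar>))"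
    using k0 pos by (intro mult_left_mono) auto
  have "d\<^sup>2 \<le> (m * (\<bar>a\<bar> + \<bar>b\<bar>))\<^sup>2" using d d0 by (intro power_mono) auto
  also have "\<dots> \<le> 2 * m\<^sup>2 * (a\<^sup>2 + b\<^sup>2)"
  proof -
    have "(\<bar>a\<bar> + \<bar>b\<bar>)\<^sup>2 \<le> 2 * (a\<^sup>2 + b\<^sup>2)"
      using zero_le_power2[of "\<bar>a\<bar> - \<bar>b\<bar>"] by (simp add: power2_eq_square algebra_simps)
    then have "m\<^sup>2 * (\<bar>a\<bar> + \<bar>b\<bar>)\<^sup>2 \<le> m\<^sup>2 * (2 * (a\<^sup>2 + b\<^sup>2))" by (intro mult_left_mono) auto
    then show ?thesis by (simp only: power_mult_distrib mult_ac)
  qed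
  also have "\<dots> \<le> 2 * m\<^sup>2 * (a\<^sup>2 + \<bar>b\<bar>)"
  proof -
    have "b\<^sup>2 = \<bar>b\<bar> * \<bar>b\<bar>" by (simp add: power2_eq_square)
    also have "\<dots> \<le> \<bar>b\<bar>" using small(2) by (rule mult_left_le_one_le[OF abs_ge_zero abs_ge_zero])
    finally show ?thesis by (intro mult_left_mono) auto
  qed
  finally have 3: "B * K * d\<^sup>2 \<le> B * K * (2 * m\<^sup>2 * (a\<^sup>2 + \<bar>b\<bar>))"
    using pos by (intro mult_left_mono) auto
  have "b' - k * La * a\<^sup>2 + k * (2 - La * s) * (2 * a * a')
     \<le> 2 * B * \<bar>b\<bar> + B * K * (2 * m\<^sup>2 * (a\<^sup>2 + \<bar>b\<bar>)) + 4 * k * B * (m * (a\<^sup>2 + \<bar>b\<bar>)) - k * La * a\<^sup>2"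
    using b' 1 2 3 by linarith
  also have "\<dots> = N * \<bar>b\<bar> + (N - 2 * B) * a\<^sup>2 - k * La * a\<^sup>2" by (simp add: N algebra_simps)
  also have "\<dots> \<le> N * \<bar>b\<bar> + N * a\<^sup>2 - k * La * a\<^sup>2"
    using pos by (simp add: mult_right_mono)
  \<comment> \<open>In \<open>k * La = N + 2 * k * N\<close> the first \<open>N\<close> cancels the
    quadratic terms. The second handles a negative \<open>b\<close>, where \<open>V > 0\<close> only
    bounds \<open>\<bar>b\<bar>\<close> by the quadratic part of \<open>V\<close>.\<close>
  also have "\<dots> = N * (\<bar>b\<bar> - 2 * k * a\<^sup>2)"
  proof -
    have "k * La = N + 2 * k * N" using k0 La(1) by simp
    then show ?thesis by (simp add: algebra_simps)
  qed
  also have "\<dots> \<le> N * V"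
  proof (rule mult_left_mono)
    have t: "k * (2 - La * s) * a\<^sup>2 \<le> k * 2 * a\<^sup>2"
      using k0 La(2,3) by (intro mult_right_mono mult_left_mono) auto
    have u: "k * (2 - La * s) * a\<^sup>2 \<ge> 0" using k0 La(2,3) by simp
    have "\<bar>b\<bar> \<le> V + k * (2 - La * s) * a\<^sup>2" using V u by linarith
    then show "\<bar>b\<bar> - 2 * k * a\<^sup>2 \<le> V" using t by linarith
  qed (use N0 in simp)
  finally show ?thesis .
qed

lemma finite_positive_lower_bound:
  fixes f :: "nat \<Rightarrow> real"
  assumes "\<And>i. i < n \<Longrightarrow> f i > 0"
  shows "\<exists>m>0. \<forall>i<n. m \<le> f i"
  using assms
proof (induction n)
  case (Suc n)
  then obtain m where "m > 0" "\<forall>i<n. m \<le> f i" by auto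
  then show ?case using Suc.prems[of n] by (intro exI[of _ "min m (f n)"]) (auto simp: less_Suc_eq)
qed (auto intro: exI[of _ 1])

lemma right_derivative_negative:
  fixes f :: "real \<Rightarrow> real"
  assumes d: "(f has_real_derivative D) (at 0 within {0..h})" and "f 0 = 0" "D < 0" "h > 0"
  shows "\<exists>s1>0. \<forall>s\<in>{0..s1}. f s \<le> D / 2 * s"
proof -
  have "((\<lambda>s. (f s - f 0) / (s - 0)) \<longlongrightarrow> D) (at 0 within {0..h})"
    using d by (simp add: has_field_derivative_iff)
  then have "eventually (\<lambda>s. (f s - f 0) / (s - 0) < D / 2) (at 0 within {0..h})"
    using \<open>D < 0\<close> by (intro order_tendstoD(2)[of _ D]) auto
  then obtain d where d: "d > 0" "\<forall>s\<in>{0..h}. s \<noteq> 0 \<and> dist s 0 < d \<longrightarrow> (f s - f 0) / (s - 0) < D / 2"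
    unfolding eventually_at by blast
  show ?thesis
  proof (intro exI[of _ "min h (d / 2)"] conjI ballI)
    show "min h (d / 2) > 0" using d \<open>h > 0\<close> by simp
    fix s assume s: "s \<in> {0..min h (d / 2)}"
    show "f s \<le> D / 2 * s"
    proof (cases "s = 0")
      case False
      then have "(f s - f 0) / (s - 0) < D / 2" using bspec[OF d(2), of s] s d(1) by auto
      then show ?thesis using False s \<open>f 0 = 0\<close> by (simp add: field_simps)
    qed (use \<open>f 0 = 0\<close> in simp)
  qed
qed

section \<open>Singular points produced by a singular origin\<close>

context control_system
begin

text \<open>A point of \<open>R r\<close> may have minimum time below \<open>r\<close>. The origin
  is an equilibrium of the zero control, so the curve can wait there first, and all competitors live
  on the same interval \<open>{0..r}\<close>.\<close>

lemma padded_curve: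
  assumes r: "0 < r" "r < Tc" and x: "x \<in> R r"
  obtains Z P where "Z 0 = 0" "Z r = x" "continuous_on {0..r} Z" "finite P"
    "\<And>s. s \<in> {0<..<r} - P \<Longrightarrow> \<exists>w. ctrl w \<and> (Z has_vector_derivative - fv w (Z s)) (at s)"
proof (cases "x = 0")
  case True
  have "ctrl (\<lambda>_. 0)" by (simp add: ctrl_def)
  moreover have "fv (\<lambda>_. 0) 0 = 0" by (simp add: fv_def F0)
  ultimately show ?thesis using True
    by (intro that[of "\<lambda>_. 0" "{}"]) (auto intro!: exI[of _ "\<lambda>_. 0"])
next
  case False
  obtain t z where z: "opt_curve t z" "z t = x" "t \<le> r"
    using optimal_curve_exists[OF r x False] by metis
  note o = opt_curveD[OF z(1)]
  obtain P where P: "finite P" "\<forall>s\<in>{0<..<t} - P. \<exists>v. ctrl v \<and> (z has_vector_derivative - fv v (z s)) (at s)"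
    using o(8) by blast
  define Z where "Z s = z (max 0 (s - (r - t)))" for s
  show ?thesis
  proof (rule that[of Z "insert (r - t) ((\<lambda>p. p + (r - t)) ` P)"])
    show "Z 0 = 0" "Z r = x" using z o(1,3) by (auto simp: Z_def)
    show "continuous_on {0..r} Z" unfolding Z_def
      by (rule continuous_on_compose2[OF o(4)]) (use z o(1) in \<open>auto intro!: continuous_intros\<close>)
    fix s assume s: "s \<in> {0<..<r} - insert (r - t) ((\<lambda>p. p + (r - t)) ` P)"
    show "\<exists>w. ctrl w \<and> (Z has_vector_derivative - fv w (Z s)) (at s)"
    proof (cases "s < r - t")
      case True
      have "(Z has_vector_derivative 0) (at s)"
      proof (rule has_vector_derivative_transform_within_open[where S="{..<r - t}" and f="\<lambda>_. z 0"])
        fix y assume "y \<in> {..<r - t}"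
        then show "z 0 = Z y" by (simp add: Z_def)
      qed (use True in auto)
      moreover have "Z s = 0" using True o(3) by (simp add: Z_def)
      moreover have "ctrl (\<lambda>_. 0)" by (simp add: ctrl_def)
      moreover have "fv (\<lambda>_. 0) 0 = 0" by (simp add: fv_def F0)
      ultimately show ?thesis by (intro exI[of _ "\<lambda>_. 0"]) auto
    next
      case False
      then have s1: "s > r - t" using s by auto
      have "s - (r - t) \<notin> P" using s by force
      then obtain w where w: "ctrl w" "(z has_vector_derivative - fv w (z (s - (r - t)))) (at (s - (r - t)))"
        using bspec[OF P(2), of "s - (r - t)"] s s1 by auto
      have "((\<lambda>s. s - (r - t)) has_vector_derivative 1) (at s)" by (auto intro!: derivative_eq_intros)
      from vector_diff_chain_at[OF this w(2)]
      have d: "((\<lambda>s. z (s - (r - t))) has_vector_derivative - fv w (z (s - (r - t)))) (at s)" by (simp add: comp_def)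
      have "(Z has_vector_derivative - fv w (z (s - (r - t)))) (at s)"
      proof (rule has_vector_derivative_transform_within_open[OF d, where S="{r - t<..}"])
        fix y assume "y \<in> {r - t<..}"
        then show "z (y - (r - t)) = Z y" by (simp add: Z_def)
      qed (use s1 in auto)
      moreover have "Z s = z (s - (r - t))" using s1 by (simp add: Z_def)
      ultimately show ?thesis using w by auto
    qed
  qed (use P in auto)
qed

text \<open>Since \<open>DG i 0 = 0\<close>, the variation of \<open>G i\<close> near the origin is
  of second order: for \<open>y\<close> and \<open>z - y\<close> of size \<open>s\<close> it is at
  most a multiple of \<open>s\<^sup>2\<close>, negligible against switching functions of size
  \<open>s\<close>.\<close>

lemma G_bounds:
  assumes i: "i < M"
  shows "G i x = fv (\<lambda>j. if j = i then 1 else 0) x - fv (\<lambda>_. 0) x"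
    "norm (G i z - G i y) \<le> 2 * K * (norm y + norm (z - y)) * norm (z - y)"
proof -
  define e where "e = (\<lambda>j::nat. if j = i then 1 else (0::real))"
  have c: "ctrl e" "ctrl (\<lambda>_. 0)" by (auto simp: ctrl_def e_def)
  have G: "G i x = fv e x - fv (\<lambda>_. 0) x" for x
  proof -
    have "(\<Sum>j<M. e j *\<^sub>R G j x) = (\<Sum>j<M. if j = i then G i x else 0)"
      by (rule sum.cong) (auto simp: e_def)
    also have "\<dots> = G i x" using i by (simp add: sum.delta)
    finally show ?thesis by (simp add: fv_def)
  qed
  then show "G i x = fv (\<lambda>j. if j = i then 1 else 0) x - fv (\<lambda>_. 0) x" by (simp add: e_def)
  define h where "h = z - y"
  have r: "norm (fv u z - fv u y - Dv u y h) \<le> K * (norm h)\<^sup>2" if "ctrl u" for u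
    unfolding h_def by (rule fv_remainder[OF that])
  have l: "norm (Dv u y h - DF 0 h) \<le> K * norm y * norm h" if "ctrl u" for u
    using Dv_lipschitz[OF that, of y h 0] by (simp add: Dv_0)
  have norm4: "norm (a1 - a2 + (a3 - a4)) \<le> (m1 + m1) + (m2 + m2)"
    if "norm a1 \<le> m1" "norm a2 \<le> m1" "norm a3 \<le> m2" "norm a4 \<le> m2" for a1 a2 a3 a4 :: "real^2" and m1 m2
    using that norm_triangle_ineq[of "a1 - a2" "a3 - a4"] norm_triangle_ineq4[of a1 a2] norm_triangle_ineq4[of a3 a4]
    by linarith
  have "G i z - G i y = (fv e z - fv e y - Dv e y h) - (fv (\<lambda>_. 0) z - fv (\<lambda>_. 0) y - Dv (\<lambda>_. 0) y h)
      + ((Dv e y h - DF 0 h) - (Dv (\<lambda>_. 0) y h - DF 0 h))" by (simp add: G)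
  also have "norm \<dots> \<le> (K * (norm h)\<^sup>2 + K * (norm h)\<^sup>2) + (K * norm y * norm h + K * norm y * norm h)"
    by (rule norm4[OF r[OF c(1)] r[OF c(2)] l[OF c(1)] l[OF c(2)]])
  also have "\<dots> = 2 * K * (norm y + norm h) * norm h" by (simp add: algebra_simps power2_eq_square)
  finally show "norm (G i z - G i y) \<le> 2 * K * (norm y + norm (z - y)) * norm (z - y)" by (simp add: h_def)
qed

lemma fv_change_control: "fv w x = fv v x + (\<Sum>i<M. (w i - v i) *\<^sub>R G i x)"
  by (simp add: fv_def scaleR_left_diff_distrib sum_subtractf)

text \<open>All \<open>G i 0\<close> are orthogonal to \<open>q\<close>, hence parallel to one line.
  The candidate arc leaves the origin along this line with every control pulling in the same sense;
  that its point at a small time \<open>r\<close> is singular follows by comparison with all curves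
  ending in \<open>R r\<close>.\<close>

lemma singular_set_nonzero:
  assumes tau: "0 < \<tau>" "\<tau> < Tc" and S0: "0 \<in> singular_set \<tau>"
  shows "\<exists>x\<in>singular_set \<tau>. x \<noteq> 0"
proof -
  obtain q where q: "norm q = 1" "hamiltonian F G M 0 q = 0"
    using S0 by (auto simp: singular_set_def)
  have qG: "q \<bullet> G i 0 = 0" if "i < M" for i
    using q(2) that sum_nonneg_eq_0_iff[of "{..<M}" "\<lambda>i. \<bar>q \<bullet> G i 0\<bar>"] by (simp add: hamiltonian_def F0)
  define g where "g = - rot q"
  have rg: "rot g = q" by (simp add: g_def vec_eq_iff forall_2)
  have g: "norm g = 1" using q by (simp add: g_def)
  define ga where "ga i = g \<bullet> G i 0" for i
  have Gg: "G i 0 = ga i *\<^sub>R g" if "i < M" for i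
    using frame_decomposition[OF g, of 1 "G i 0"] qG[OF that] by (simp add: rg ga_def)
  have ga0: "ga i \<noteq> 0" if "i < M" for i using G_nonzero[OF that] Gg[OF that] by auto
  have lin0: "linear (DF 0)" using DF has_derivative_linear by blast
  define ka where "ka = cross2 g (DF 0 g)"
  have ka0: "ka \<noteq> 0"
    using rank_cross[OF M_pos] unfolding Gg[OF M_pos] linear_scale[OF lin0] by (auto simp: ka_def cross2_simps)
  \<comment> \<open>This sign gives the switching functions \<open>psi\<close> a negative slope at
    the origin.\<close>
  define th where "th = - sgn ka"
  have th: "th * th = 1" "th * ka = - \<bar>ka\<bar>" "\<bar>th\<bar> = 1" using ka0 by (auto simp: th_def sgn_if)
  define v where "v i = th * sgn (ga i)" for i
  have v1: "v i * v i = 1" "\<bar>v i\<bar> = 1" if "i < M" for i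
    using ga0[OF that] th by (auto simp: v_def sgn_if)
  have v: "ctrl v" using v1(2) by (simp add: ctrl_def)
  define Ga where "Ga = (\<Sum>i<M. \<bar>ga i\<bar>)"
  have Ga: "Ga > 0" unfolding Ga_def
    by (rule sum_pos) (use M_pos ga0 in auto)
  have fv0: "fv v 0 = (th * Ga) *\<^sub>R g"
  proof -
    have "fv v 0 = (\<Sum>i<M. (th * \<bar>ga i\<bar>) *\<^sub>R g)"
      unfolding fv_def F0 by (auto simp: Gg v_def abs_sgn mult.assoc mult.commute intro!: sum.cong)
    then show ?thesis by (simp add: Ga_def sum_distrib_left scaleR_sum_left)
  qed
  obtain h C0 where h: "h > 0" "\<exists>Z. Z 0 = 0 \<and> backward_arc v Z 0 h"
    using local_backward_solution[of 1] v by (metis norm_zero zero_le_one)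
  then obtain y where y: "y 0 = 0" "backward_arc v y 0 h" by blast
  obtain B where B: "B > 0" "\<And>v x. ctrl v \<Longrightarrow> norm x \<le> 1 \<Longrightarrow> norm (fv v x) \<le> B"
    "\<And>v. ctrl v \<Longrightarrow> B-lipschitz_on (cball 0 1) (fv v)"
    "\<And>v x h. ctrl v \<Longrightarrow> norm x \<le> 1 \<Longrightarrow> norm (Dv v x h) \<le> B * norm h"
    using fv_bounds[of 1] by metis
  have Bl: "norm (fv u x - fv u x') \<le> B * norm (x - x')" if "ctrl u" "norm x \<le> 1" "norm x' \<le> 1" for u x x'
    using lipschitz_onD[OF B(3)[OF that(1)], of x x'] that by (simp add: dist_norm)
  have BG: "norm (G i x) \<le> 2 * B" if "i < M" "norm x \<le> 1" for i x
  proof -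
    have "ctrl (\<lambda>j. if j = i then 1 else 0)" "ctrl (\<lambda>_. 0)" by (auto simp: ctrl_def)
    from B(2)[OF this(1) that(2)] B(2)[OF this(2) that(2)] show ?thesis
      unfolding G_bounds(1)[OF that(1)] using norm_triangle_ineq4 by (smt (verit))
  qed
  text \<open>Along \<^term>\<open>y\<close> the switching functions vanish at the origin with nonzero slope, which is where
    the rank condition enters.\<close>
  define psi where "psi i s = th * v i * cross2 (fv v (y s)) (G i (y s))" for i s
  have psi: "\<exists>s1>0. \<forall>s\<in>{0..s1}. psi i s \<le> - (Ga * \<bar>ga i\<bar> * \<bar>ka\<bar>) / 2 * s" if i: "i < M" for i
  proof (rule right_derivative_negative[OF _ _ _ h(1)])
    have "0 \<in> {0..h}" using h by simp
    then have y': "(y has_vector_derivative - fv v (y 0)) (at 0 within {0..h})"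
      using y(2) by (simp add: backward_arc_def)
    have "((fv v \<circ> y) has_vector_derivative Dv v (y 0) (- fv v (y 0))) (at 0 within {0..h})"
      by (rule vector_derivative_diff_chain_within[OF y' has_derivative_at_withinI[OF fv_derivative]])
    moreover have "((G i \<circ> y) has_vector_derivative DG i (y 0) (- fv v (y 0))) (at 0 within {0..h})"
      by (rule vector_derivative_diff_chain_within[OF y' has_derivative_at_withinI[OF DG[OF i]]])
    ultimately have "((\<lambda>s. cross2 (fv v (y s)) (G i (y s))) has_vector_derivative
        (cross2 (fv v (y 0)) (DG i (y 0) (- fv v (y 0))) + cross2 (Dv v (y 0) (- fv v (y 0))) (G i (y 0)))) (at 0 within {0..h})"
      unfolding comp_def by (rule bounded_bilinear.has_vector_derivative[OF cross2_bilinear])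
    then have "((\<lambda>s. cross2 (fv v (y s)) (G i (y s))) has_real_derivative cross2 (DF 0 (- fv v 0)) (G i 0)) (at 0 within {0..h})"
      by (simp add: has_real_derivative_iff_has_vector_derivative y(1) DG0[OF i] Dv_0 bounded_bilinear.zero_right[OF cross2_bilinear])
    from DERIV_cmult[OF this, of "th * v i"]
    have 1: "(psi i has_real_derivative th * v i * cross2 (DF 0 (- fv v 0)) (G i 0)) (at 0 within {0..h})"
      by (simp add: psi_def[abs_def])
    have "cross2 (DF 0 (- fv v 0)) (G i 0) = th * Ga * ga i * ka"
      unfolding fv0 Gg[OF i] linear_neg[OF lin0] linear_scale[OF lin0] ka_def
      by (subst cross2_commute) (simp add: cross2_simps)
    then have "th * v i * cross2 (DF 0 (- fv v 0)) (G i 0) = (th * th) * (th * ka) * Ga * (sgn (ga i) * ga i)"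
      by (simp add: v_def)
    also have "sgn (ga i) * ga i = \<bar>ga i\<bar>" by (simp add: sgn_if)
    finally have "th * v i * cross2 (DF 0 (- fv v 0)) (G i 0) = - (Ga * \<bar>ga i\<bar> * \<bar>ka\<bar>)"
      unfolding th(1,2) by simp
    then show "(psi i has_real_derivative - (Ga * \<bar>ga i\<bar> * \<bar>ka\<bar>)) (at 0 within {0..h})"
      using 1 by simp
    show "psi i 0 = 0" unfolding psi_def y(1) fv0 Gg[OF i] by (simp add: cross2_simps)
    show "- (Ga * \<bar>ga i\<bar> * \<bar>ka\<bar>) < 0" using Ga ga0[OF i] ka0 by simp
  qed
  obtain gm where gm: "gm > 0" "\<And>i. i < M \<Longrightarrow> gm \<le> \<bar>ga i\<bar>"
    using finite_positive_lower_bound[of M "\<lambda>i. \<bar>ga i\<bar>"] ga0 by auto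
  define c1 where "c1 = Ga * gm * \<bar>ka\<bar> / 2"
  have c1: "c1 > 0" using Ga gm ka0 by (simp add: c1_def)
  from psi obtain sp where sp: "\<And>i. i < M \<Longrightarrow> sp i > 0"
    "\<And>i s. i < M \<Longrightarrow> s \<in> {0..sp i} \<Longrightarrow> psi i s \<le> - (Ga * \<bar>ga i\<bar> * \<bar>ka\<bar>) / 2 * s" by metis
  obtain s1 where s1: "s1 > 0" "\<And>i. i < M \<Longrightarrow> s1 \<le> sp i"
    using finite_positive_lower_bound[of M sp] sp(1) by auto
  have psi1: "psi i s \<le> - c1 * s" if "i < M" "s \<in> {0..s1}" for i s
  proof -
    have "psi i s \<le> - (Ga * \<bar>ga i\<bar> * \<bar>ka\<bar>) / 2 * s" using sp(2)[OF that(1)] s1(2)[OF that(1)] that(2) by auto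
    also have "\<dots> \<le> - (Ga * gm * \<bar>ka\<bar>) / 2 * s"
      using gm(2)[OF that(1)] Ga that(2) by (intro mult_right_mono divide_right_mono) (auto intro!: mult_right_mono mult_left_mono)
    finally show ?thesis by (simp add: c1_def)
  qed
  \<comment> \<open>\<open>m\<close> bounds the displacement by
    \<open>\<bar>a\<bar> + \<bar>b\<bar>\<close>: replacing the velocity at \<open>y s\<close> by
    that at the origin costs at most half of the displacement, whence the factors 2.\<close>
  define m where "m = 2 + 2 / Ga"
  define k where "k = c1 / (32 * B\<^sup>2)"
  define N where "N = 2 * B + 2 * B * K * m\<^sup>2 + 4 * k * B * m"
  define La where "La = (N + 2 * k * N) / k"
  have m: "m > 0" using Ga by (simp add: m_def add_pos_pos)
  have k0: "k > 0" using c1 B by (simp add: k_def)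
  have N0: "N > 0" unfolding N_def using B K_nonneg m k0 by (intro add_pos_nonneg) auto
  have La0: "La > 0" using N0 k0 by (simp add: La_def add_pos_pos)
  \<comment> \<open>The conditions on \<open>r\<close> keep all competitors in the unit ball, make
    \<open>a\<close> and \<open>b\<close> at most 1 in size, keep the weight
    \<open>2 - La * s\<close> at least 1, the velocity near its value at the origin and the effect
    of varying \<open>G i\<close> below half of the slope \<open>c1\<close>.\<close>
  have "\<exists>r>0. r \<le> h \<and> r \<le> s1 \<and> r \<le> \<tau> \<and> 2 * B * r < 1 \<and> 2 * B\<^sup>2 * r \<le> 1 \<and> La * r \<le> 1 \<and>
      B\<^sup>2 * r \<le> Ga / 2 \<and> 12 * K * B ^ 3 * r \<le> c1 / 2"
  proof -
    have small: "\<exists>r0>0. \<forall>r. 0 < r \<and> r \<le> r0 \<longrightarrow> p * r < w" if "p \<ge> 0" "w > 0" for p w :: real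
    proof (intro exI[of _ "w / (p + 1)"] conjI allI impI)
      show "w / (p + 1) > 0" using that by simp
      fix r assume r: "0 < r \<and> r \<le> w / (p + 1)"
      then have "(p + 1) * r \<le> w" using that by (simp add: field_simps)
      then show "p * r < w" using r by (simp add: algebra_simps)
    qed
    obtain r1 where r1: "r1 > 0" "\<And>r. 0 < r \<Longrightarrow> r \<le> r1 \<Longrightarrow> 2 * B * r < 1" using small[of "2 * B" 1] B by auto
    obtain r2 where r2: "r2 > 0" "\<And>r. 0 < r \<Longrightarrow> r \<le> r2 \<Longrightarrow> 2 * B\<^sup>2 * r < 1" using small[of "2 * B\<^sup>2" 1] by auto
    obtain r3 where r3: "r3 > 0" "\<And>r. 0 < r \<Longrightarrow> r \<le> r3 \<Longrightarrow> La * r < 1" using small[of La 1] La0 by auto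
    obtain r4 where r4: "r4 > 0" "\<And>r. 0 < r \<Longrightarrow> r \<le> r4 \<Longrightarrow> B\<^sup>2 * r < Ga / 2" using small[of "B\<^sup>2" "Ga / 2"] Ga by auto
    obtain r5 where r5: "r5 > 0" "\<And>r. 0 < r \<Longrightarrow> r \<le> r5 \<Longrightarrow> 12 * K * B ^ 3 * r < c1 / 2"
      using small[of "12 * K * B ^ 3" "c1 / 2"] K_nonneg B c1 by auto
    define r where "r = min (min h (min s1 \<tau>)) (min (min r1 r2) (min (min r3 r4) r5))"
    have r: "r > 0" "r \<le> h" "r \<le> s1" "r \<le> \<tau>" "r \<le> r1" "r \<le> r2" "r \<le> r3" "r \<le> r4" "r \<le> r5"
      using h(1) s1(1) tau(1) r1(1) r2(1) r3(1) r4(1) r5(1) by (auto simp: r_def min_le_iff_disj)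
    show ?thesis
      using r r1(2)[OF r(1,5)] r2(2)[OF r(1,6)] r3(2)[OF r(1,7)] r4(2)[OF r(1,8)] r5(2)[OF r(1,9)]
      by (intro exI[of _ r]) auto
  qed
  then obtain r where r: "r > 0" "r \<le> h" "r \<le> s1" "r \<le> \<tau>" "2 * B * r < 1" "2 * B\<^sup>2 * r \<le> 1" "La * r \<le> 1"
      "B\<^sup>2 * r \<le> Ga / 2" "12 * K * B ^ 3 * r \<le> c1 / 2" by blast
  have scale: "p * s \<le> u" if "p \<ge> 0" "s \<in> {0..r}" "p * r \<le> u" for p s u :: real
    using that mult_left_mono[of s r p] by auto
  have near: "norm (Z s) \<le> B * s" "norm (Z s) \<le> 1"
    if Z: "Z 0 = 0" "continuous_on {0..r} Z" "finite P"
      "\<And>s. s \<in> {0<..<r} - P \<Longrightarrow> ctrl (w s) \<and> (Z has_vector_derivative - fv (w s) (Z s)) (at s)"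
      and s: "s \<in> {0..r}" for Z P w s
  proof -
    have "norm (Z s - Z 0) \<le> B * s"
      by (rule stays_in_ball[where h=r and R=1 and P=P and z'="\<lambda>s. - fv (w s) (Z s)"])
        (use Z s r B in \<open>auto\<close>)
    then show *: "norm (Z s) \<le> B * s" using Z(1) by simp
    have "B * s \<le> B * r" using scale[OF _ s order.refl, of B] B by simp
    moreover have "B * r < 1" using r(5) mult_pos_pos[OF B(1) r(1)] by simp
    ultimately show "norm (Z s) \<le> 1" using * by linarith
  qed
  have yr: "backward_arc v y 0 r" using backward_arc_subset[OF y(2)] r by auto
  have yn: "norm (y s) \<le> B * s" "norm (y s) \<le> 1" if "s \<in> {0..r}" for s
    using near[of y "{}" "\<lambda>_. v" s] y(1) backward_arc_continuous[OF yr] backward_arc_at[OF yr] v that by auto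
  have f0n: "norm (fv v (y s) - fv v 0) \<le> Ga / 2" if s: "s \<in> {0..r}" for s
  proof -
    have "norm (fv v (y s) - fv v 0) \<le> B * norm (y s)" using Bl[OF v yn(2)[OF s], of 0] by simp
    also have "\<dots> \<le> B * (B * s)" using yn(1)[OF s] B by (intro mult_left_mono) auto
    also have "\<dots> = B\<^sup>2 * s" by (simp add: power2_eq_square)
    also have "\<dots> \<le> Ga / 2" by (rule scale[OF _ s r(8)]) simp
    finally show ?thesis .
  qed
  define x where "x = y r"
  have x0: "x \<noteq> 0"
  proof -
    have "(th *\<^sub>R g) \<bullet> (y 0 - y r) \<ge> (Ga / 2) * (r - 0)"
    proof (rule backward_arc_inner_increment[OF yr])
      fix s assume "s \<in> {0<..<r}"
      then have s: "s \<in> {0..r}" by auto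
      have "(th *\<^sub>R g) \<bullet> fv v 0 = (th * th) * Ga * (norm g)\<^sup>2"
        by (simp add: fv0 power2_norm_eq_inner)
      then have 1: "(th *\<^sub>R g) \<bullet> fv v 0 = Ga" using g th by simp
      have "\<bar>(th *\<^sub>R g) \<bullet> (fv v (y s) - fv v 0)\<bar> \<le> norm (th *\<^sub>R g) * norm (fv v (y s) - fv v 0)"
        by (rule Cauchy_Schwarz_ineq2)
      also have "\<dots> \<le> Ga / 2" using f0n[OF s] g th by simp
      finally show "(th *\<^sub>R g) \<bullet> fv v (y s) \<ge> Ga / 2" using 1 unfolding inner_diff_right by linarith
    qed (use r in auto)
    moreover have "(Ga / 2) * (r - 0) > 0" using Ga r by simp
    ultimately show ?thesis using y(1) by (auto simp: x_def)
  qed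
  have fx: "fv v x \<noteq> 0"
  proof
    assume "fv v x = 0"
    moreover have "norm (fv v x - fv v 0) \<le> Ga / 2" unfolding x_def using f0n[of r] r by auto
    ultimately have "norm (fv v 0) \<le> Ga / 2" by simp
    then show False using Ga g th by (simp add: fv0 abs_mult)
  qed
  have normal: "th * cross2 (fv v x) (z - x) \<le> 0" if z: "z \<in> R r" for z
  proof -
    obtain Z P where Z: "Z 0 = 0" "Z r = z" "continuous_on {0..r} Z" "finite P"
      "\<And>s. s \<in> {0<..<r} - P \<Longrightarrow> \<exists>w. ctrl w \<and> (Z has_vector_derivative - fv w (Z s)) (at s)"
      using padded_curve[OF r(1) _ z] tau(2) r(4) by (metis order.strict_trans1)
    then obtain w where w: "\<And>s. s \<in> {0<..<r} - P \<Longrightarrow> ctrl (w s) \<and> (Z has_vector_derivative - fv (w s) (Z s)) (at s)"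
      by metis
    have Zn: "norm (Z s) \<le> B * s" "norm (Z s) \<le> 1" if "s \<in> {0..r}" for s
      using near[OF Z(1,3,4) w that] by auto
    define de where "de s = Z s - y s" for s
    have den: "norm (de s) \<le> 2 * B * s" if "s \<in> {0..r}" for s
      using Zn(1)[OF that] yn(1)[OF that] norm_triangle_ineq4[of "Z s" "y s"] by (simp add: de_def)
    define a where "a s = th * (g \<bullet> de s)" for s
    define b where "b s = th * cross2 (fv v (y s)) (de s)" for s
    \<comment> \<open>\<open>V\<close> starts at 0 and grows at rate at most \<open>N * V\<close>
      where it is positive, so it stays nonpositive; its quadratic part being nonnegative,
      \<open>b r\<close> is nonpositive, which is the required normality.\<close>
    define V where "V s = b s + k * (2 - La * s) * (a s)\<^sup>2" for s
    define tr where "tr s = Dv v (y s) (axis 1 1) $ 1 + Dv v (y s) (axis 2 1) $ 2" for s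
    define a' where "a' s = - th * (g \<bullet> (fv (w s) (Z s) - fv v (y s)))" for s
    define b' where "b' s = th * (- tr s * cross2 (fv v (y s)) (de s)
        - cross2 (fv v (y s)) (fv (w s) (Z s) - fv v (y s) - Dv v (y s) (de s)))" for s
    have conty: "continuous_on {0..r} y" by (rule backward_arc_continuous[OF yr])
    have "V r \<le> 0 * (r - 0) * exp (N * (r - 0))"
    proof (rule gronwall_upper[OF _ _ _ Z(4), where W=V
          and W'="\<lambda>s. b' s - k * La * (a s)\<^sup>2 + k * (2 - La * s) * (2 * a s * a' s)"])
      show "continuous_on {0..r} V" unfolding V_def a_def b_def de_def
        by (intro continuous_intros bounded_bilinear.continuous_on[OF cross2_bilinear]
            continuous_on_compose2[OF fv_continuous[of UNIV] conty] conty Z(3)) auto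
      show "V 0 \<le> 0" by (simp add: V_def a_def b_def de_def Z(1) y(1) bounded_bilinear.zero_right[OF cross2_bilinear])
      fix s assume s: "s \<in> {0<..<r} - P"
      then have s': "s \<in> {0..r}" "s \<in> {0<..<r}" "s \<in> {0..s1}" "s \<ge> 0" using r by auto
      have cw: "ctrl (w s)" and dZ: "(Z has_vector_derivative - fv (w s) (Z s)) (at s)" using w[OF s] by auto
      have dy: "(y has_vector_derivative - fv v (y s)) (at s)" by (rule backward_arc_at[OF yr s'(2)])
      have db: "(b has_real_derivative b' s) (at s)"
        unfolding b_def[abs_def] b'_def tr_def de_def by (rule DERIV_cmult[OF cross2_velocity_derivative[OF dy dZ]])
      have "((\<lambda>s. g \<bullet> de s) has_vector_derivative (g \<bullet> (- fv (w s) (Z s) - (- fv v (y s))))) (at s)"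
        unfolding de_def
        by (rule bounded_linear.has_vector_derivative[OF bounded_linear_inner_right has_vector_derivative_diff[OF dZ dy]])
      then have "((\<lambda>s. g \<bullet> de s) has_real_derivative (g \<bullet> (- fv (w s) (Z s) - (- fv v (y s))))) (at s)"
        by (simp add: has_real_derivative_iff_has_vector_derivative)
      from DERIV_cmult[OF this, of th]
      have da: "(a has_real_derivative a' s) (at s)" unfolding a_def[abs_def] a'_def
        by (simp add: inner_diff_right algebra_simps)
      show "(V has_real_derivative b' s - k * La * (a s)\<^sup>2 + k * (2 - La * s) * (2 * a s * a' s)) (at s)"
        unfolding V_def[abs_def] using da db by (auto intro!: derivative_eq_intros simp: algebra_simps power2_eq_square)
      assume Vpos: "V s > 0"
      define ph where "ph = (\<Sum>i<M. \<bar>w s i - v i\<bar>)"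
      \<comment> \<open>As \<open>v i\<close> is an extreme control value, every admissible
        deviation from it has the sign of \<open>- v i\<close>.\<close>
      have wv: "w s i - v i = - v i * \<bar>w s i - v i\<bar>" if "i < M" for i
      proof -
        have "v i = 1 \<or> v i = - 1" "\<bar>w s i\<bar> \<le> 1" using v1(2)[OF that] cw that by (auto simp: ctrl_def)
        then show ?thesis by auto
      qed
      have f: "norm (fv v (y s)) \<le> B" by (rule B(2)[OF v yn(2)[OF s'(1)]])
      have de2: "norm (de s) \<le> 2 * B * s" by (rule den[OF s'(1)])
      show "b' s - k * La * (a s)\<^sup>2 + k * (2 - La * s) * (2 * a s * a' s) \<le> N * V s + 0"
      proof -
        have "b' s - k * La * (a s)\<^sup>2 + k * (2 - La * s) * (2 * a s * a' s) \<le> N * V s"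
        proof (rule lyapunov_rate[where d="norm (de s)" and ph=ph and c=c1 and B=B and K=K and m=m and b="b s" and a="a s"])
          define rem where "rem = fv v (Z s) - fv v (y s) - Dv v (y s) (de s)"
          have rem: "norm rem \<le> K * (norm (de s))\<^sup>2" unfolding rem_def de_def by (rule fv_remainder[OF v])
          have eqr: "fv (w s) (Z s) - fv v (y s) - Dv v (y s) (de s) = rem + (\<Sum>i<M. (w s i - v i) *\<^sub>R G i (Z s))"
            unfolding rem_def fv_change_control[of "w s" "Z s" v] by simp
          have b'eq: "b' s = - tr s * b s - th * cross2 (fv v (y s)) rem
              + (\<Sum>i<M. - th * ((w s i - v i) * cross2 (fv v (y s)) (G i (Z s))))"
            unfolding b'_def b_def eqr
            by (simp add: cross2_simps bounded_bilinear.sum_right[OF cross2_bilinear] sum_distrib_left algebra_simps sum_subtractf)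
          have t1: "- tr s * b s \<le> 2 * B * \<bar>b s\<bar>"
          proof -
            have "\<bar>tr s\<bar> \<le> 2 * B" unfolding tr_def by (rule trace_bound[OF B(4)[OF v yn(2)[OF s'(1)]]])
            then have "\<bar>tr s\<bar> * \<bar>b s\<bar> \<le> 2 * B * \<bar>b s\<bar>" by (intro mult_right_mono) auto
            then show ?thesis using abs_ge_minus_self[of "tr s * b s"] by (simp add: abs_mult)
          qed
          have t2: "- th * cross2 (fv v (y s)) rem \<le> B * K * (norm (de s))\<^sup>2"
          proof -
            have "\<bar>th * cross2 (fv v (y s)) rem\<bar> \<le> norm (fv v (y s)) * norm rem"
              unfolding abs_mult th(3) using cross2_le by simp
            also have "\<dots> \<le> B * (K * (norm (de s))\<^sup>2)" using f rem B by (intro mult_mono) auto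
            finally show ?thesis by (simp add: abs_le_iff mult.assoc)
          qed
          have t3: "- th * ((w s i - v i) * cross2 (fv v (y s)) (G i (Z s))) \<le> - (c1 / 2 * s) * \<bar>w s i - v i\<bar>"
            if i: "i < M" for i
          proof -
            define D where "D = G i (Z s) - G i (y s)"
            have "norm D \<le> 2 * K * (norm (y s) + norm (de s)) * norm (de s)"
              unfolding D_def de_def by (rule G_bounds(2)[OF i])
            \<comment> \<open>Both curves are within \<open>B * s\<close> of the origin, hence
              within \<open>2 * B * s\<close> of each other; this produces the constant 12.\<close>
            also have "\<dots> \<le> 2 * K * (B * s + 2 * B * s) * (2 * B * s)"
              using yn(1)[OF s'(1)] de2 K_nonneg B s'(4) by (intro mult_mono mult_left_mono add_mono) auto
            also have "\<dots> = 12 * K * B\<^sup>2 * s\<^sup>2" by (simp add: power2_eq_square)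
            finally have D: "norm D \<le> 12 * K * B\<^sup>2 * s\<^sup>2" .
            have "\<bar>th * v i * cross2 (fv v (y s)) D\<bar> \<le> norm (fv v (y s)) * norm D"
              unfolding abs_mult th(3) v1(2)[OF i] using cross2_le by simp
            also have "\<dots> \<le> B * (12 * K * B\<^sup>2 * s\<^sup>2)" using f D B by (intro mult_mono) auto
            also have "\<dots> = (12 * K * B ^ 3 * s) * s" by (simp add: power2_eq_square power3_eq_cube)
            also have "\<dots> \<le> (c1 / 2) * s"
              by (rule mult_right_mono[OF scale[OF _ s'(1) r(9)] s'(4)]) (use K_nonneg B in auto)
            finally have e: "th * v i * cross2 (fv v (y s)) D \<le> c1 / 2 * s" by simp
            have "th * v i * cross2 (fv v (y s)) (G i (y s)) \<le> - c1 * s"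
              using psi1[OF i s'(3)] by (simp add: psi_def)
            moreover have "cross2 (fv v (y s)) (G i (Z s)) = cross2 (fv v (y s)) (G i (y s)) + cross2 (fv v (y s)) D"
              by (simp add: D_def cross2_simps)
            ultimately have "th * v i * cross2 (fv v (y s)) (G i (Z s)) \<le> - (c1 / 2 * s)"
              using e by (simp add: algebra_simps)
            from mult_left_mono[OF this, of "\<bar>w s i - v i\<bar>"]
            have "\<bar>w s i - v i\<bar> * (th * v i * cross2 (fv v (y s)) (G i (Z s))) \<le> \<bar>w s i - v i\<bar> * (- (c1 / 2 * s))" by simp
            moreover have "- th * ((w s i - v i) * cross2 (fv v (y s)) (G i (Z s)))
                = \<bar>w s i - v i\<bar> * (th * v i * cross2 (fv v (y s)) (G i (Z s)))"
              by (subst wv[OF i]) simp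
            ultimately show ?thesis by (simp add: mult.commute)
          qed
          have "(\<Sum>i<M. - th * ((w s i - v i) * cross2 (fv v (y s)) (G i (Z s)))) \<le> (\<Sum>i<M. - (c1 / 2 * s) * \<bar>w s i - v i\<bar>)"
            using t3 by (intro sum_mono) auto
          also have "\<dots> = - (c1 / 2 * s * ph)" by (simp add: ph_def sum_distrib_left sum_negf)
          finally show "b' s \<le> 2 * B * \<bar>b s\<bar> + B * K * (norm (de s))\<^sup>2 - c1 / 2 * s * ph"
            using t1 t2 unfolding b'eq by simp
          have "fv (w s) (Z s) - fv v (y s) = (fv v (Z s) - fv v (y s)) + (\<Sum>i<M. (w s i - v i) *\<^sub>R G i (Z s))"
            unfolding fv_change_control[of "w s" "Z s" v] by simp
          also have "norm \<dots> \<le> B * norm (de s) + (\<Sum>i<M. \<bar>w s i - v i\<bar> * (2 * B))"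
            using Bl[OF v Zn(2)[OF s'(1)] yn(2)[OF s'(1)]] BG Zn(2)[OF s'(1)]
            by (intro norm_triangle_le add_mono sum_norm_le) (auto simp: de_def intro!: mult_left_mono)
          also have "(\<Sum>i<M. \<bar>w s i - v i\<bar> * (2 * B)) = 2 * B * ph" by (simp add: ph_def sum_distrib_left mult.commute)
          finally have "norm (fv (w s) (Z s) - fv v (y s)) \<le> B * norm (de s) + 2 * B * ph" .
          moreover have "\<bar>a' s\<bar> \<le> norm (fv (w s) (Z s) - fv v (y s))"
            unfolding a'_def abs_mult abs_minus_cancel th(3)
            using Cauchy_Schwarz_ineq2[of g "fv (w s) (Z s) - fv v (y s)"] g by simp
          ultimately show "\<bar>a' s\<bar> \<le> B * norm (de s) + 2 * B * ph" by simp
          show ad: "\<bar>a s\<bar> \<le> norm (de s)"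
            unfolding a_def abs_mult th(3) using Cauchy_Schwarz_ineq2[of g "de s"] g by simp
          show "norm (de s) \<le> 2 * B * s" by (rule de2)
          have "2 * B * s \<le> 1" by (rule scale[OF _ s'(1) less_imp_le[OF r(5)]]) (use B in auto)
          then show "\<bar>a s\<bar> \<le> 1" using ad de2 by simp
          have "\<bar>b s\<bar> \<le> norm (fv v (y s)) * norm (de s)" unfolding b_def abs_mult th(3) using cross2_le by simp
          also have "\<dots> \<le> B * (2 * B * s)" using f de2 B by (intro mult_mono) auto
          also have "\<dots> = 2 * B\<^sup>2 * s" by (simp add: power2_eq_square)
          also have "\<dots> \<le> 1" by (rule scale[OF _ s'(1) r(6)]) simp
          finally show "\<bar>b s\<bar> \<le> 1" .
          show "norm (de s) \<le> m * (\<bar>a s\<bar> + \<bar>b s\<bar>)"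
          proof -
            have "b s - Ga * (q \<bullet> de s) = th * cross2 (fv v (y s) - fv v 0) (de s)"
              unfolding b_def fv0 cross2_simps using th rot_inner[of g "de s"]
              by (simp add: rg algebra_simps)
            moreover have "\<bar>th * cross2 (fv v (y s) - fv v 0) (de s)\<bar> \<le> Ga / 2 * norm (de s)"
              unfolding abs_mult th(3)
              using cross2_le[of "fv v (y s) - fv v 0" "de s"] mult_right_mono[OF f0n[OF s'(1)], of "norm (de s)"] by simp
            ultimately have "Ga * \<bar>q \<bullet> de s\<bar> \<le> \<bar>b s\<bar> + Ga / 2 * norm (de s)"
              using Ga abs_mult[of Ga "q \<bullet> de s"] by linarith
            then have qd: "\<bar>q \<bullet> de s\<bar> \<le> \<bar>b s\<bar> / Ga + norm (de s) / 2" using Ga by (simp add: field_simps)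
            have "de s = (g \<bullet> de s) *\<^sub>R g + (q \<bullet> de s) *\<^sub>R q"
              using frame_decomposition[OF g, of 1 "de s"] by (simp add: rg)
            then have "norm (de s) \<le> \<bar>g \<bullet> de s\<bar> + \<bar>q \<bullet> de s\<bar>"
              using norm_triangle_ineq[of "(g \<bullet> de s) *\<^sub>R g" "(q \<bullet> de s) *\<^sub>R q"] g q by simp
            also have "\<bar>g \<bullet> de s\<bar> = \<bar>a s\<bar>" unfolding a_def abs_mult th(3) by simp
            finally have "norm (de s) \<le> 2 * \<bar>a s\<bar> + 2 / Ga * \<bar>b s\<bar>" using qd by simp
            also have "\<dots> \<le> m * \<bar>a s\<bar> + m * \<bar>b s\<bar>"
              using Ga by (intro add_mono mult_right_mono) (auto simp: m_def)
            finally show ?thesis by (simp add: distrib_left)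
          qed
          show "La * s \<le> 1" by (rule scale[OF _ s'(1) r(7)]) (use La0 in auto)
          show "ph \<ge> 0" by (auto simp: ph_def intro: sum_nonneg)
        qed (use B K_nonneg c1 m s'(4) k_def N_def La_def La0 V_def Vpos in auto)
        then show ?thesis by simp
      qed
    qed (use r N0 in auto)
    then have "V r \<le> 0" by simp
    moreover have "k * (2 - La * r) * (a r)\<^sup>2 \<ge> 0" using k0 r(7) by simp
    ultimately have "b r \<le> 0" by (simp add: V_def)
    then show ?thesis by (simp add: b_def de_def Z(2) x_def)
  qed
  have ham: "th * cross2 (fv v x) (fv v' x) \<ge> 0" if v': "ctrl v'" for v'
  proof -
    have "th * ((v' i - v i) * cross2 (fv v x) (G i x)) \<ge> 0" if i: "i < M" for i
    proof -
      have "v i = 1 \<or> v i = - 1" "\<bar>v' i\<bar> \<le> 1" using v1(2)[OF i] v' i by (auto simp: ctrl_def)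
      then have e: "v' i - v i = - v i * \<bar>v' i - v i\<bar>" by auto
      have "psi i r \<le> - c1 * r" using psi1[OF i] r by auto
      moreover have "c1 * r \<ge> 0" using c1 r by simp
      ultimately have "psi i r \<le> 0" by simp
      then have "\<bar>v' i - v i\<bar> * psi i r \<le> 0" by (simp add: mult_nonneg_nonpos)
      moreover have "th * ((v' i - v i) * cross2 (fv v x) (G i x)) = - (\<bar>v' i - v i\<bar> * psi i r)"
        by (subst e) (simp add: psi_def x_def)
      ultimately show ?thesis by simp
    qed
    then have "(\<Sum>i<M. th * ((v' i - v i) * cross2 (fv v x) (G i x))) \<ge> 0" by (intro sum_nonneg) auto
    then show ?thesis
      unfolding fv_change_control[of v' x v]
      by (simp add: cross2_simps bounded_bilinear.sum_right[OF cross2_bilinear] sum_distrib_left)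
  qed
  \<comment> \<open>The minimum time \<open>t\<close> of \<open>x\<close> might be smaller than
    \<open>r\<close>; normality for \<open>R r\<close> passes to the smaller set \<open>R t\<close>,
    so \<open>x\<close> is singular for its own time.\<close>
  have "x \<in> R (0 + (r - 0))" unfolding x_def
    by (rule backward_arc_in_R[OF yr]) (use r y(1) zero_in_R in auto)
  then have "T x \<le> ereal r" by (simp add: reach_set_def)
  moreover have "0 \<le> T x" by (rule min_time_nonneg)
  ultimately obtain t where t: "T x = ereal t" "0 \<le> t" "t \<le> r" by (cases "T x") auto
  define p where "p = (th / norm (fv v x)) *\<^sub>R rot (fv v x)"
  have p: "p \<bullet> d = (th * cross2 (fv v x) d) / norm (fv v x)" for d by (simp add: p_def rot_inner)
  have "singular_at t x" unfolding singular_at_def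
  proof (intro exI[of _ p] conjI ballI)
    show "norm p = 1" using fx th by (simp add: p_def)
    show "p \<bullet> (z - x) \<le> 0" if "z \<in> R t" for z
      unfolding p using normal[of z] R_mono[OF t(3)] that by (auto simp: divide_nonpos_nonneg)
    show "hamiltonian F G M x p = 0"
      by (rule hamiltonian_zeroI[OF v]) (use ham in \<open>auto simp: p\<close>)
  qed
  then have "x \<in> singular_set \<tau>" unfolding singular_set_iff[OF tau(2)] using t r by auto
  then show ?thesis using x0 by blast
qed

text \<open>A singular origin is treated through a nonzero singular point, whose optimal curve ends
  at the origin.\<close>

lemma singular_set_positive:
  assumes tau: "0 < \<tau>" "\<tau> < Tc" and x: "x \<in> singular_set \<tau>"
  shows "\<exists>\<delta>>0. hausdorff1 (singular_set \<tau> \<inter> ball x \<delta>) > 0"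
proof (cases "x = 0")
  case True
  then obtain x' where x': "x' \<in> singular_set \<tau>" "x' \<noteq> 0" using singular_set_nonzero[OF tau] x by blast
  obtain t z where z: "opt_curve t z" "z t = x'" "t \<le> \<tau>" "singular_at t (z t)"
    by (rule singular_set_curve[OF tau x'])
  have "hausdorff1 (singular_set \<tau> \<inter> ball (z 0) 1) > 0"
    by (rule singular_set_positive_near_curve[OF tau(2) z(1,4,3)]) (use opt_curveD(1)[OF z(1)] in auto)
  then show ?thesis using True opt_curveD(3)[OF z(1)] by (intro exI[of _ 1]) auto
next
  case False
  obtain t z where z: "opt_curve t z" "z t = x" "t \<le> \<tau>" "singular_at t (z t)"
    by (rule singular_set_curve[OF tau x False])
  have "hausdorff1 (singular_set \<tau> \<inter> ball (z t) 1) > 0"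
    by (rule singular_set_positive_near_curve[OF tau(2) z(1,4,3)]) (use opt_curveD(1)[OF z(1)] in auto)
  then show ?thesis using z(2) by (intro exI[of _ 1]) auto
qed

end

theorem theorem5p2:
  fixes F :: "real^2 \<Rightarrow> real^2" and G :: "nat \<Rightarrow> real^2 \<Rightarrow> real^2"
    and DF :: "real^2 \<Rightarrow> real^2 \<Rightarrow> real^2" and DG :: "nat \<Rightarrow> real^2 \<Rightarrow> real^2 \<Rightarrow> real^2"
    and M :: nat and L Tc \<tau> :: real
  assumes M: "M \<in> {1, 2}"
    and DF: "\<And>x. (F has_derivative DF x) (at x)"
    and DG: "\<And>i x. i < M \<Longrightarrow> (G i has_derivative DG i x) (at x)"
    and F_lip: "\<And>x y j k. \<bar>DF x (axis j 1) $ k - DF y (axis j 1) $ k\<bar> \<le> L * norm (x - y)"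
    and G_lip: "\<And>i x y j k. i < M \<Longrightarrow>
                  \<bar>DG i x (axis j 1) $ k - DG i y (axis j 1) $ k\<bar> \<le> L * norm (x - y)"
    and F0: "F 0 = 0"
    and rank: "\<And>i. i < M \<Longrightarrow> rank (transpose (vector [G i 0, DF 0 (G i 0)] :: real^2^2)) = 2"
    and DG0: "\<And>i. i < M \<Longrightarrow> DG i 0 = (\<lambda>v. 0)"
    and Tc: "good_horizon F G M Tc"
    and tau: "0 < \<tau>" "\<tau> < Tc"
  defines "S \<equiv> {x \<in> reach_set F G M (ereal \<tau>).
                  \<exists>\<zeta>. norm \<zeta> = 1 \<and> \<zeta> \<in> prox_normal (reach_set F G M (min_time F G M x)) x \<and>
                      hamiltonian F G M x \<zeta> = 0}"
  shows "countably_H1_rectifiable S \<and>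
         (\<forall>xb\<in>S. \<exists>\<delta>>0. hausdorff1 (S \<inter> ball xb \<delta>) > 0)"
proof -
  interpret control_system F G DF DG M L Tc
    by unfold_locales (fact M DF DG F_lip G_lip F0 rank DG0 Tc)+
  have "S = singular_set \<tau>" unfolding S_def singular_set_def ..
  then show ?thesis using singular_set_rectifiable[OF tau] singular_set_positive[OF tau] by simp
qed

end
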